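(* For every integer $k\ge 3$, \[ \max\left\{\frac{k-2}{e\,((k-2)!)^{1/(k-2)}},\ \log\mu_k^{\mathrm S}\right\}\le\gamma_k\le\mu_k^{\mathrm S}-1\le 1. \] Consequently, \[ 0.438899884\ldots<\gamma_3\le 0.889881574\ldots. \] Furthermore, $\gamma_k$ is nondecreasing in $k$ and $\gamma_k\to1$ as $k\to\infty$; more precisely, with $r=k-2$, \[ \gamma_k\ge\frac{r}{e(r!)^{1/r}}=1-\frac{\log(2\pi r)}{2r}+O\!\left(\frac{(\log r)^2}{r^2}\right). \]
   Context: Write $[N]=\{1,\dots,N\}$; $\log$ is the natural logarithm and $e$ its base. A set $A\subseteq[N]$ is LCM-$k$-free if it contains no $k$ distinct integers $a_1,\dots,a_k$ for which $\operatorname{lcm}(a_i,a_j)$ is the same for all pairs $1\le i<j\le k$. Let $f_k(N):=\max\{\sum_{a\in A}1/a : A\subseteq[N]\text{ is LCM-}k\text{-free}\}$, and \[ \gamma_k:=\lim_{N\to\infty}\frac{\log f_k(N)}{\log\log N}, \] a limit which exists for every fixed integer $k\ge3$. Distinct sets $S_1,\dots,S_k$ form a $k$-sunflower if their pairwise intersections $S_i\cap S_j$ ($i\ne j$) are all equal; a family is $k$-sunflower-free if no $k$ distinct members form a $k$-sunflower. Let $F_k(n)$ be the largest cardinality of a $k$-sunflower-free family of subsets of $[n]$, and $\mu_k^{\mathrm S}:=\lim_{n\to\infty}F_k(n)^{1/n}$ (this limit exists). The $O$-term refers to $r\to\infty$. *)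

theory Defs
  imports Complex_Main "HOL-Library.Landau_Symbols"
begin

text \<open>
  Throughout, \<open>k\<close> distinct objects are represented by a set \<open>T\<close> with \<open>card T = k\<close>; for
  \<open>k \<ge> 1\<close> such a \<open>T\<close> is finite.
\<close>

definition lcm_free :: "nat \<Rightarrow> nat set \<Rightarrow> bool" where
  "lcm_free k A \<longleftrightarrow>
    \<not> (\<exists>T. T \<subseteq> A \<and> card T = k \<and> (\<exists>m. pairwise (\<lambda>a b. lcm a b = m) T))"

definition lcm_free_max :: "nat \<Rightarrow> nat \<Rightarrow> real" where
  "lcm_free_max k N = Max {(\<Sum>a\<in>A. 1 / real a) |A. A \<subseteq> {1..N} \<and> lcm_free k A}"

text \<open>
  For a divergent sequence \<^const>\<open>lim\<close> is an unspecified value, so any bound on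
  the next constant, or on \<open>sunflower_mu\<close> below, carries the existence of the limit with it.
\<close>

definition lcm_gamma :: "nat \<Rightarrow> real" where
  "lcm_gamma k = lim (\<lambda>N. ln (lcm_free_max k N) / ln (ln (real N)))"

definition sunflower :: "nat \<Rightarrow> 'a set set \<Rightarrow> bool" where
  "sunflower k T \<longleftrightarrow> card T = k \<and> (\<exists>C. pairwise (\<lambda>S S'. S \<inter> S' = C) T)"

definition sunflower_free :: "nat \<Rightarrow> 'a set set \<Rightarrow> bool" where
  "sunflower_free k F \<longleftrightarrow> \<not> (\<exists>T. T \<subseteq> F \<and> sunflower k T)"

definition sunflower_free_max :: "nat \<Rightarrow> nat \<Rightarrow> nat" where
  "sunflower_free_max k n = Max {card F |F. F \<subseteq> Pow {1..n} \<and> sunflower_free k F}"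

definition sunflower_mu :: "nat \<Rightarrow> real" where
  "sunflower_mu k = lim (\<lambda>n. root n (real (sunflower_free_max k n)))"

text \<open>
  The two decimal constants bounding \<open>\<gamma>\<^sub>3\<close> are the logarithm of the lower bound \<open>1.551\<close>
  for \<open>\<mu>\<^sub>3\<close> (Deuber, Erdos, Gunderson, Kostochka, Meyer) and the upper bound
  \<open>3 / 2 powr (2/3)\<close> for \<open>\<mu>\<^sub>3\<close> (Naslund, Sawin) minus one.
\<close>

definition gamma3_lower :: real where
  "gamma3_lower = ln (1551 / 1000)"

definition gamma3_upper :: real where
  "gamma3_upper = 3 / 2 powr (2 / 3) - 1"

end

theory Submission
  imports Defs "HOL-Analysis.Analysis" "HOL-Computational_Algebra.Computational_Algebra"
    "HOL-Real_Asymp.Real_Asymp"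
begin

text \<open>
  Taking complements turns sunflowers into families with equal pairwise unions, and sets of
  primes turn unions into least common multiples. For a finite set \<open>I\<close> with weights \<open>w\<close> and an
  antichain \<open>F\<close> of subsets of \<open>I\<close> without \<open>k\<close> members whose pairwise unions agree, consider
  \<open>ln (\<Sum>X\<in>F. \<Prod>i\<in>X. w i) / sum w I\<close>. The exponent \<open>\<gamma>\<^sub>k\<close> exists and is the supremum of these
  quotients. For the lower bound, replace every point by a class of primes whose reciprocals sum
  up to its weight, and take products over disjoint blocks of primes; for the upper bound,
  decompose an LCM-free set by the square part of its members and then into layers.

  Constant weights 1 give \<open>ln \<mu>\<^sub>k \<le> \<gamma>\<^sub>k\<close>, and all \<open>(k - 2)\<close>-subsets of a large set give the
  explicit lower bound. Choosing every prime \<open>p\<close> with probability \<open>1/p\<close> gives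
  \<open>\<gamma>\<^sub>k \<le> \<mu>\<^sub>k - 1\<close>. The slice rank method bounds \<open>\<mu>\<^sub>3\<close> from above (Naslund, Sawin), and a
  recursive construction with two types of sets bounds \<open>\<gamma>\<^sub>3\<close> from below.
\<close>

section \<open>Union-free families and blow-ups\<close>

text \<open>The normalisation by \<open>sum w I\<close> reflects that the primes up to
  \<open>y\<close> carry reciprocal mass about \<open>ln (ln y)\<close>: roughly
  \<open>ln (ln y) / sum w I\<close> disjoint copies of a weighted family fit, and each copy
  multiplies the reciprocal sum by the weight of the family. Conversely, the members of an LCM-free
  set with a fixed square part form a weighted family over primes of just this mass. Both directions
  therefore meet in one supremum, which is how existence of the limit is obtained. The obstacle is
  that union-freeness alone does not survive products: for \<open>{{}, {a}}\<close> and
  \<open>{{}, {b}}\<close> the product contains \<open>{a}\<close>, \<open>{b}\<close>,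
  \<open>{a, b}\<close>, whose pairwise unions agree. Antichains repair this, and they come cheaply
  because sets of equal size form one: the loss is a factor \<open>n + 1\<close> in counting and a
  constant factor after a slight rescaling of weights, both invisible in the exponent.\<close>

definition union_free :: "nat \<Rightarrow> 'a set set \<Rightarrow> bool" where
  "union_free k F \<longleftrightarrow>
    \<not> (\<exists>T. T \<subseteq> F \<and> card T = k \<and> (\<exists>U. pairwise (\<lambda>X Y. X \<union> Y = U) T))"

definition antichain :: "'a set set \<Rightarrow> bool" where
  "antichain F \<longleftrightarrow> (\<forall>X\<in>F. \<forall>Y\<in>F. X \<subseteq> Y \<longrightarrow> X = Y)"

definition free_antichain :: "nat \<Rightarrow> 'a set set \<Rightarrow> bool" where
  "free_antichain k F \<longleftrightarrow> union_free k F \<and> antichain F"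

text \<open>With weights 1 this is the cardinality; with \<open>1 / real p\<close> on sets of primes
  it is the reciprocal sum of the products of the members.\<close>

definition fam_weight :: "('a \<Rightarrow> real) \<Rightarrow> 'a set set \<Rightarrow> real" where
  "fam_weight w F = (\<Sum>X\<in>F. \<Prod>x\<in>X. w x)"

lemma union_freeD:
  "union_free k F \<Longrightarrow> T \<subseteq> F \<Longrightarrow> card T = k \<Longrightarrow> pairwise (\<lambda>X Y. X \<union> Y = U) T \<Longrightarrow> False"
  unfolding union_free_def by blast

lemma union_free_subset: "union_free k F \<Longrightarrow> G \<subseteq> F \<Longrightarrow> union_free k G"
  unfolding union_free_def by blast

lemma antichainD: "antichain F \<Longrightarrow> X \<in> F \<Longrightarrow> Y \<in> F \<Longrightarrow> X \<subseteq> Y \<Longrightarrow> X = Y"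
  unfolding antichain_def by blast

lemma union_free_mono:
  assumes "union_free k F" "k \<le> l"
  shows "union_free l F"
  unfolding union_free_def
proof safe
  fix T U assume T: "T \<subseteq> F" "l = card T" "pairwise (\<lambda>X Y. X \<union> Y = U) T"
  obtain T' where T': "T' \<subseteq> T" "card T' = k"
    using obtain_subset_with_card_n[of k T] assms(2) T(2) by blast
  show False
    using union_freeD[OF assms(1), of T' U] T T' pairwise_subset by blast
qed

lemma antichain_uniform:
  assumes "\<And>X. X \<in> F \<Longrightarrow> finite X \<and> card X = r"
  shows "antichain F"
  unfolding antichain_def using assms card_subset_eq by metis

lemma card_ge_3_obtain:
  assumes "3 \<le> card T"
  obtains Z where "Z \<in> T" "Z \<noteq> X" "Z \<noteq> Y"
proof -
  have "card {X, Y} \<le> 2" by (simp add: card_insert_if)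
  then have "\<not> T \<subseteq> {X, Y}"
    using assms card_mono[of "{X, Y}" T] by fastforce
  then show ?thesis using that by blast
qed

text \<open>A point of the union is missing from at most one member.\<close>

lemma sunflower_common_member:
  assumes "3 \<le> card T" "pairwise (\<lambda>X Y. X \<union> Y = U) T" "p \<in> U" "q \<in> U"
  obtains X where "X \<in> T" "p \<in> X" "q \<in> X"
proof -
  have one: "x \<in> X \<or> x \<in> Y" if "X \<in> T" "Y \<in> T" "X \<noteq> Y" "x \<in> U" for X Y x
    using assms(2) that by (auto simp: pairwise_def)
  obtain X where X: "X \<in> T" using card_ge_3_obtain[OF assms(1)] by blast
  obtain Y where Y: "Y \<in> T" "Y \<noteq> X" using card_ge_3_obtain[OF assms(1)] by blast
  obtain Z where Z: "Z \<in> T" "Z \<noteq> X" "Z \<noteq> Y" using card_ge_3_obtain[OF assms(1)] by blast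
  show ?thesis
    using one[of X Y] one[of X Z] one[of Y Z] X Y Z assms(3,4) that by metis
qed

text \<open>The colouring \<open>c\<close> replaces a point \<open>i\<close> by its colour class in
  \<open>P\<close>; injectivity makes a set pick exactly one representative for each colour of some
  member of \<open>F\<close>.\<close>

definition blowup :: "('a \<Rightarrow> 'b) \<Rightarrow> 'a set \<Rightarrow> 'b set set \<Rightarrow> 'a set set" where
  "blowup c P F = {X. X \<subseteq> P \<and> inj_on c X \<and> c ` X \<in> F}"

text \<open>Any two points of the common union lie in one member, on which \<open>c\<close> is
  injective. Hence \<open>c\<close> is injective on the whole union and carries the configuration to
  one in \<open>F\<close> without merging members.\<close>

lemma union_free_blowup:
  assumes "union_free k F" "3 \<le> k"
  shows "union_free k (blowup c P F)"
  unfolding union_free_def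
proof safe
  fix T U assume T: "T \<subseteq> blowup c P F" "k = card T" and pw: "pairwise (\<lambda>X Y. X \<union> Y = U) T"
  have T3: "3 \<le> card T" using T assms by simp
  have sub: "X \<subseteq> U" if "X \<in> T" for X
  proof -
    obtain Y where "Y \<in> T" "Y \<noteq> X" using card_ge_3_obtain[OF T3] by blast
    then show ?thesis using pw that by (auto simp: pairwise_def)
  qed
  have inj: "inj_on c U"
  proof (rule inj_onI)
    fix p q assume pq: "p \<in> U" "q \<in> U" "c p = c q"
    obtain X where "X \<in> T" "p \<in> X" "q \<in> X"
      using sunflower_common_member[OF T3 pw pq(1,2)] by blast
    then show "p = q" using T(1) pq(3) by (auto simp: blowup_def inj_on_def)
  qed
  have injT: "inj_on ((`) c) T"
    by (intro inj_onI) (metis inj inj_on_image_eq_iff sub)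
  show False
  proof (rule union_freeD[OF assms(1), of "(`) c ` T" "c ` U"])
    show "(`) c ` T \<subseteq> F" using T(1) by (auto simp: blowup_def)
    show "card ((`) c ` T) = k" using card_image[OF injT] T(2) by simp
    show "pairwise (\<lambda>X Y. X \<union> Y = c ` U) ((`) c ` T)"
    proof (rule pairwiseI)
      fix A B assume "A \<in> (`) c ` T" "B \<in> (`) c ` T" "A \<noteq> B"
      then obtain X Y where XY: "X \<in> T" "Y \<in> T" "X \<noteq> Y" "A = c ` X" "B = c ` Y" by auto
      then have "X \<union> Y = U" using pw by (auto simp: pairwise_def)
      then show "A \<union> B = c ` U" using XY by (simp add: image_Un[symmetric])
    qed
  qed
qed

lemma antichain_blowup:
  assumes "antichain F"
  shows "antichain (blowup c P F)"
  unfolding antichain_def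
proof (intro ballI impI)
  fix X Y assume XY: "X \<in> blowup c P F" "Y \<in> blowup c P F" "X \<subseteq> Y"
  then have "c ` X = c ` Y"
    using antichainD[OF assms, of "c ` X" "c ` Y"] by (auto simp: blowup_def)
  then show "X = Y"
    using XY inj_on_image_eq_iff[of c Y X Y] by (auto simp: blowup_def)
qed

lemma free_antichain_blowup: "free_antichain k F \<Longrightarrow> 3 \<le> k \<Longrightarrow> free_antichain k (blowup c P F)"
  by (simp add: free_antichain_def union_free_blowup antichain_blowup)

text \<open>Expanding the product of the class sums chooses one representative per colour.\<close>

lemma sum_selections:
  fixes v :: "'a \<Rightarrow> real"
  assumes "finite P" "finite S"
  shows "(\<Sum>X | X \<subseteq> P \<and> inj_on c X \<and> c ` X = S. \<Prod>p\<in>X. v p)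
       = (\<Prod>i\<in>S. \<Sum>p\<in>{p\<in>P. c p = i}. v p)"
proof -
  let ?E = "PiE S (\<lambda>i. {p\<in>P. c p = i})"
  have "(\<Prod>i\<in>S. \<Sum>p\<in>{p\<in>P. c p = i}. v p) = (\<Sum>g\<in>?E. \<Prod>i\<in>S. v (g i))"
    using assms by (intro prod_sum_PiE) auto
  also have "\<dots> = (\<Sum>X | X \<subseteq> P \<and> inj_on c X \<and> c ` X = S. \<Prod>p\<in>X. v p)"
  proof (rule sum.reindex_bij_witness[of _ "\<lambda>X. \<lambda>i\<in>S. the_inv_into X c i" "\<lambda>g. g ` S"])
    fix g assume g: "g \<in> ?E"
    have cg: "c (g i) = i" if "i \<in> S" for i using g that by (auto simp: PiE_def Pi_def)
    have inj: "inj_on g S" by (metis cg inj_onI)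
    show *: "g ` S \<in> {X. X \<subseteq> P \<and> inj_on c X \<and> c ` X = S}"
      using g cg by (auto simp: PiE_def Pi_def inj_on_def image_iff)
    show "(\<lambda>i\<in>S. the_inv_into (g ` S) c i) = g"
    proof (rule ext)
      fix i show "(\<lambda>i\<in>S. the_inv_into (g ` S) c i) i = g i"
      proof (cases "i \<in> S")
        case True
        then show ?thesis using the_inv_into_f_f[of c "g ` S" "g i"] * cg by auto
      qed (use g in \<open>auto simp: PiE_def extensional_def\<close>)
    qed
    show "(\<Prod>p\<in>g ` S. v p) = (\<Prod>i\<in>S. v (g i))"
      using prod.reindex[OF inj, of v] by simp
  next
    fix X assume "X \<in> {X. X \<subseteq> P \<and> inj_on c X \<and> c ` X = S}"
    then have X: "X \<subseteq> P" "inj_on c X" "c ` X = S" by auto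
    show "(\<lambda>i\<in>S. the_inv_into X c i) \<in> ?E"
      using X f_the_inv_into_f[OF X(2)] the_inv_into_into[OF X(2)] by auto
    show "(\<lambda>i\<in>S. the_inv_into X c i) ` S = X"
      using X(2,3) the_inv_into_onto[OF X(2)] by (auto simp: image_def)
  qed
  finally show ?thesis by simp
qed

lemma fam_weight_blowup:
  assumes "finite P" "F \<subseteq> Pow I" "finite I"
  shows "fam_weight v (blowup c P F) = fam_weight (\<lambda>i. \<Sum>p\<in>{p\<in>P. c p = i}. v p) F"
proof -
  have "finite F" using assms finite_subset by blast
  have eq: "blowup c P F = (\<Union>S\<in>F. {X. X \<subseteq> P \<and> inj_on c X \<and> c ` X = S})"
    by (auto simp: blowup_def)
  have "fam_weight v (blowup c P F)
      = (\<Sum>S\<in>F. \<Sum>X | X \<subseteq> P \<and> inj_on c X \<and> c ` X = S. \<Prod>p\<in>X. v p)"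
    unfolding fam_weight_def eq using \<open>finite F\<close> assms(1) by (intro sum.UNION_disjoint) auto
  also have "\<dots> = fam_weight (\<lambda>i. \<Sum>p\<in>{p\<in>P. c p = i}. v p) F"
    unfolding fam_weight_def using assms finite_subset
    by (intro sum.cong sum_selections refl) blast+
  finally show ?thesis .
qed

lemma fam_weight_mono:
  assumes "\<And>X x. X \<in> F \<Longrightarrow> x \<in> X \<Longrightarrow> 0 \<le> w x \<and> w x \<le> w' x"
  shows "fam_weight w F \<le> fam_weight w' F"
  unfolding fam_weight_def using assms by (intro sum_mono prod_mono) blast

section \<open>Products of families over disjoint ground sets\<close>

definition fam_prod :: "'a set set \<Rightarrow> 'a set set \<Rightarrow> 'a set set" where
  "fam_prod A B = (\<lambda>(X, Y). X \<union> Y) ` (A \<times> B)"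

lemma fam_prod_trace:
  assumes "A \<subseteq> Pow P" "B \<subseteq> Pow Q" "P \<inter> Q = {}" "Z \<in> fam_prod A B"
  shows "Z \<inter> P \<in> A" "Z \<inter> Q \<in> B" "Z = (Z \<inter> P) \<union> (Z \<inter> Q)"
proof -
  obtain X Y where XY: "X \<in> A" "Y \<in> B" "Z = X \<union> Y" using assms(4) by (auto simp: fam_prod_def)
  then have "X \<subseteq> P" "Y \<subseteq> Q" using assms by auto
  then have "Z \<inter> P = X" "Z \<inter> Q = Y" using XY assms(3) by auto
  then show "Z \<inter> P \<in> A" "Z \<inter> Q \<in> B" "Z = (Z \<inter> P) \<union> (Z \<inter> Q)" using XY by auto
qed

text \<open>If the traces on \<open>P\<close> are pairwise distinct, they form a forbidden
  configuration in \<open>A\<close>. Otherwise two of them coincide and equal the trace of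
  \<open>U\<close>, which contains every other trace; the antichain property then forces
  equality.\<close>

lemma trace_sunflower_const:
  assumes A: "free_antichain k A" and k: "3 \<le> k" and T: "card T = k" "pairwise (\<lambda>X Y. X \<union> Y = U) T"
    and tr: "\<And>Z. Z \<in> T \<Longrightarrow> Z \<inter> P \<in> A"
    and Z: "Z \<in> T" "Z' \<in> T"
  shows "Z \<inter> P = Z' \<inter> P"
proof (cases "inj_on (\<lambda>Z. Z \<inter> P) T")
  case True
  have "False"
  proof (rule union_freeD[of k A "(\<lambda>Z. Z \<inter> P) ` T" "U \<inter> P"])
    show "union_free k A" using A by (simp add: free_antichain_def)
    show "(\<lambda>Z. Z \<inter> P) ` T \<subseteq> A" using tr by auto
    show "card ((\<lambda>Z. Z \<inter> P) ` T) = k" using card_image[OF True] T(1) by simp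
    show "pairwise (\<lambda>X Y. X \<union> Y = U \<inter> P) ((\<lambda>Z. Z \<inter> P) ` T)"
      using T(2) unfolding pairwise_def by blast
  qed
  then show ?thesis ..
next
  case False
  then obtain X Y where XY: "X \<in> T" "Y \<in> T" "X \<noteq> Y" "X \<inter> P = Y \<inter> P"
    by (auto simp: inj_on_def)
  then have U: "U \<inter> P = X \<inter> P" using T(2) by (auto simp: pairwise_def)
  have "W \<inter> P = X \<inter> P" if "W \<in> T" for W
  proof -
    have "3 \<le> card T" using k T(1) by simp
    then obtain V where "V \<in> T" "V \<noteq> W" using card_ge_3_obtain by metis
    then have "W \<subseteq> U" using T(2) that by (auto simp: pairwise_def)
    then have "W \<inter> P \<subseteq> X \<inter> P" using U by auto
    then show ?thesis using antichainD[of A] A tr that XY(1) unfolding free_antichain_def by blast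
  qed
  then show ?thesis using Z by simp
qed

lemma free_antichain_fam_prod:
  assumes "free_antichain k A" "free_antichain k B" "3 \<le> k" "A \<subseteq> Pow P" "B \<subseteq> Pow Q" "P \<inter> Q = {}"
  shows "free_antichain k (fam_prod A B)"
  unfolding free_antichain_def
proof
  note tr = fam_prod_trace[OF assms(4,5,6)]
  show "union_free k (fam_prod A B)"
    unfolding union_free_def
  proof safe
    fix T U assume T: "T \<subseteq> fam_prod A B" "k = card T" "pairwise (\<lambda>X Y. X \<union> Y = U) T"
    have 1: "Z \<inter> P = Z' \<inter> P" if "Z \<in> T" "Z' \<in> T" for Z Z'
      using trace_sunflower_const[OF assms(1,3) T(2)[symmetric] T(3) _ that] tr(1) T(1) by blast
    have 2: "Z \<inter> Q = Z' \<inter> Q" if "Z \<in> T" "Z' \<in> T" for Z Z'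
      using trace_sunflower_const[OF assms(2,3) T(2)[symmetric] T(3) _ that] tr(2) T(1) by blast
    have eq: "Z = Z'" if "Z \<in> T" "Z' \<in> T" for Z Z'
      using 1[OF that] 2[OF that] tr(3) T(1) that by (metis subsetD)
    have "3 \<le> card T" using T(2) assms(3) by simp
    then obtain Z where "Z \<in> T" using card_ge_3_obtain by metis
    moreover obtain Z' where "Z' \<in> T" "Z' \<noteq> Z" using card_ge_3_obtain[OF \<open>3 \<le> card T\<close>] by metis
    ultimately show False using eq by blast
  qed
  show "antichain (fam_prod A B)"
    unfolding antichain_def
  proof (intro ballI impI)
    fix X Y assume XY: "X \<in> fam_prod A B" "Y \<in> fam_prod A B" "X \<subseteq> Y"
    have "X \<inter> P = Y \<inter> P"
      using antichainD[of A "X \<inter> P" "Y \<inter> P"] assms(1) tr(1) XY unfolding free_antichain_def by blast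
    moreover have "X \<inter> Q = Y \<inter> Q"
      using antichainD[of B "X \<inter> Q" "Y \<inter> Q"] assms(2) tr(2) XY unfolding free_antichain_def by blast
    ultimately show "X = Y" using tr(3) XY by metis
  qed
qed

lemma inj_on_fam_prod:
  assumes "A \<subseteq> Pow P" "B \<subseteq> Pow Q" "P \<inter> Q = {}"
  shows "inj_on (\<lambda>(X, Y). X \<union> Y) (A \<times> B)"
proof (rule inj_onI, clarify)
  fix X Y X' Y' assume "X \<in> A" "Y \<in> B" "X' \<in> A" "Y' \<in> B" and e: "X \<union> Y = X' \<union> Y'"
  then have "X \<subseteq> P" "X' \<subseteq> P" "Y \<subseteq> Q" "Y' \<subseteq> Q" using assms by auto
  then have "X = (X \<union> Y) \<inter> P" "X' = (X' \<union> Y') \<inter> P" "Y = (X \<union> Y) \<inter> Q" "Y' = (X' \<union> Y') \<inter> Q"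
    using assms(3) by auto
  then show "X = X' \<and> Y = Y'" using e by metis
qed

lemma fam_weight_fam_prod:
  assumes "A \<subseteq> Pow P" "B \<subseteq> Pow Q" "P \<inter> Q = {}" "finite P" "finite Q"
  shows "fam_weight w (fam_prod A B) = fam_weight w A * fam_weight w B"
proof -
  have "fam_weight w (fam_prod A B) = (\<Sum>(X, Y)\<in>A \<times> B. \<Prod>x\<in>X \<union> Y. w x)"
    unfolding fam_weight_def fam_prod_def
    by (subst sum.reindex[OF inj_on_fam_prod[OF assms(1-3)]]) (auto intro!: sum.cong)
  also have "\<dots> = (\<Sum>(X, Y)\<in>A \<times> B. (\<Prod>x\<in>X. w x) * (\<Prod>x\<in>Y. w x))"
  proof (rule sum.cong[OF refl], clarify)
    fix X Y assume "X \<in> A" "Y \<in> B"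
    then have "X \<subseteq> P" "Y \<subseteq> Q" using assms by auto
    then show "(\<Prod>x\<in>X \<union> Y. w x) = (\<Prod>x\<in>X. w x) * (\<Prod>x\<in>Y. w x)"
      using assms by (intro prod.union_disjoint) (auto intro: finite_subset)
  qed
  also have "\<dots> = fam_weight w A * fam_weight w B"
    unfolding fam_weight_def by (simp add: sum_product sum.cartesian_product)
  finally show ?thesis .
qed

lemma fam_prod_Pow: "A \<subseteq> Pow P \<Longrightarrow> B \<subseteq> Pow Q \<Longrightarrow> fam_prod A B \<subseteq> Pow (P \<union> Q)"
  unfolding fam_prod_def by fast


lemma fam_weight_Pow: "finite I \<Longrightarrow> fam_weight w (Pow I) = (\<Prod>i\<in>I. 1 + w i)"
  using prod_add[of I w "\<lambda>_. 1"] by (simp add: fam_weight_def add.commute)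

lemma fam_weight_subset_mono:
  assumes "finite G" "F \<subseteq> G" "\<And>X x. X \<in> G \<Longrightarrow> x \<in> X \<Longrightarrow> 0 \<le> w x"
  shows "fam_weight w F \<le> fam_weight w G"
  unfolding fam_weight_def using assms by (intro sum_mono2) (auto intro!: prod_nonneg)

lemma fam_weight_le_exp:
  assumes "finite I" "F \<subseteq> Pow I" "\<And>i. i \<in> I \<Longrightarrow> 0 \<le> w i"
  shows "fam_weight w F \<le> exp (\<Sum>i\<in>I. w i)"
proof -
  have "fam_weight w F \<le> fam_weight w (Pow I)"
    using assms by (intro fam_weight_subset_mono) auto
  also have "\<dots> \<le> (\<Prod>i\<in>I. exp (w i))"
    unfolding fam_weight_Pow[OF assms(1)] using assms(3)
    by (intro prod_mono) (auto simp: add_increasing)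
  finally show ?thesis using assms(1) by (simp add: exp_sum)
qed

section \<open>The sunflower constant\<close>

text \<open>Fekete's lemma. The limit is the supremum of \<open>f n / real n\<close>, which gives a
  bound at every single \<open>n\<close> besides convergence.\<close>

lemma superadditive_limit:
  fixes f :: "nat \<Rightarrow> real"
  assumes super: "\<And>m n. f m + f n \<le> f (m + n)"
    and nonneg: "\<And>n. 0 \<le> f n" and bound: "\<And>n. f n \<le> C * real n"
  obtains l where "(\<lambda>n. f n / real n) \<longlonglongrightarrow> l" "\<And>n. f n \<le> l * real n"
proof -
  define l where "l = (SUP n\<in>{1..}. f n / real n)"
  have bdd: "bdd_above ((\<lambda>n. f n / real n) ` {1..})"
    using bound by (intro bdd_aboveI2[of _ _ C]) (simp add: divide_le_eq)
  have f0: "f 0 = 0" using nonneg[of 0] bound[of 0] by simp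
  have le: "f n / real n \<le> l" if "1 \<le> n" for n
    unfolding l_def using that by (intro cSUP_upper bdd) auto
  have mult: "real q * f m \<le> f (q * m)" for q m
  proof (induction q)
    case (Suc q)
    then show ?case using super[of m "q * m"] by (simp add: algebra_simps)
  qed (simp add: f0)
  \<comment> \<open>Division with remainder: \<open>n\<close> contains at least
    \<open>n / m - 1\<close> full blocks of length \<open>m\<close>.\<close>
  have low: "f m / real m - f m / real n \<le> f n / real n" if "1 \<le> m" "1 \<le> n" for m n
  proof -
    have "real n = real (n div m) * real m + real (n mod m)"
      by (metis div_mult_mod_eq of_nat_add of_nat_mult)
    moreover have "real (n mod m) \<le> real m" using that by (simp add: less_imp_le)
    ultimately have q: "real n / real m - 1 \<le> real (n div m)" using that by (simp add: field_simps)
    have "(real n / real m - 1) * f m \<le> real (n div m) * f m"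
      using q nonneg[of m] by (intro mult_right_mono)
    also have "\<dots> \<le> f ((n div m) * m)" by (rule mult)
    also have "\<dots> \<le> f n"
      using super[of "(n div m) * m" "n mod m"] nonneg[of "n mod m"] by simp
    finally have "(real n / real m - 1) * f m / real n \<le> f n / real n"
      by (intro divide_right_mono) auto
    moreover have "(real n / real m - 1) * f m / real n = f m / real m - f m / real n"
      using that by (simp add: field_simps)
    ultimately show ?thesis by simp
  qed
  have "(\<lambda>n. f n / real n) \<longlonglongrightarrow> l"
  proof (rule LIMSEQ_I)
    fix e :: real assume e: "0 < e"
    obtain m where m: "1 \<le> m" "l - e / 2 < f m / real m"
    proof -
      have "\<exists>x\<in>(\<lambda>n. f n / real n) ` {1..}. l - e / 2 < x"
        unfolding l_def by (rule less_cSupD) (use e in auto)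
      then show ?thesis using that by auto
    qed
    obtain n0 where n0: "2 * f m / e < real n0" using reals_Archimedean2 by blast
    have "norm (f n / real n - l) < e" if n: "max 1 n0 \<le> n" for n
    proof -
      have "2 * f m / e < real n" using n0 n by linarith
      then have "f m / real n < e / 2" using e n by (simp add: field_simps)
      then show ?thesis using low[of m n] le[of n] m n by (simp add: abs_if)
    qed
    then show "\<exists>n0. \<forall>n\<ge>n0. norm (f n / real n - l) < e" by blast
  qed
  moreover have "f n \<le> l * real n" for n
    using le[of n] f0 by (cases "n = 0") (auto simp: divide_le_eq)
  ultimately show ?thesis by (rule that)
qed

section \<open>Complements exchange equal intersections and equal unions\<close>

lemma pairwise_Int_complement:
  assumes "T \<subseteq> Pow W" "pairwise (\<lambda>X Y. X \<inter> Y = C) T"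
  shows "pairwise (\<lambda>X Y. X \<union> Y = W - C) ((\<lambda>X. W - X) ` T)"
  using assms unfolding pairwise_def by blast

lemma pairwise_Un_complement:
  assumes "T \<subseteq> Pow W" "pairwise (\<lambda>X Y. X \<union> Y = U) T"
  shows "pairwise (\<lambda>X Y. X \<inter> Y = W - U) ((\<lambda>X. W - X) ` T)"
  using assms unfolding pairwise_def by blast

lemma inj_on_complement: "T \<subseteq> Pow W \<Longrightarrow> inj_on (\<lambda>X. W - X) T"
  by (intro inj_onI) (metis PowD double_diff order_refl subsetD)

lemma complement_image_subset:
  assumes "T \<subseteq> (\<lambda>X. W - X) ` F" "F \<subseteq> Pow W"
  shows "(\<lambda>X. W - X) ` T \<subseteq> F"
proof clarify
  fix X assume "X \<in> T"
  then obtain Y where Y: "Y \<in> F" "X = W - Y" using assms(1) by blast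
  then have "W - X = Y" using assms(2) by blast
  then show "W - X \<in> F" using Y(1) by simp
qed

lemma sunflower_free_complement:
  assumes "union_free k F" "F \<subseteq> Pow W"
  shows "sunflower_free k ((\<lambda>X. W - X) ` F)"
  unfolding sunflower_free_def sunflower_def
proof safe
  fix T C assume T: "T \<subseteq> (\<lambda>X. W - X) ` F" "k = card T" "pairwise (\<lambda>X Y. X \<inter> Y = C) T"
  have TW: "T \<subseteq> Pow W" using T(1) by blast
  show False
  proof (rule union_freeD[OF assms(1)])
    show "(\<lambda>X. W - X) ` T \<subseteq> F" by (rule complement_image_subset[OF T(1) assms(2)])
    show "card ((\<lambda>X. W - X) ` T) = k" using card_image[OF inj_on_complement[OF TW]] T(2) by simp
    show "pairwise (\<lambda>X Y. X \<union> Y = W - C) ((\<lambda>X. W - X) ` T)"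
      by (rule pairwise_Int_complement[OF TW T(3)])
  qed
qed

lemma union_free_complement:
  assumes "sunflower_free k F" "F \<subseteq> Pow W"
  shows "union_free k ((\<lambda>X. W - X) ` F)"
  unfolding union_free_def
proof safe
  fix T U assume T: "T \<subseteq> (\<lambda>X. W - X) ` F" "k = card T" "pairwise (\<lambda>X Y. X \<union> Y = U) T"
  have TW: "T \<subseteq> Pow W" using T(1) by blast
  have "(\<lambda>X. W - X) ` T \<subseteq> F" by (rule complement_image_subset[OF T(1) assms(2)])
  moreover have "sunflower k ((\<lambda>X. W - X) ` T)"
    unfolding sunflower_def using T(2) card_image[OF inj_on_complement[OF TW]]
      pairwise_Un_complement[OF TW T(3)] by auto
  ultimately show False using assms(1) unfolding sunflower_free_def by blast
qed

lemma card_eq_fam_weight: "real (card F) = fam_weight (\<lambda>_. 1) F"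
  by (simp add: fam_weight_def)

lemma card_blowup_bij:
  assumes "bij_betw c P W" "finite P" "F \<subseteq> Pow W"
  shows "card (blowup c P F) = card F"
proof -
  have fin: "finite W" using assms(1,2) bij_betw_finite by blast
  have one: "(\<Sum>p\<in>{p\<in>P. c p = i}. 1) = (1::real)" if "i \<in> W" for i
  proof -
    have "i \<in> c ` P" using assms(1) that by (simp add: bij_betw_def)
    then obtain p where "p \<in> P" "c p = i" by blast
    then have "{p\<in>P. c p = i} = {p}" using assms(1) by (auto simp: bij_betw_def inj_on_def)
    then show ?thesis by simp
  qed
  have "real (card (blowup c P F)) = fam_weight (\<lambda>i. \<Sum>p\<in>{p\<in>P. c p = i}. 1) F"
    unfolding card_eq_fam_weight by (rule fam_weight_blowup[OF assms(2,3) fin])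
  also have "\<dots> = fam_weight (\<lambda>_. 1) F"
    unfolding fam_weight_def using assms(3) one by (intro sum.cong prod.cong refl) blast
  finally show ?thesis unfolding card_eq_fam_weight[symmetric] by simp
qed

section \<open>Extremal numbers with and without the antichain condition\<close>

definition free_antichain_max :: "nat \<Rightarrow> nat \<Rightarrow> nat" where
  "free_antichain_max k n = Max {card F |F. F \<subseteq> Pow {1..n} \<and> free_antichain k F}"

lemma finite_family_cards: "finite {card F |F. F \<subseteq> Pow {1..n::nat} \<and> Q F}"
  by (rule finite_subset[of _ "card ` Pow (Pow {1..n})"]) auto

lemma card_le_free_antichain_max: "F \<subseteq> Pow {1..n} \<Longrightarrow> free_antichain k F \<Longrightarrow> card F \<le> free_antichain_max k n"
  unfolding free_antichain_max_def by (rule Max_ge[OF finite_family_cards]) auto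

lemma card_le_sunflower_free_max:
  "F \<subseteq> Pow {1..n} \<Longrightarrow> sunflower_free k F \<Longrightarrow> card F \<le> sunflower_free_max k n"
  unfolding sunflower_free_max_def by (rule Max_ge[OF finite_family_cards]) auto

lemma free_antichain_singleton: "2 \<le> k \<Longrightarrow> free_antichain k {X}"
proof -
  assume k: "2 \<le> k"
  have "card T \<noteq> k" if "T \<subseteq> {X}" for T
    using card_mono[OF _ that] k by simp
  then show ?thesis by (auto simp: free_antichain_def union_free_def antichain_def)
qed

lemma free_antichain_max_attained:
  assumes "2 \<le> k"
  obtains F where "F \<subseteq> Pow {1..n}" "free_antichain k F" "card F = free_antichain_max k n"
proof -
  have "free_antichain_max k n \<in> {card F |F. F \<subseteq> Pow {1..n} \<and> free_antichain k F}"
    unfolding free_antichain_max_def using free_antichain_singleton[OF assms, of "{}"]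
    by (intro Max_in finite_family_cards) blast
  then show ?thesis using that by auto
qed

lemma sunflower_free_max_attained:
  assumes "2 \<le> k"
  obtains F where "F \<subseteq> Pow {1..n}" "sunflower_free k F" "card F = sunflower_free_max k n"
proof -
  have "sunflower_free k ((\<lambda>X. {1..n} - X) ` {{}})"
    by (rule sunflower_free_complement) (use free_antichain_singleton[OF assms] in \<open>auto simp: free_antichain_def\<close>)
  then have "card ((\<lambda>X. {1..n} - X) ` {{}}) \<in> {card F |F. F \<subseteq> Pow {1..n} \<and> sunflower_free k F}"
    by blast
  then have "sunflower_free_max k n \<in> {card F |F. F \<subseteq> Pow {1..n} \<and> sunflower_free k F}"
    unfolding sunflower_free_max_def by (intro Max_in finite_family_cards) blast
  then show ?thesis using that by auto
qed

lemma free_antichain_max_pos: "2 \<le> k \<Longrightarrow> 1 \<le> free_antichain_max k n"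
  using card_le_free_antichain_max[of "{{}}" n k] free_antichain_singleton[of k "{}"] by simp

lemma free_antichain_max_le_two_power: "2 \<le> k \<Longrightarrow> free_antichain_max k n \<le> 2 ^ n"
proof -
  assume "2 \<le> k"
  then obtain F where F: "F \<subseteq> Pow {1..n}" "card F = free_antichain_max k n"
    by (rule free_antichain_max_attained)
  have "card F \<le> card (Pow {1..n})" by (rule card_mono) (use F in auto)
  then show ?thesis using F by (simp add: card_Pow)
qed

lemma free_antichain_max_le_sunflower_free_max:
  assumes "2 \<le> k"
  shows "free_antichain_max k n \<le> sunflower_free_max k n"
proof -
  obtain F where F: "F \<subseteq> Pow {1..n}" "free_antichain k F" "card F = free_antichain_max k n"
    using free_antichain_max_attained[OF assms] .
  have "card ((\<lambda>X. {1..n} - X) ` F) \<le> sunflower_free_max k n"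
    using sunflower_free_complement[of k F "{1..n}"] F
    by (intro card_le_sunflower_free_max) (auto simp: free_antichain_def)
  then show ?thesis using card_image[OF inj_on_complement[OF F(1)]] F(3) by simp
qed

text \<open>A blow-up along a bijection is a relabelling, which moves \<open>B\<close> to
  \<open>{1..card W}\<close> before complements are taken.\<close>

lemma union_free_card_le:
  assumes "union_free k B" "B \<subseteq> Pow W" "finite W" "3 \<le> k"
  shows "card B \<le> sunflower_free_max k (card W)"
proof -
  obtain c where c: "bij_betw c {1..card W} W"
    using assms(3) by (metis bij_betw_iff_card card_atLeastAtMost diff_Suc_1 finite_atLeastAtMost)
  let ?B = "blowup c {1..card W} B"
  have B: "?B \<subseteq> Pow {1..card W}" by (auto simp: blowup_def)
  have "card ((\<lambda>X. {1..card W} - X) ` ?B) \<le> sunflower_free_max k (card W)"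
    by (intro card_le_sunflower_free_max sunflower_free_complement union_free_blowup assms B) auto
  then show ?thesis
    using card_image[OF inj_on_complement[OF B]] card_blowup_bij[OF c _ assms(2)] by simp
qed

text \<open>The complements form a union-free family, and each of its \<open>n + 1\<close> layers of
  sets of equal size is an antichain.\<close>

lemma sunflower_free_max_le:
  assumes "2 \<le> k"
  shows "sunflower_free_max k n \<le> (n + 1) * free_antichain_max k n"
proof -
  obtain F where F: "F \<subseteq> Pow {1..n}" "sunflower_free k F" "card F = sunflower_free_max k n"
    using sunflower_free_max_attained[OF assms] .
  define G where "G = (\<lambda>X. {1..n} - X) ` F"
  have G: "G \<subseteq> Pow {1..n}" "union_free k G"
    using union_free_complement[OF F(2,1)] by (auto simp: G_def)
  have layer: "card {X\<in>G. card X = j} \<le> free_antichain_max k n" for j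
  proof (rule card_le_free_antichain_max)
    have "antichain {X\<in>G. card X = j}"
      using G(1) by (intro antichain_uniform[of _ j]) (auto intro: finite_subset)
    then show "free_antichain k {X\<in>G. card X = j}"
      using union_free_subset[OF G(2)] by (auto simp: free_antichain_def)
  qed (use G in auto)
  have "X \<in> (\<Union>j\<in>{0..n}. {X\<in>G. card X = j})" if "X \<in> G" for X
    using that G(1) card_mono[of "{1..n}" X] by auto
  then have eq: "G = (\<Union>j\<in>{0..n}. {X\<in>G. card X = j})" by blast
  have "card G = card (\<Union>j\<in>{0..n}. {X\<in>G. card X = j})" by (rule arg_cong[OF eq])
  also have "\<dots> \<le> (\<Sum>j\<in>{0..n}. card {X\<in>G. card X = j})" by (rule card_UN_le) simp
  also have "\<dots> \<le> (\<Sum>j\<in>{0..n}. free_antichain_max k n)" by (intro sum_mono layer)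
  also have "\<dots> = (n + 1) * free_antichain_max k n" by simp
  finally show ?thesis using card_image[OF inj_on_complement[OF F(1)]] F(3) by (simp add: G_def)
qed

lemma free_antichain_max_supermult:
  assumes "3 \<le> k"
  shows "free_antichain_max k m * free_antichain_max k n \<le> free_antichain_max k (m + n)"
proof -
  have k2: "2 \<le> k" using assms by simp
  obtain F where F: "F \<subseteq> Pow {1..m}" "free_antichain k F" "card F = free_antichain_max k m"
    using free_antichain_max_attained[OF k2] .
  obtain G where G: "G \<subseteq> Pow {1..n}" "free_antichain k G" "card G = free_antichain_max k n"
    using free_antichain_max_attained[OF k2] .
  let ?Q = "{m + 1..m + n}" and ?c = "\<lambda>p. p - m"
  define H where "H = blowup ?c ?Q G"
  have bij: "bij_betw ?c ?Q {1..n}"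
    by (rule bij_betwI[of _ _ _ "\<lambda>p. p + m"]) auto
  have H: "H \<subseteq> Pow ?Q" "free_antichain k H" "card H = free_antichain_max k n"
    using card_blowup_bij[OF bij _ G(1)] G(3) free_antichain_blowup[OF G(2) assms]
    by (auto simp: H_def blowup_def)
  have dis: "{1..m} \<inter> ?Q = {}" by auto
  have "real (card (fam_prod F H)) = real (card F) * real (card H)"
    unfolding card_eq_fam_weight using F H dis by (intro fam_weight_fam_prod) auto
  moreover have "card (fam_prod F H) \<le> free_antichain_max k (m + n)"
  proof (rule card_le_free_antichain_max)
    have "fam_prod F H \<subseteq> Pow ({1..m} \<union> ?Q)" using F H by (intro fam_prod_Pow)
    also have "\<dots> \<subseteq> Pow {1..m + n}" by auto
    finally show "fam_prod F H \<subseteq> Pow {1..m + n}" .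
    show "free_antichain k (fam_prod F H)"
      using F H assms dis by (intro free_antichain_fam_prod[where P="{1..m}" and Q="?Q"])
  qed
  ultimately show ?thesis using F(3) H(3) by (metis of_nat_eq_iff of_nat_mult)
qed

text \<open>Fekete's lemma applies to the antichain numbers, which are supermultiplicative; the
  factor \<open>n + 1\<close> between them and the sunflower numbers disappears under the
  \<open>n\<close>-th root. The convergence found this way identifies the \<open>lim\<close> in
  \<open>sunflower_mu\<close>.\<close>

lemma sunflower_mu_facts:
  assumes k: "3 \<le> k"
  shows "(\<lambda>n. ln (real (free_antichain_max k n)) / real n) \<longlonglongrightarrow> ln (sunflower_mu k)" (is ?A)
    and "real (free_antichain_max k n) \<le> sunflower_mu k ^ n"
    and "1 \<le> sunflower_mu k" and "sunflower_mu k \<le> 2"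
proof -
  have k2: "2 \<le> k" using k by simp
  define f where "f n = ln (real (free_antichain_max k n))" for n
  have pos: "1 \<le> real (free_antichain_max k n)" for n
    using free_antichain_max_pos[OF k2, of n] by simp
  have two: "real (free_antichain_max k n) \<le> 2 ^ n" for n
    using free_antichain_max_le_two_power[OF k2, of n]
      by (metis of_nat_le_iff of_nat_numeral of_nat_power)
  have fle: "f n \<le> ln 2 * real n" for n
  proof -
    have "f n \<le> ln (2 ^ n)"
      unfolding f_def using two[of n] pos[of n] by (subst ln_le_cancel_iff) auto
    then show ?thesis by (simp add: ln_realpow mult.commute)
  qed
  have super: "f m + f n \<le> f (m + n)" for m n
  proof -
    have "real (free_antichain_max k m) * real (free_antichain_max k n) \<le> real (free_antichain_max k (m + n))"
      using free_antichain_max_supermult[OF k, of m n] by (metis of_nat_le_iff of_nat_mult)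
    then show ?thesis
      unfolding f_def using pos[of m] pos[of n] pos[of "m + n"]
      by (subst ln_mult_pos[symmetric]) (auto intro!: ln_mono mult_pos_pos)
  qed
  have f0: "0 \<le> f n" for n using pos[of n] by (simp add: f_def)
  obtain l where l: "(\<lambda>n. f n / real n) \<longlonglongrightarrow> l" "\<And>n. f n \<le> l * real n"
    using superadditive_limit[of f "ln 2"] super f0 fle by blast
  have "(\<lambda>n. ln (real n + 1) / real n) \<longlonglongrightarrow> 0" by real_asymp
  then have up: "(\<lambda>n. ln (real n + 1) / real n + f n / real n) \<longlonglongrightarrow> l"
    using tendsto_add[OF _ l(1)] by fastforce
  have "(\<lambda>n. ln (real (sunflower_free_max k n)) / real n) \<longlonglongrightarrow> l"
  proof (rule tendsto_sandwich[OF _ _ l(1) up])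
    show "\<forall>\<^sub>F n in sequentially. f n / real n \<le> ln (real (sunflower_free_max k n)) / real n"
      using free_antichain_max_le_sunflower_free_max[OF k2] pos
      by (intro always_eventually allI divide_right_mono)
        (auto simp: f_def intro!: ln_mono order.strict_trans2[OF zero_less_one])
    show "\<forall>\<^sub>F n in sequentially. ln (real (sunflower_free_max k n)) / real n
        \<le> ln (real n + 1) / real n + f n / real n"
    proof (intro always_eventually allI)
      fix n
      have "1 \<le> real (sunflower_free_max k n)"
        using free_antichain_max_le_sunflower_free_max[OF k2, of n] pos[of n] by linarith
      moreover have "real (sunflower_free_max k n) \<le> (real n + 1) * real (free_antichain_max k n)"
      proof -
        have "real (sunflower_free_max k n) \<le> real ((n + 1) * free_antichain_max k n)"
          using sunflower_free_max_le[OF k2, of n] by (subst of_nat_le_iff)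
        then show ?thesis by (simp add: algebra_simps)
      qed
      ultimately have "ln (real (sunflower_free_max k n)) \<le> ln ((real n + 1) * real (free_antichain_max k n))"
        by (intro ln_mono) auto
      also have "\<dots> = ln (real n + 1) + f n"
        unfolding f_def using pos[of n] by (intro ln_mult_pos) auto
      finally show "ln (real (sunflower_free_max k n)) / real n \<le> ln (real n + 1) / real n + f n / real n"
        by (simp add: add_divide_distrib[symmetric] divide_right_mono)
    qed
  qed
  then have "(\<lambda>n. exp (ln (real (sunflower_free_max k n)) / real n)) \<longlonglongrightarrow> exp l"
    by (rule tendsto_exp)
  moreover have "\<forall>\<^sub>F n in sequentially. exp (ln (real (sunflower_free_max k n)) / real n)
      = root n (real (sunflower_free_max k n))"
  \<comment> \<open>\<open>root 0\<close> is 0 while the exponential is 1, so the identity starts at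
    \<open>n = 1\<close>.\<close>
  proof (rule eventually_sequentiallyI[of 1])
    fix n :: nat assume "1 \<le> n"
    moreover have "0 < real (sunflower_free_max k n)"
      using free_antichain_max_le_sunflower_free_max[OF k2, of n] pos[of n] by linarith
    ultimately show "exp (ln (real (sunflower_free_max k n)) / real n)
      = root n (real (sunflower_free_max k n))"
      by (simp add: root_powr_inverse powr_def divide_inverse)
  qed
  ultimately have "(\<lambda>n. root n (real (sunflower_free_max k n))) \<longlonglongrightarrow> exp l"
    by (rule Lim_transform_eventually)
  then have mu: "sunflower_mu k = exp l" unfolding sunflower_mu_def by (rule limI)
  show ?A using l(1) mu by (simp add: f_def)
  show "real (free_antichain_max k n) \<le> sunflower_mu k ^ n"
  proof -
    have "real (free_antichain_max k n) = exp (f n)" using pos[of n] by (simp add: f_def)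
    also have "\<dots> \<le> exp (l * real n)" using l(2) by simp
    also have "\<dots> = sunflower_mu k ^ n" unfolding mu by (metis exp_of_nat2_mult)
    finally show ?thesis .
  qed
  have "0 \<le> l" using l(2)[of 1] f0[of 1] by simp
  then show "1 \<le> sunflower_mu k" by (simp add: mu)
  have "l \<le> ln 2"
    by (rule LIMSEQ_le_const2[OF l(1)]) (use fle in \<open>auto intro!: exI[of _ 1] simp: divide_le_eq\<close>)
  then show "sunflower_mu k \<le> 2" unfolding mu by (metis exp_le_cancel_iff exp_ln zero_less_numeral)
qed

lemma sunflower_free_max_le_mu:
  assumes "3 \<le> k"
  shows "real (sunflower_free_max k n) \<le> (real n + 1) * sunflower_mu k ^ n"
proof -
  have "real (sunflower_free_max k n) \<le> (real n + 1) * real (free_antichain_max k n)"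
  proof -
    have "real (sunflower_free_max k n) \<le> real ((n + 1) * free_antichain_max k n)"
      using sunflower_free_max_le[of k n] assms by (subst of_nat_le_iff) simp
    then show ?thesis by (simp add: algebra_simps)
  qed
  also have "\<dots> \<le> (real n + 1) * sunflower_mu k ^ n"
    using sunflower_mu_facts(2)[OF assms] by (intro mult_left_mono) auto
  finally show ?thesis .
qed

section \<open>Sums over primes\<close>

definition primes_le :: "real \<Rightarrow> nat set" where
  "primes_le y = {p. prime p \<and> real p \<le> y}"

definition prime_sum :: "real \<Rightarrow> real" where
  "prime_sum y = (\<Sum>p\<in>primes_le y. 1 / real p)"

lemma finite_primes_le [simp]: "finite (primes_le y)"
proof (rule finite_subset)
  show "primes_le y \<subseteq> {..nat \<lfloor>y\<rfloor>}" by (auto simp: primes_le_def le_nat_floor)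
qed simp

lemma prime_factors_prod_primes:
  fixes X :: "nat set"
  assumes "finite X" "\<And>p. p \<in> X \<Longrightarrow> prime p"
  shows "prime_factors (\<Prod>X) = X"
proof -
  have "prime_factors (\<Prod>p\<in>X. p) = \<Union>((prime_factors \<circ> (\<lambda>p. p)) ` X)"
  proof (rule prime_factors_prod[OF assms(1)])
    show "0 \<notin> (\<lambda>p. p) ` X" using assms(2)[of 0] by auto
  qed
  also have "\<dots> = X" using assms(2) by (auto simp: prime_prime_factors)
  finally show ?thesis by simp
qed

lemma prod_primes_pos:
  fixes X :: "nat set"
  assumes "\<And>p. p \<in> X \<Longrightarrow> prime p"
  shows "0 < \<Prod>X"
  using assms by (intro prod_pos) (auto simp: prime_gt_0_nat)

lemma squarefree_eq_prod_prime_factors: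
  fixes n :: nat
  assumes "squarefree n" "n \<noteq> 0"
  shows "\<Prod>(prime_factors n) = n"
proof -
  have "n = (\<Prod>p\<in>prime_factors n. p ^ multiplicity p n)"
    using prod_prime_factors[OF assms(2)] by simp
  also have "\<dots> = \<Prod>(prime_factors n)"
    using assms by (intro prod.cong) (auto simp: squarefree_factorial_semiring')
  finally show ?thesis ..
qed

lemma sum_inverse_squares_le: "(\<Sum>m=1..N. 1 / (real m)\<^sup>2) \<le> 2"
proof -
  \<comment> \<open>The strengthened bound telescopes, as \<open>1 / (n + 1)^2\<close> is at most
    \<open>1 / n - 1 / (n + 1)\<close>.\<close>
  have "(\<Sum>m=1..N. 1 / (real m)\<^sup>2) \<le> 2 - 1 / real N" if "1 \<le> N"
    using that
  proof (induction N rule: dec_induct)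
    case (step n)
    have "1 / (real (Suc n))\<^sup>2 \<le> 1 / real n - 1 / real (Suc n)"
    proof -
      have "1 / real n - 1 / real (Suc n) = 1 / (real n * real (Suc n))"
        using step by (simp add: field_simps)
      moreover have "1 / (real (Suc n))\<^sup>2 \<le> 1 / (real n * real (Suc n))"
        using step by (intro frac_le) (auto simp: power2_eq_square)
      ultimately show ?thesis by simp
    qed
    then show ?case using step by simp
  qed simp
  then show ?thesis by (cases "N = 0") (auto intro: order_trans)
qed

lemma inverse_prod_primes: "(\<Prod>p\<in>X. 1 / real p) = 1 / real (\<Prod>X)"
  by (simp add: prod_dividef)

text \<open>Write \<open>a = m\<^sup>2 s\<close> with \<open>s\<close> squarefree; \<open>X\<close> is the set of primes dividing \<open>s\<close>.\<close>

lemma sum_inverse_decompose: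
  assumes A: "A \<subseteq> {1..N}"
    and B: "\<And>m. 1 \<le> m \<Longrightarrow> fam_weight (\<lambda>p. 1 / real p)
              {X. X \<subseteq> primes_le (real N) \<and> m\<^sup>2 * \<Prod>X \<in> A} \<le> B"
  shows "(\<Sum>a\<in>A. 1 / real a) \<le> 2 * B"
proof -
  define F where "F m = {X. X \<subseteq> primes_le (real N) \<and> m\<^sup>2 * \<Prod>X \<in> A}" for m
  have finF: "finite (F m)" for m
    by (rule finite_subset[of _ "Pow (primes_le (real N))"]) (auto simp: F_def)
  define h where "h a = (square_part a, prime_factors (squarefree_part a))" for a :: nat
  have dec: "fst (h a) ^ 2 * \<Prod>(snd (h a)) = a" for a
    using squarefree_decompose[of a] squarefree_eq_prod_prime_factors[of "squarefree_part a"]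
    by (simp add: h_def mult.commute)
  have hA: "h a \<in> Sigma {1..N} F" if "a \<in> A" for a
  proof -
    have a: "1 \<le> a" "a \<le> N" using A that by auto
    have "square_part a ^ 2 dvd a" by simp
    then have "square_part a dvd a" by (metis dvd_mult_left power2_eq_square)
    then have s: "square_part a \<in> {1..N}"
      using a dvd_imp_le[of "square_part a" a] dvd_pos_nat[of a "square_part a"] by auto
    have "squarefree_part a dvd a" using squarefree_decompose[of a] by (metis dvd_triv_left)
    then have "p \<le> N" if "p \<in> prime_factors (squarefree_part a)" for p
      using that a dvd_imp_le[of p a]
        by (meson dvd_trans in_prime_factors_iff le_trans less_le_trans zero_less_one)
    then have "prime_factors (squarefree_part a) \<subseteq> primes_le (real N)"
      by (auto simp: primes_le_def)
    then show ?thesis using s dec[of a] that by (auto simp: h_def F_def)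
  qed
  have inj: "inj_on h A" using dec by (metis inj_onI)
  have "(\<Sum>a\<in>A. 1 / real a) = (\<Sum>a\<in>A. (\<lambda>(m, X). 1 / (real m)\<^sup>2 * (\<Prod>p\<in>X. 1 / real p)) (h a))"
  proof (rule sum.cong[OF refl])
    fix a assume "a \<in> A"
    have "real a = (real (fst (h a)))\<^sup>2 * real (\<Prod>(snd (h a)))"
      using dec[of a] by (metis of_nat_mult of_nat_power)
    then show "1 / real a = (\<lambda>(m, X). 1 / (real m)\<^sup>2 * (\<Prod>p\<in>X. 1 / real p)) (h a)"
      by (simp add: case_prod_beta inverse_prod_primes)
  qed
  also have "\<dots> = (\<Sum>(m, X)\<in>h ` A. 1 / (real m)\<^sup>2 * (\<Prod>p\<in>X. 1 / real p))"
    by (rule sum.reindex[OF inj, symmetric, unfolded o_def])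
  also have "\<dots> \<le> (\<Sum>(m, X)\<in>Sigma {1..N} F. 1 / (real m)\<^sup>2 * (\<Prod>p\<in>X. 1 / real p))"
  proof (rule sum_mono2)
    show "h ` A \<subseteq> Sigma {1..N} F" using hA by blast
    show "finite (Sigma {1..N} F)" using finF by simp
  qed (auto intro!: prod_nonneg divide_nonneg_nonneg)
  also have "\<dots> = (\<Sum>m=1..N. \<Sum>X\<in>F m. 1 / (real m)\<^sup>2 * (\<Prod>p\<in>X. 1 / real p))"
    using finF by (simp add: sum.Sigma)
  also have "\<dots> = (\<Sum>m=1..N. 1 / (real m)\<^sup>2 * fam_weight (\<lambda>p. 1 / real p) (F m))"
    by (simp add: fam_weight_def sum_distrib_left)
  also have "\<dots> \<le> (\<Sum>m=1..N. 1 / (real m)\<^sup>2 * B)"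
    using B by (intro sum_mono mult_left_mono) (auto simp: F_def)
  also have "\<dots> \<le> 2 * B"
  proof -
    have "0 \<le> fam_weight (\<lambda>p. 1 / real p) (F 1)"
      by (auto simp: fam_weight_def intro!: sum_nonneg prod_nonneg)
    then have "0 \<le> B" using B[of 1] by (simp add: F_def)
    then show ?thesis
      unfolding sum_distrib_right[symmetric] by (intro mult_right_mono sum_inverse_squares_le)
  qed
  finally show ?thesis .
qed

text \<open>Euler's argument: splitting all of \<open>{1..N}\<close> into square and squarefree
  parts bounds the harmonic sum by \<open>2 * exp (prime_sum y)\<close>.\<close>

lemma prime_sum_lower:
  assumes "1 < y"
  shows "ln (ln y) - ln 2 \<le> prime_sum y"
proof -
  define N where "N = nat \<lfloor>y\<rfloor>"
  have N: "real N \<le> y" "y < real N + 1" using assms by (auto simp: N_def; linarith)+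
  have "ln y \<le> ln (real N + 1)" using assms N by (intro ln_mono) auto
  also have "\<dots> \<le> harm N" by (rule ln_le_harm)
  also have "\<dots> = (\<Sum>a\<in>{1..N}. 1 / real a)" by (simp add: harm_def inverse_eq_divide)
  also have "\<dots> \<le> 2 * exp (prime_sum y)"
  proof (rule sum_inverse_decompose[of _ N])
    fix m :: nat
    have "fam_weight (\<lambda>p. 1 / real p) {X. X \<subseteq> primes_le (real N) \<and> m\<^sup>2 * \<Prod>X \<in> {1..N}}
        \<le> exp (\<Sum>p\<in>primes_le (real N). 1 / real p)"
      by (intro fam_weight_le_exp) auto
    also have "\<dots> \<le> exp (prime_sum y)"
    proof -
      have "primes_le (real N) \<subseteq> primes_le y" using N(1) by (auto simp: primes_le_def)
      then show ?thesis unfolding prime_sum_def by (simp add: sum_mono2)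
    qed
    finally show "fam_weight (\<lambda>p. 1 / real p) {X. X \<subseteq> primes_le (real N) \<and> m\<^sup>2 * \<Prod>X \<in> {1..N}}
        \<le> exp (prime_sum y)" .
  qed simp
  finally have "ln (ln y) \<le> ln (2 * exp (prime_sum y))" using assms by (intro ln_mono) auto
  then show ?thesis by (simp add: ln_mult)
qed

lemma sum_powr_le:
  assumes "0 < d"
  shows "(\<Sum>n=1..M. real n powr (-(1 + d))) \<le> 1 + 1 / d"
proof -
  \<comment> \<open>Integral comparison in telescoping form: \<open>real M powr (-d) / d\<close> is
    the integral of \<open>x powr (-(1 + d))\<close> beyond \<open>M\<close>.\<close>
  have "(\<Sum>n=1..M. real n powr (-(1 + d))) \<le> 1 + 1 / d - real M powr (-d) / d" if "1 \<le> M"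
    using that
  proof (induction M rule: dec_induct)
    case (step n)
    let ?n = "real (Suc n)"
    have n: "1 \<le> real n" using step by simp
    have "1 + d / ?n \<le> exp (d / ?n)" by (rule exp_ge_add_one_self)
    also have "\<dots> \<le> exp (- d * ln (1 - 1 / ?n))"
    proof -
      have "ln (1 - 1 / ?n) \<le> - (1 / ?n)"
        using n ln_add_one_self_le_self2[of "- (1 / ?n)"] by (simp add: field_simps)
      then have "d * ln (1 - 1 / ?n) \<le> d * (- (1 / ?n))" using assms by (intro mult_left_mono) auto
      then show ?thesis by simp
    qed
    also have "\<dots> = (1 - 1 / ?n) powr (-d)" using n by (simp add: powr_def field_simps)
    also have "1 - 1 / ?n = real n / ?n" by (simp add: field_simps)
    also have "(real n / ?n) powr (-d) = real n powr (-d) / ?n powr (-d)"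
      by (rule powr_divide)
    finally have "1 + d / ?n \<le> real n powr (-d) / ?n powr (-d)" .
    then have "(1 + d / ?n) * ?n powr (-d) \<le> real n powr (-d)"
      by (subst (asm) pos_le_divide_eq) auto
    then have le: "?n powr (-d) + d * (?n powr (-d) / ?n) \<le> real n powr (-d)"
      by (simp add: algebra_simps)
    have eq: "?n powr (-d) / ?n = ?n powr (-(1 + d))"
      using powr_add[of ?n "-d" "-1"] by (simp add: powr_minus_divide add.commute)
    have "d * ?n powr (-(1 + d)) \<le> real n powr (-d) - ?n powr (-d)"
      using le unfolding eq by linarith
    then have "?n powr (-(1 + d)) \<le> real n powr (-d) / d - ?n powr (-d) / d"
      unfolding diff_divide_distrib[symmetric] using assms
      by (subst pos_le_divide_eq) (auto simp: mult.commute)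
    then show ?case using step by simp
  qed (use assms in simp)
  moreover have "0 \<le> real M powr (-d) / d" using assms by simp
  moreover have "0 \<le> 1 + 1 / d" using assms by simp
  ultimately show ?thesis by (cases "M = 0") auto
qed

text \<open>Expanding the finite Euler product gives a sum over distinct squarefree divisors of
  \<open>M\<close>, hence part of the sum over all integers up to \<open>M\<close>.\<close>

lemma prod_primes_powr_le:
  assumes "0 < d"
  shows "(\<Prod>p\<in>primes_le y. 1 + real p powr (-(1 + d))) \<le> 1 + 1 / d"
proof -
  let ?P = "primes_le y"
  have pr: "prime p" if "X \<in> Pow ?P" "p \<in> X" for X p using that by (auto simp: primes_le_def)
  have fin: "finite X" if "X \<in> Pow ?P" for X using that finite_subset[of X ?P] by auto
  define M where "M = \<Prod>?P"
  have "(\<Prod>p\<in>?P. 1 + real p powr (-(1 + d))) = fam_weight (\<lambda>p. real p powr (-(1 + d))) (Pow ?P)"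
    by (simp add: fam_weight_Pow)
  also have "\<dots> = (\<Sum>X\<in>Pow ?P. real (\<Prod>X) powr (-(1 + d)))"
    unfolding fam_weight_def
  proof (rule sum.cong[OF refl])
    fix X assume "X \<in> Pow ?P"
    show "(\<Prod>p\<in>X. real p powr (-(1 + d))) = real (\<Prod>X) powr (-(1 + d))"
      by (simp add: prod_powr_distrib)
  qed
  also have "\<dots> = (\<Sum>n\<in>Prod ` Pow ?P. real n powr (-(1 + d)))"
  proof -
    have "inj_on Prod (Pow ?P)"
      by (intro inj_onI) (metis prime_factors_prod_primes pr fin)
    then show ?thesis by (simp add: sum.reindex o_def)
  qed
  also have "\<dots> \<le> (\<Sum>n=1..M. real n powr (-(1 + d)))"
  proof (rule sum_mono2)
    show "Prod ` Pow ?P \<subseteq> {1..M}"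
    proof safe
      fix X assume X: "X \<subseteq> ?P"
      have "\<Prod>X dvd M" unfolding M_def using X by (intro prod_dvd_prod_subset) auto
      moreover have "0 < M" unfolding M_def using pr by (intro prod_primes_pos) auto
      moreover have "0 < \<Prod>X" using pr X by (intro prod_primes_pos) auto
      ultimately show "\<Prod>X \<in> {1..M}" using dvd_imp_le by auto
    qed
  qed auto
  also have "\<dots> \<le> 1 + 1 / d" by (rule sum_powr_le[OF assms])
  finally show ?thesis .
qed

text \<open>The inequality \<open>v - v^2 \<le> ln (1 + v)\<close> passes from the product to the
  sum; the quadratic errors are bounded by the sum of \<open>1 / p^2\<close>, hence by 2.\<close>

lemma sum_primes_powr_le:
  assumes "0 < d"
  shows "(\<Sum>p\<in>primes_le y. real p powr (-(1 + d))) \<le> ln (1 + 1 / d) + 2"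
proof -
  let ?v = "\<lambda>p. real p powr (-(1 + d))"
  have p1: "1 \<le> real p" if "p \<in> primes_le y" for p
    using that prime_ge_1_nat by (auto simp: primes_le_def)
  have v1: "?v p \<le> 1 / real p" if "p \<in> primes_le y" for p
  proof -
    have "?v p \<le> real p powr (-1)" using p1[OF that] assms by (intro powr_mono) auto
    then show ?thesis using p1[OF that] by (simp add: powr_minus_divide)
  qed
  have "(\<Sum>p\<in>primes_le y. ?v p) \<le> (\<Sum>p\<in>primes_le y. ln (1 + ?v p) + 1 / (real p)\<^sup>2)"
  proof (rule sum_mono)
    fix p assume p: "p \<in> primes_le y"
    have "?v p \<le> 1" using v1[OF p] p1[OF p] by (smt (verit) divide_le_eq_1)
    then have "?v p - (?v p)\<^sup>2 \<le> ln (1 + ?v p)" by (intro ln_one_plus_pos_lower_bound) auto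
    moreover have "(?v p)\<^sup>2 \<le> (1 / real p)\<^sup>2" using v1[OF p] by (intro power_mono) auto
    ultimately show "?v p \<le> ln (1 + ?v p) + 1 / (real p)\<^sup>2" by (simp add: power_one_over)
  qed
  also have "\<dots> = (\<Sum>p\<in>primes_le y. ln (1 + ?v p)) + (\<Sum>p\<in>primes_le y. 1 / (real p)\<^sup>2)"
    by (rule sum.distrib)
  also have "(\<Sum>p\<in>primes_le y. ln (1 + ?v p)) = ln (\<Prod>p\<in>primes_le y. 1 + ?v p)"
  proof (rule ln_prod[symmetric])
    fix p show "1 + ?v p \<noteq> 0" using powr_ge_zero[of "real p" "-(1 + d)"] by linarith
  qed simp
  also have "\<dots> \<le> ln (1 + 1 / d)"
    using prod_primes_powr_le[OF assms, of y]
      by (intro ln_mono prod_pos) (auto simp: add_pos_nonneg)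
  also have "(\<Sum>p\<in>primes_le y. 1 / (real p)\<^sup>2) \<le> (\<Sum>p=1..nat \<lfloor>y\<rfloor>. 1 / (real p)\<^sup>2)"
    by (intro sum_mono2) (auto simp: primes_le_def le_nat_floor intro!: prime_ge_1_nat[unfolded One_nat_def])
  also have "\<dots> \<le> 2" by (rule sum_inverse_squares_le)
  finally show ?thesis by simp
qed

text \<open>With \<open>d = 1 / (K ln y)\<close> the terms \<open>p powr -(1 + d)\<close>, \<open>p \<le> y\<close>, differ from \<open>1 / p\<close> by
  a factor of at most \<open>exp (1 / K)\<close>. This replaces Mertens' theorem: as \<open>K\<close> is arbitrary, it
  gives the asymptotics.\<close>

lemma prime_sum_upper:
  assumes "1 < y" "0 < K"
  shows "prime_sum y \<le> exp (1 / K) * (ln (1 + K * ln y) + 2)"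
proof -
  define d where "d = 1 / (K * ln y)"
  have d: "0 < d" using assms by (simp add: d_def)
  have "prime_sum y \<le> (\<Sum>p\<in>primes_le y. exp (1 / K) * real p powr (-(1 + d)))"
    unfolding prime_sum_def
  proof (rule sum_mono)
    fix p assume p: "p \<in> primes_le y"
    then have p1: "1 \<le> real p" and py: "real p \<le> y"
      using prime_ge_1_nat by (auto simp: primes_le_def)
    have "d * ln (real p) \<le> d * ln y" using d p1 py by (intro mult_left_mono ln_mono) auto
    also have "\<dots> = 1 / K" using assms by (simp add: d_def)
    finally have "exp (d * ln (real p)) \<le> exp (1 / K)" by simp
    then have "exp (d * ln (real p)) * real p powr (-(1 + d)) \<le> exp (1 / K) * real p powr (-(1 + d))"
      by (intro mult_right_mono) auto
    moreover have "exp (d * ln (real p)) * real p powr (-(1 + d)) = 1 / real p"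
    proof -
      have "exp (d * ln (real p)) = real p powr d" using p1 by (simp add: powr_def)
      then have "exp (d * ln (real p)) * real p powr (-(1 + d)) = real p powr (-1)"
        by (simp add: powr_add[symmetric])
      then show ?thesis using p1 by (simp add: powr_minus_divide)
    qed
    ultimately show "1 / real p \<le> exp (1 / K) * real p powr (-(1 + d))" by simp
  qed
  also have "\<dots> \<le> exp (1 / K) * (ln (1 + 1 / d) + 2)"
    unfolding sum_distrib_left[symmetric] by (intro mult_left_mono sum_primes_powr_le d) simp
  finally show ?thesis by (simp add: d_def)
qed

theorem prime_sum_asymp: "((\<lambda>y. prime_sum y / ln (ln y)) \<longlongrightarrow> 1) at_top"
proof (rule order_tendstoI)
  fix a :: real assume "a < 1"
  have "((\<lambda>y::real. (ln (ln y) - ln 2) / ln (ln y)) \<longlongrightarrow> 1) at_top" by real_asymp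
  then have "\<forall>\<^sub>F y in at_top. a < (ln (ln y) - ln 2) / ln (ln y)"
    using \<open>a < 1\<close> order_tendstoD(1) by blast
  moreover have "\<forall>\<^sub>F y in at_top. (0::real) < ln (ln y)" by real_asymp
  moreover have "\<forall>\<^sub>F y in at_top. (1::real) < y" by real_asymp
  ultimately show "\<forall>\<^sub>F y in at_top. a < prime_sum y / ln (ln y)"
  proof eventually_elim
    case (elim y)
    have "(ln (ln y) - ln 2) / ln (ln y) \<le> prime_sum y / ln (ln y)"
      using elim prime_sum_lower by (intro divide_right_mono) auto
    then show ?case using elim by linarith
  qed
next
  fix a :: real assume a: "1 < a"
  \<comment> \<open>Then \<open>exp (1 / K)\<close> is the square root of \<open>a\<close>, which
    leaves room below \<open>a\<close>.\<close>
  define K where "K = 2 / ln a"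
  have K: "0 < K" "exp (1 / K) < a"
  proof -
    show "0 < K" using a by (simp add: K_def)
    have "exp (1 / K) < exp (ln a)" using a by (subst exp_less_cancel_iff) (simp add: K_def)
    then show "exp (1 / K) < a" using a by simp
  qed
  have "((\<lambda>y. exp (1 / K) * (ln (1 + K * ln y) + 2) / ln (ln y)) \<longlongrightarrow> exp (1 / K)) at_top"
    using K(1) by real_asymp
  then have "\<forall>\<^sub>F y in at_top. exp (1 / K) * (ln (1 + K * ln y) + 2) / ln (ln y) < a"
    using K(2) order_tendstoD(2) by blast
  moreover have "\<forall>\<^sub>F y in at_top. (0::real) < ln (ln y)" by real_asymp
  moreover have "\<forall>\<^sub>F y in at_top. (1::real) < y" by real_asymp
  ultimately show "\<forall>\<^sub>F y in at_top. prime_sum y / ln (ln y) < a"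
  proof eventually_elim
    case (elim y)
    have "prime_sum y / ln (ln y) \<le> exp (1 / K) * (ln (1 + K * ln y) + 2) / ln (ln y)"
      using elim K(1) prime_sum_upper by (intro divide_right_mono) auto
    then show ?case using elim by linarith
  qed
qed

section \<open>LCM-free sets from families of primes\<close>

lemma lcm_prod_primes:
  fixes X Y :: "nat set"
  assumes "finite X" "finite Y" "\<And>p. p \<in> X \<union> Y \<Longrightarrow> prime p"
  shows "lcm (\<Prod>X) (\<Prod>Y) = \<Prod>(X \<union> Y)"
proof (rule dvd_antisym)
  show "lcm (\<Prod>X) (\<Prod>Y) dvd \<Prod>(X \<union> Y)"
    using assms(1,2) by (intro lcm_least prod_dvd_prod_subset) auto
  have "coprime (\<Prod>X) (\<Prod>(Y - X))"
    using assms(3) by (intro prod_coprime_left prod_coprime_right primes_coprime) auto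
  moreover have "\<Prod>(Y - X) dvd lcm (\<Prod>X) (\<Prod>Y)"
    using assms(2) by (meson Diff_subset dvd_lcm2 dvd_trans prod_dvd_prod_subset)
  ultimately have "\<Prod>X * \<Prod>(Y - X) dvd lcm (\<Prod>X) (\<Prod>Y)"
    by (intro divides_mult) auto
  moreover have "\<Prod>(X \<union> (Y - X)) = \<Prod>X * \<Prod>(Y - X)"
    using assms(1,2) by (intro prod.union_disjoint) auto
  ultimately show "\<Prod>(X \<union> Y) dvd lcm (\<Prod>X) (\<Prod>Y)" by simp
qed

text \<open>On sets of primes \<open>prime_factors\<close> inverts \<open>Prod\<close>, and it turns
  a common lcm into a common union.\<close>

lemma lcm_free_prods:
  assumes "union_free k F" "\<And>X. X \<in> F \<Longrightarrow> finite X \<and> (\<forall>p\<in>X. prime p)"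
  shows "lcm_free k (Prod ` F)"
  unfolding lcm_free_def
proof safe
  fix T m assume T: "T \<subseteq> Prod ` F" "k = card T" "pairwise (\<lambda>a b. lcm a b = m) T"
  have pf: "prime_factors t \<in> F \<and> \<Prod>(prime_factors t) = t \<and> t \<noteq> 0" if t: "t \<in> T" for t
  proof -
    obtain X where X: "X \<in> F" "t = \<Prod>X" using t T(1) by auto
    have "prime_factors t = X" "0 < t"
      unfolding X(2) using prime_factors_prod_primes[of X] prod_primes_pos[of X] assms(2)[OF X(1)]
      by blast+
    then show ?thesis using X by simp
  qed
  have inj: "inj_on prime_factors T" by (rule inj_on_inverseI[of _ Prod]) (use pf in blast)
  show False
  proof (rule union_freeD[OF assms(1), of "prime_factors ` T" "prime_factors m"])
    show "prime_factors ` T \<subseteq> F" using pf by blast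
    show "card (prime_factors ` T) = k" using card_image[OF inj] T(2) by simp
    show "pairwise (\<lambda>X Y. X \<union> Y = prime_factors m) (prime_factors ` T)"
    proof (rule pairwiseI)
      fix X Y assume "X \<in> prime_factors ` T" "Y \<in> prime_factors ` T" "X \<noteq> Y"
      then obtain a b where ab: "a \<in> T" "b \<in> T" "a \<noteq> b" "X = prime_factors a" "Y = prime_factors b"
        by auto
      then have "lcm a b = m" using T(3) by (auto simp: pairwise_def)
      then show "X \<union> Y = prime_factors m" using pf[OF ab(1)] pf[OF ab(2)] ab by auto
    qed
  qed
qed

text \<open>A common factor passes through \<open>lcm\<close>, so equal unions give equal lcms. In
  the application the factor is the square part.\<close>

lemma union_free_of_lcm_free:
  assumes "lcm_free k A" "finite P" "\<And>p. p \<in> P \<Longrightarrow> prime p" "1 \<le> m"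
  shows "union_free k {X. X \<subseteq> P \<and> m * \<Prod>X \<in> A}"
  unfolding union_free_def
proof safe
  fix T U assume T: "T \<subseteq> {X. X \<subseteq> P \<and> m * \<Prod>X \<in> A}" "k = card T" "pairwise (\<lambda>X Y. X \<union> Y = U) T"
  have X: "finite X \<and> (\<forall>p\<in>X. prime p)" if "X \<in> T" for X
    using that T(1) assms(2,3) finite_subset[of X P] by blast
  have inj: "inj_on (\<lambda>X. m * \<Prod>X) T"
  proof (rule inj_onI)
    fix X Y assume XY: "X \<in> T" "Y \<in> T" "m * \<Prod>X = m * \<Prod>Y"
    then have "\<Prod>X = \<Prod>Y" using assms(4) by simp
    then show "X = Y"
      using prime_factors_prod_primes[of X] prime_factors_prod_primes[of Y] X XY(1,2) by metis
  qed
  have "pairwise (\<lambda>a b. lcm a b = m * \<Prod>U) ((\<lambda>X. m * \<Prod>X) ` T)"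
  proof (rule pairwiseI)
    fix a b assume "a \<in> (\<lambda>X. m * \<Prod>X) ` T" "b \<in> (\<lambda>X. m * \<Prod>X) ` T" "a \<noteq> b"
    then obtain X Y where XY: "X \<in> T" "Y \<in> T" "X \<noteq> Y" "a = m * \<Prod>X" "b = m * \<Prod>Y" by auto
    have "X \<union> Y = U" using XY T(3) by (auto simp: pairwise_def)
    moreover have "lcm (\<Prod>X) (\<Prod>Y) = \<Prod>(X \<union> Y)"
      using X XY by (intro lcm_prod_primes) auto
    ultimately show "lcm a b = m * \<Prod>U" unfolding XY(4,5) by (simp add: lcm_mult_left)
  qed
  moreover have "(\<lambda>X. m * \<Prod>X) ` T \<subseteq> A" using T(1) by auto
  moreover have "card ((\<lambda>X. m * \<Prod>X) ` T) = k" using card_image[OF inj] T(2) by simp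
  ultimately show False using assms(1) unfolding lcm_free_def by blast
qed

lemma finite_lcm_free_sums: "finite {(\<Sum>a\<in>A. 1 / real a) |A. A \<subseteq> {1..N} \<and> lcm_free k A}"
  by (rule finite_subset[of _ "(\<lambda>A. \<Sum>a\<in>A. 1 / real a) ` Pow {1..N}"]) auto

lemma sum_le_lcm_free_max:
  "A \<subseteq> {1..N} \<Longrightarrow> lcm_free k A \<Longrightarrow> (\<Sum>a\<in>A. 1 / real a) \<le> lcm_free_max k N"
  unfolding lcm_free_max_def by (rule Max_ge[OF finite_lcm_free_sums]) auto

lemma lcm_free_singleton: "2 \<le> k \<Longrightarrow> lcm_free k {a}"
proof -
  assume k: "2 \<le> k"
  have "card T \<noteq> k" if "T \<subseteq> {a}" for T using card_mono[OF _ that] k by simp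
  then show ?thesis by (auto simp: lcm_free_def)
qed

lemma lcm_free_max_ge_1: "2 \<le> k \<Longrightarrow> 1 \<le> N \<Longrightarrow> 1 \<le> lcm_free_max k N"
  using sum_le_lcm_free_max[of "{1}" N k] lcm_free_singleton[of k 1] by simp

lemma lcm_free_max_le:
  assumes "2 \<le> k"
    and B: "\<And>F. union_free k F \<Longrightarrow> F \<subseteq> Pow (primes_le (real N)) \<Longrightarrow> fam_weight (\<lambda>p. 1 / real p) F \<le> B"
  shows "lcm_free_max k N \<le> 2 * B"
proof -
  have "{} \<in> {A. A \<subseteq> {1..N} \<and> lcm_free k A}" using assms(1) by (auto simp: lcm_free_def)
  then have "lcm_free_max k N \<in> {(\<Sum>a\<in>A. 1 / real a) |A. A \<subseteq> {1..N} \<and> lcm_free k A}"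
    unfolding lcm_free_max_def by (intro Max_in finite_lcm_free_sums) blast
  then obtain A where A: "A \<subseteq> {1..N}" "lcm_free k A" "lcm_free_max k N = (\<Sum>a\<in>A. 1 / real a)"
    by auto
  show ?thesis
    unfolding A(3)
  proof (rule sum_inverse_decompose[OF A(1)], rule B)
    fix m :: nat assume "1 \<le> m"
    then show "union_free k {X. X \<subseteq> primes_le (real N) \<and> m\<^sup>2 * \<Prod>X \<in> A}"
      by (intro union_free_of_lcm_free A) (auto simp: primes_le_def)
  qed auto
qed

section \<open>Splitting many small weights into classes of prescribed mass\<close>

lemma greedy_subset:
  fixes v :: "'a \<Rightarrow> real"
  assumes "finite Q" "\<And>q. q \<in> Q \<Longrightarrow> 0 \<le> v q \<and> v q \<le> e" "0 \<le> e" "0 \<le> w" "w \<le> sum v Q"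
  shows "\<exists>Q'\<subseteq>Q. w \<le> sum v Q' \<and> sum v Q' \<le> w + e"
  using assms(1,2,5)
proof (induction Q rule: finite_induct)
  case empty
  then show ?case using assms(3,4) by auto
next
  case (insert q Q)
  show ?case
  proof (cases "w \<le> sum v Q")
    case True
    then show ?thesis using insert.IH insert.prems by (metis insertI2 subset_insertI2)
  next
    case False
    have "v q \<le> e" using insert.prems(1) by auto
    then have "w \<le> sum v (insert q Q) \<and> sum v (insert q Q) \<le> w + e"
      using False insert.hyps insert.prems(2) by auto
    then show ?thesis by blast
  qed
qed

text \<open>Each class is filled point by point until it reaches \<open>w i\<close>, and so
  overshoots by at most \<open>e\<close>; hence the budget contains one \<open>e\<close> per
  class.\<close>

lemma greedy_classes:
  fixes v :: "'a \<Rightarrow> real" and w :: "'b \<Rightarrow> real"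
  assumes "finite I" "finite Q" "\<And>q. q \<in> Q \<Longrightarrow> 0 \<le> v q \<and> v q \<le> e" "0 \<le> e"
    "\<And>i. i \<in> I \<Longrightarrow> 0 \<le> w i" "sum w I + e * real (card I) \<le> sum v Q"
  shows "\<exists>c Q'. Q' \<subseteq> Q \<and> (\<forall>i\<in>I. w i \<le> sum v {q\<in>Q'. c q = i})
           \<and> sum v Q' \<le> sum w I + e * real (card I)"
  using assms(1,5,6)
proof (induction I rule: finite_induct)
  case empty
  then show ?case by (intro exI[of _ "\<lambda>_. undefined"] exI[of _ "{}"]) auto
next
  case (insert i I)
  have wi: "0 \<le> w i" using insert by auto
  have "sum w I + e * real (card I) \<le> sum v Q"
    using insert.prems(2) insert.hyps wi assms(4) by (auto simp: algebra_simps)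
  then obtain c Q' where Q': "Q' \<subseteq> Q" "\<forall>i\<in>I. w i \<le> sum v {q\<in>Q'. c q = i}"
      "sum v Q' \<le> sum w I + e * real (card I)"
    using insert.IH insert.prems(1) by auto
  have fQ': "finite Q'" using Q'(1) assms(2) finite_subset by blast
  have "sum v (Q - Q') = sum v Q - sum v Q'" using Q'(1) assms(2) by (simp add: sum_diff)
  then have "w i \<le> sum v (Q - Q')"
    using insert.prems(2) insert.hyps Q'(3) assms(4) by (auto simp: algebra_simps)
  then obtain R where R: "R \<subseteq> Q - Q'" "w i \<le> sum v R" "sum v R \<le> w i + e"
    using greedy_subset[of "Q - Q'" v e "w i"] assms(2,3,4) wi by auto
  have fR: "finite R" using R(1) assms(2) finite_subset by blast
  define c' where "c' q = (if q \<in> R then i else c q)" for q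
  have "w j \<le> sum v {q\<in>Q' \<union> R. c' q = j}" if "j \<in> insert i I" for j
  proof (cases "j = i")
    case True
    have "sum v R \<le> sum v {q\<in>Q' \<union> R. c' q = i}"
      using Q'(1) R(1) fQ' fR assms(3) by (intro sum_mono2) (auto simp: c'_def)
    then show ?thesis using True R(2) by simp
  next
    case False
    then have "j \<in> I" using that by simp
    moreover have "{q\<in>Q'. c q = j} \<subseteq> {q\<in>Q' \<union> R. c' q = j}"
      using R(1) by (auto simp: c'_def)
    then have "sum v {q\<in>Q'. c q = j} \<le> sum v {q\<in>Q' \<union> R. c' q = j}"
      using Q'(1) R(1) fQ' fR assms(3) by (intro sum_mono2) auto
    ultimately show ?thesis using Q'(2) by fastforce
  qed
  moreover have "sum v (Q' \<union> R) = sum v Q' + sum v R"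
    using R(1) fQ' fR by (intro sum.union_disjoint) auto
  then have "sum v (Q' \<union> R) \<le> sum w (insert i I) + e * real (card (insert i I))"
    using Q'(3) R(3) insert.hyps by (simp add: algebra_simps)
  moreover have "Q' \<union> R \<subseteq> Q" using Q'(1) R(1) by blast
  ultimately show ?case by blast
qed

lemma blowup_copy:
  fixes v :: "'a \<Rightarrow> real" and w :: "'b \<Rightarrow> real"
  assumes I: "finite I" "F \<subseteq> Pow I" "\<And>i. i \<in> I \<Longrightarrow> 0 \<le> w i" and F: "free_antichain k F" "3 \<le> k"
    and Q: "finite Q" "\<And>q. q \<in> Q \<Longrightarrow> 0 \<le> v q \<and> v q \<le> e" "0 \<le> e"
    and mass: "sum w I + e * real (card I) \<le> sum v Q"
  shows "\<exists>Q' A. Q' \<subseteq> Q \<and> sum v Q' \<le> sum w I + e * real (card I) \<and> A \<subseteq> Pow Q' \<and> free_antichain k A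
    \<and> fam_weight w F \<le> fam_weight v A \<and> (\<forall>X\<in>A. card X \<le> card I)"
proof -
  obtain c Q' where c: "Q' \<subseteq> Q" "\<forall>i\<in>I. w i \<le> sum v {q\<in>Q'. c q = i}"
      "sum v Q' \<le> sum w I + e * real (card I)"
    using greedy_classes[OF I(1) Q(1,2,3) I(3) mass] by auto
  have fQ': "finite Q'" using c(1) Q(1) finite_subset by blast
  have "free_antichain k (blowup c Q' F)" using F by (rule free_antichain_blowup)
  moreover have "fam_weight w F \<le> fam_weight (\<lambda>i. sum v {q\<in>Q'. c q = i}) F"
    using I(2,3) c(2) by (intro fam_weight_mono) blast
  then have "fam_weight w F \<le> fam_weight v (blowup c Q' F)"
    by (simp add: fam_weight_blowup[OF fQ' I(2,1)])
  moreover have "card X \<le> card I" if "X \<in> blowup c Q' F" for X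
  proof -
    have "inj_on c X" "c ` X \<subseteq> I" using I(2) that by (auto simp: blowup_def)
    then show ?thesis using I(1) by (rule card_inj_on_le)
  qed
  moreover have "blowup c Q' F \<subseteq> Pow Q'" by (auto simp: blowup_def)
  ultimately show ?thesis using c(1,3) by blast
qed

text \<open>Copies are built one after another from the points not yet used and joined by
  \<open>fam_prod\<close>. The cardinality bound serves to keep the later products of primes below
  \<open>N\<close>.\<close>

lemma blowup_power:
  fixes v :: "'a \<Rightarrow> real" and w :: "'b \<Rightarrow> real"
  assumes I: "finite I" "F \<subseteq> Pow I" "\<And>i. i \<in> I \<Longrightarrow> 0 \<le> w i" and F: "free_antichain k F" "3 \<le> k"
    and "0 \<le> e" "finite Q" "\<And>q. q \<in> Q \<Longrightarrow> 0 \<le> v q \<and> v q \<le> e"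
      "real m * (sum w I + e * real (card I)) \<le> sum v Q"
  shows "\<exists>A. A \<subseteq> Pow Q \<and> free_antichain k A \<and> fam_weight w F ^ m \<le> fam_weight v A
           \<and> (\<forall>X\<in>A. card X \<le> m * card I)"
  using assms(7,8,9)
proof (induction m arbitrary: Q)
  case 0
  have "free_antichain k {{}}" using F(2) by (intro free_antichain_singleton) simp
  then show ?case by (intro exI[of _ "{{}}"]) (simp add: fam_weight_def)
next
  case (Suc m)
  let ?T = "sum w I + e * real (card I)"
  have T0: "0 \<le> ?T" using I(3) \<open>0 \<le> e\<close> by (intro add_nonneg_nonneg sum_nonneg) auto
  have "1 * ?T \<le> real (Suc m) * ?T" using T0 by (intro mult_right_mono) auto
  then have mass: "?T \<le> sum v Q" using order_trans[OF _ Suc.prems(3)] by simp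
  obtain Q' A where A: "Q' \<subseteq> Q" "sum v Q' \<le> ?T" "A \<subseteq> Pow Q'" "free_antichain k A"
    "fam_weight w F \<le> fam_weight v A" "\<forall>X\<in>A. card X \<le> card I"
  proof -
    have "\<exists>Q' A. Q' \<subseteq> Q \<and> sum v Q' \<le> ?T \<and> A \<subseteq> Pow Q' \<and> free_antichain k A
        \<and> fam_weight w F \<le> fam_weight v A \<and> (\<forall>X\<in>A. card X \<le> card I)"
      by (rule blowup_copy[OF I F Suc.prems(1,2) \<open>0 \<le> e\<close> mass])
    then show ?thesis by (elim exE conjE) (rule that)
  qed
  have fQ': "finite Q'" using A(1) Suc.prems(1) finite_subset by blast
  have "sum v (Q - Q') = sum v Q - sum v Q'" using A(1) Suc.prems(1) by (simp add: sum_diff)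
  then have "real m * ?T \<le> sum v (Q - Q')" using Suc.prems(3) A(2) by (simp add: distrib_right)
  then obtain B where B: "B \<subseteq> Pow (Q - Q')" "free_antichain k B" "fam_weight w F ^ m \<le> fam_weight v B"
      "\<forall>X\<in>B. card X \<le> m * card I"
    using Suc.IH[of "Q - Q'"] Suc.prems(1,2) by auto
  have F0: "0 \<le> fam_weight w F"
    unfolding fam_weight_def using I(2,3) by (intro sum_nonneg prod_nonneg) blast
  have "fam_weight w F ^ Suc m \<le> fam_weight v A * fam_weight v B"
    using A(5) B(3) F0 by (simp add: mult_mono order_trans[OF F0])
  also have "\<dots> = fam_weight v (fam_prod A B)"
    using A(3) B(1) fQ' Suc.prems(1)
      by (intro fam_weight_fam_prod[symmetric, of A Q' B "Q - Q'"]) auto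
  finally have "fam_weight w F ^ Suc m \<le> fam_weight v (fam_prod A B)" .
  moreover have "free_antichain k (fam_prod A B)"
    using A B F(2) by (intro free_antichain_fam_prod[where P=Q' and Q="Q - Q'"]) auto
  moreover have "fam_prod A B \<subseteq> Pow Q"
    using fam_prod_Pow[OF A(3) B(1)] A(1) by (simp add: Un_absorb1)
  moreover have "card Z \<le> Suc m * card I" if Z: "Z \<in> fam_prod A B" for Z
  proof -
    obtain X Y where XY: "X \<in> A" "Y \<in> B" "Z = X \<union> Y" using Z by (auto simp: fam_prod_def)
    then show ?thesis using card_Un_le[of X Y] A(6) B(4) by fastforce
  qed
  ultimately show ?case by blast
qed

lemma lcm_free_max_ge_fam_weight:
  assumes "free_antichain k A" "A \<subseteq> Pow Q" "finite Q" "\<And>q. q \<in> Q \<Longrightarrow> prime q"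
    and "\<And>X. X \<in> A \<Longrightarrow> \<Prod>X \<le> N"
  shows "fam_weight (\<lambda>p. 1 / real p) A \<le> lcm_free_max k N"
proof -
  have X: "finite X" "\<And>p. p \<in> X \<Longrightarrow> prime p" if "X \<in> A" for X
    using that assms(2,3,4) finite_subset[of X Q] by auto
  have inj: "inj_on Prod A"
    by (intro inj_onI) (metis X prime_factors_prod_primes)
  have "fam_weight (\<lambda>p. 1 / real p) A = (\<Sum>a\<in>Prod ` A. 1 / real a)"
    by (simp add: fam_weight_def inverse_prod_primes sum.reindex[OF inj])
  also have "\<dots> \<le> lcm_free_max k N"
  proof (rule sum_le_lcm_free_max)
    have "0 < \<Prod>Y" if "Y \<in> A" for Y using X(2)[OF that] by (intro prod_primes_pos)
    then show "Prod ` A \<subseteq> {1..N}" using assms(5) by (fastforce simp: Suc_le_eq)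
    show "lcm_free k (Prod ` A)"
      using assms(1) X by (intro lcm_free_prods) (auto simp: free_antichain_def)
  qed
  finally show ?thesis .
qed

text \<open>Use about \<open>ln (ln N) / sum w I\<close> copies of the family, each blown up by splitting the
  primes up to \<open>y = exp ((ln N) powr a)\<close>, \<open>a < 1\<close>, into classes of reciprocal sum slightly
  above \<open>w i\<close>. The resulting products have \<open>O(ln (ln N))\<close> prime factors, so they do not
  exceed \<open>N\<close>, while \<open>ln (ln y) = a ln (ln N)\<close>.\<close>

lemma lcm_free_max_lower:
  fixes w :: "'b \<Rightarrow> real"
  assumes I: "finite I" "F \<subseteq> Pow I" "\<And>i. i \<in> I \<Longrightarrow> 0 \<le> w i" and F: "free_antichain k F" "3 \<le> k"
    and T: "0 < sum w I" and x: "x * sum w I < ln (fam_weight w F)" and W: "1 \<le> fam_weight w F"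
  shows "\<forall>\<^sub>F N in sequentially. x * ln (ln (real N)) < ln (lcm_free_max k N)"
proof (cases "0 \<le> x")
  case False
  have "\<forall>\<^sub>F N in sequentially. 0 < ln (ln (real N))" by real_asymp
  then show ?thesis
    using eventually_ge_at_top[of 1]
  proof eventually_elim
    case (elim N)
    have "x * ln (ln (real N)) < 0" using False elim by (simp add: mult_neg_pos)
    also have "0 \<le> ln (lcm_free_max k N)" using lcm_free_max_ge_1[of k N] F(2) elim by simp
    finally show ?case .
  qed
next
  case True
  define r where "r = ln (fam_weight w F)"
  have r: "0 < r" "x * sum w I < r" using x True T unfolding r_def
    by (auto intro: order.strict_trans1[rotated] mult_nonneg_nonneg)
  \<comment> \<open>A tolerance small enough that the mass \<open>T'\<close> of one copy, overshoot
    included, still satisfies \<open>x * T' < r\<close>.\<close>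
  define e where "e = (r - x * sum w I) / (2 * (x + 1) * (real (card I) + 1))"
  have e: "0 < e" using r True by (simp add: e_def add_pos_nonneg)
  define T' where "T' = sum w I + e * real (card I)"
  have T': "0 < T'" using T e by (simp add: T'_def add_pos_nonneg)
  have "x * e * real (card I) \<le> (x + 1) * e * (real (card I) + 1)"
    using True e by (intro mult_mono) auto
  also have "\<dots> = e * (2 * (x + 1) * (real (card I) + 1)) / 2" by (simp add: field_simps)
  also have "\<dots> = (r - x * sum w I) / 2"
    using True by (simp add: e_def add_nonneg_eq_0_iff)
  finally have xT': "x * T' < r" using r by (simp add: T'_def algebra_simps)
  obtain z where z: "x * T' / r < z" "z < 1" using dense[of "x * T' / r" 1] xT' r by auto
  have z0: "0 < z" using z(1) True T' r by (smt (verit) divide_nonneg_pos mult_nonneg_nonneg)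
  \<comment> \<open>One factor \<open>a\<close> is lost in \<open>ln (ln y) = a * ln (ln N)\<close>
    and another in \<open>prime_sum y > a * ln (ln y)\<close>; together they cost the factor
    \<open>z\<close>.\<close>
  define a where "a = sqrt z"
  have a: "0 < a" "a < 1" "a * a = z" using z z0 by (auto simp: a_def real_sqrt_lt_1_iff)
  \<comment> \<open>This bounds the mass of the discarded primes, whose reciprocals exceed
    \<open>e\<close> and are too coarse for the greedy classes; it does not depend on
    \<open>N\<close>.\<close>
  define c0 where "c0 = prime_sum (1 / e)"
  define y where "y N = exp (ln (real N) powr a)" for N :: nat
  have ylim: "filterlim y at_top sequentially"
    unfolding y_def using a by real_asymp
  have lny: "\<forall>\<^sub>F N in sequentially. ln (ln (y N)) = a * ln (ln (real N))"
    using eventually_gt_at_top[of 2]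
  proof eventually_elim
    case (elim N)
    then show ?case by (simp add: y_def ln_powr)
  qed
  have ratio: "((\<lambda>N. prime_sum (y N) / ln (ln (y N))) \<longlongrightarrow> 1) sequentially"
    using filterlim_compose[OF prime_sum_asymp ylim] .
  have ev1: "\<forall>\<^sub>F N in sequentially. a < prime_sum (y N) / ln (ln (y N))"
    using order_tendstoD(1)[OF ratio a(2)] .
  have ev2: "\<forall>\<^sub>F N in sequentially. prime_sum (y N) / ln (ln (y N)) < 2"
    using order_tendstoD(2)[OF ratio] by simp
  have ev3: "\<forall>\<^sub>F N in sequentially. 0 < ln (ln (real N))" by real_asymp
  define C where "C = 2 * a / T' * real (card I)"
  have "((\<lambda>N. C * (ln (ln (real N)) * (ln (real N) powr a)) / ln (real N)) \<longlongrightarrow> C * 0) sequentially"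
    unfolding times_divide_eq_right[symmetric]
      using a by (intro tendsto_mult tendsto_const) real_asymp
  then have ev4: "\<forall>\<^sub>F N in sequentially. C * (ln (ln (real N)) * (ln (real N) powr a)) / ln (real N) < 1"
    using order_tendstoD(2)[of _ "C * 0" sequentially 1] by simp
  have slope: "x < z * r / T'" using z(1) r T' by (simp add: field_simps)
  have "((\<lambda>N. ((z * ln (ln (real N)) - c0) / T' - 1) * r / ln (ln (real N))) \<longlongrightarrow> z * r / T') sequentially"
  proof -
    have "((\<lambda>N. z * r / T' - (c0 / T' + 1) * r * (1 / ln (ln (real N)))) \<longlongrightarrow> z * r / T' - (c0 / T' + 1) * r * 0) sequentially"
      by (intro tendsto_intros) real_asymp
    moreover have "\<forall>\<^sub>F N in sequentially. z * r / T' - (c0 / T' + 1) * r * (1 / ln (ln (real N)))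
        = ((z * ln (ln (real N)) - c0) / T' - 1) * r / ln (ln (real N))"
      using ev3 by eventually_elim (use T' in \<open>simp add: field_simps\<close>)
    ultimately show ?thesis using Lim_transform_eventually by fastforce
  qed
  then have ev5: "\<forall>\<^sub>F N in sequentially. x < ((z * ln (ln (real N)) - c0) / T' - 1) * r / ln (ln (real N))"
    using slope order_tendstoD(1) by blast
  show ?thesis
    using ev1 ev2 ev3 ev4 ev5 lny eventually_gt_at_top[of 2]
  proof eventually_elim
    case (elim N)
    let ?L = "ln (ln (real N))"
    have lnN: "0 < ln (real N)" using elim(7) by simp
    have ly: "ln (ln (y N)) = a * ?L" "0 < a * ?L" using elim a by auto
    have ps: "z * ?L < prime_sum (y N)" "prime_sum (y N) < 2 * a * ?L"
      using elim(1,2) ly a(3)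
        by (auto simp: pos_less_divide_eq pos_divide_less_eq mult.assoc[symmetric])
    define Q where "Q = {p \<in> primes_le (y N). 1 / real p \<le> e}"
    define m where "m = nat \<lfloor>(prime_sum (y N) - c0) / T'\<rfloor>"
    have finQ: "finite Q" by (simp add: Q_def)
    have "primes_le (y N) \<subseteq> Q \<union> primes_le (1 / e)"
    proof
      fix p assume p: "p \<in> primes_le (y N)"
      then have "prime p" by (simp add: primes_le_def)
      then have "0 < real p" by (simp add: prime_gt_0_nat)
      then have "1 / real p \<le> e \<or> real p \<le> 1 / e"
        using e by (simp add: field_simps linear)
      then show "p \<in> Q \<union> primes_le (1 / e)"
        using p \<open>prime p\<close> by (auto simp: Q_def primes_le_def)
    qed
    then have "prime_sum (y N) \<le> (\<Sum>p\<in>Q \<union> primes_le (1 / e). 1 / real p)"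
      unfolding prime_sum_def using finQ by (intro sum_mono2) auto
    also have "\<dots> \<le> (\<Sum>p\<in>Q. 1 / real p) + c0"
      unfolding c0_def prime_sum_def using finQ by (simp add: sum_Un sum_nonneg)
    finally have massQ: "prime_sum (y N) - c0 \<le> (\<Sum>p\<in>Q. 1 / real p)" by simp
    have mle: "real m * T' \<le> (\<Sum>p\<in>Q. 1 / real p)"
    proof (cases "0 \<le> (prime_sum (y N) - c0) / T'")
      case True
      then have "real m \<le> (prime_sum (y N) - c0) / T'" by (simp add: m_def)
      then have "real m * T' \<le> prime_sum (y N) - c0" using T' by (simp add: pos_le_divide_eq)
      then show ?thesis using massQ by simp
    next
      case False
      then have "m = 0" by (simp add: m_def floor_le_iff)
      then show ?thesis by (simp add: sum_nonneg)
    qed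
    have mge: "(prime_sum (y N) - c0) / T' - 1 \<le> real m" unfolding m_def by linarith
    have "\<exists>A. A \<subseteq> Pow Q \<and> free_antichain k A \<and> fam_weight w F ^ m \<le> fam_weight (\<lambda>p. 1 / real p) A
        \<and> (\<forall>X\<in>A. card X \<le> m * card I)"
    proof (rule blowup_power[OF I F])
      show "0 \<le> e" using e by simp
      show "0 \<le> 1 / real q \<and> 1 / real q \<le> e" if "q \<in> Q" for q using that by (simp add: Q_def)
      show "real m * (sum w I + e * real (card I)) \<le> (\<Sum>p\<in>Q. 1 / real p)"
        using mle by (simp add: T'_def)
    qed (use finQ in auto)
    then obtain A where A: "A \<subseteq> Pow Q" "free_antichain k A" "fam_weight w F ^ m \<le> fam_weight (\<lambda>p. 1 / real p) A"
        "\<forall>X\<in>A. card X \<le> m * card I"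
      by (elim exE conjE) (rule that)
    have y1: "1 \<le> y N" by (simp add: y_def)
    have "real m * T' \<le> 2 * a * ?L"
    proof -
      have "(\<Sum>p\<in>Q. 1 / real p) \<le> prime_sum (y N)"
        unfolding prime_sum_def by (intro sum_mono2) (auto simp: Q_def)
      then show ?thesis using mle ps(2) by simp
    qed
    then have "real m \<le> 2 * a * ?L / T'" using T' by (simp add: pos_le_divide_eq)
    then have "real m * real (card I) \<le> 2 * a * ?L / T' * real (card I)"
      by (rule mult_right_mono) simp
    then have mC: "real (m * card I) \<le> C * ?L" by (simp add: C_def mult_ac)
    have "\<Prod>X \<le> N" if X: "X \<in> A" for X
    proof -
      have XQ: "X \<subseteq> Q" using X A(1) by auto
      have "real (\<Prod>X) = (\<Prod>p\<in>X. real p)" by simp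
      also have "\<dots> \<le> (\<Prod>p\<in>X. y N)" using XQ by (intro prod_mono) (auto simp: Q_def primes_le_def)
      also have "\<dots> = y N ^ card X" by simp
      also have "\<dots> \<le> y N ^ (m * card I)" using A(4) X y1 by (intro power_increasing) auto
      also have "\<dots> = exp (real (m * card I) * ln (real N) powr a)"
        by (simp add: y_def exp_of_nat_mult[symmetric])
      also have "\<dots> \<le> exp (C * ?L * ln (real N) powr a)"
        using mC by (simp del: of_nat_mult add: mult_right_mono)
      also have "\<dots> \<le> exp (ln (real N))"
        using elim(4) lnN by (simp add: pos_divide_less_eq mult.assoc)
      also have "\<dots> = real N" using elim(7) by simp
      finally show ?thesis by (simp only: of_nat_le_iff)
    qed
    then have "fam_weight (\<lambda>p. 1 / real p) A \<le> lcm_free_max k N"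
      by (intro lcm_free_max_ge_fam_weight[OF A(2,1) finQ]) (simp_all add: Q_def primes_le_def)
    then have "fam_weight w F ^ m \<le> lcm_free_max k N" using A(3) by (rule order_trans[rotated])
    then have "ln (fam_weight w F ^ m) \<le> ln (lcm_free_max k N)"
      using W by (intro ln_mono) (auto intro: order.strict_trans2[OF zero_less_one])
    then have 1: "real m * r \<le> ln (lcm_free_max k N)" by (simp add: r_def ln_realpow)
    have "x * ?L < ((z * ?L - c0) / T' - 1) * r" using elim(3,5) by (simp add: pos_less_divide_eq)
    also have "\<dots> \<le> ((prime_sum (y N) - c0) / T' - 1) * r"
      using ps(1) T' r by (intro mult_right_mono diff_right_mono divide_right_mono) auto
    also have "\<dots> \<le> real m * r" using mge r by (intro mult_right_mono) auto
    finally show ?case using 1 by simp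
  qed
qed

section \<open>The exponent of LCM-free sets\<close>

text \<open>The supremum has to range over a single ground type; \<open>nat\<close> is the type in
  which the primes live.\<close>

definition scores :: "nat \<Rightarrow> real set" where
  "scores k = {ln (fam_weight w F) / sum w I | (I :: nat set) w F.
     finite I \<and> (\<forall>i\<in>I. 0 < w i) \<and> F \<subseteq> Pow I \<and> free_antichain k F \<and> 1 \<le> fam_weight w F \<and> 0 < sum w I}"

definition growth :: "nat \<Rightarrow> real" where
  "growth k = Sup (scores k)"

lemma scores_le_1:
  assumes "x \<in> scores k"
  shows "x \<le> 1"
proof -
  obtain I :: "nat set" and w F where I: "finite I" "\<forall>i\<in>I. 0 < w i" "F \<subseteq> Pow I" "1 \<le> fam_weight w F" "0 < sum w I"
    and x: "x = ln (fam_weight w F) / sum w I"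
    using assms unfolding scores_def by blast
  have "fam_weight w F \<le> exp (sum w I)"
    using I by (intro fam_weight_le_exp) (auto simp: less_imp_le)
  then have "ln (fam_weight w F) \<le> ln (exp (sum w I))" using I(4) by (intro ln_mono) auto
  then have "ln (fam_weight w F) \<le> sum w I" by simp
  then show ?thesis using I(5) x by simp
qed

lemma zero_in_scores: "2 \<le> k \<Longrightarrow> 0 \<in> scores k"
  unfolding scores_def
  by (rule CollectI, rule exI[of _ "{0}"], rule exI[of _ "\<lambda>_. 1"], rule exI[of _ "{{0}}"])
    (simp add: free_antichain_singleton fam_weight_def)

lemma bdd_above_scores: "bdd_above (scores k)"
  using scores_le_1 by (rule bdd_aboveI)

lemma growth_nonneg: "2 \<le> k \<Longrightarrow> 0 \<le> growth k"
  unfolding growth_def by (rule cSup_upper[OF zero_in_scores bdd_above_scores])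

lemma growth_mono: "2 \<le> k \<Longrightarrow> k \<le> l \<Longrightarrow> growth k \<le> growth l"
proof -
  assume k: "2 \<le> k" "k \<le> l"
  have "free_antichain l F" if "free_antichain k F" for F :: "nat set set"
    using that union_free_mono[of k F l] k(2) by (simp add: free_antichain_def)
  then have "scores k \<subseteq> scores l" unfolding scores_def by blast
  then show ?thesis
    unfolding growth_def using zero_in_scores[OF k(1)] bdd_above_scores
    by (intro cSup_subset_mono) auto
qed

lemma fam_weight_le_growth:
  fixes I :: "nat set"
  assumes "finite I" "\<And>i. i \<in> I \<Longrightarrow> 0 < w i" "F \<subseteq> Pow I" "free_antichain k F" "2 \<le> k"
  shows "fam_weight w F \<le> exp (growth k * sum w I)"
proof (cases "1 \<le> fam_weight w F \<and> 0 < sum w I")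
  case True
  then have "ln (fam_weight w F) / sum w I \<in> scores k"
    using assms unfolding scores_def by blast
  then have "ln (fam_weight w F) / sum w I \<le> growth k"
    unfolding growth_def by (rule cSup_upper[OF _ bdd_above_scores])
  then have "ln (fam_weight w F) \<le> growth k * sum w I" using True by (simp add: pos_divide_le_eq)
  then have "exp (ln (fam_weight w F)) \<le> exp (growth k * sum w I)" by simp
  then show ?thesis using True by simp
next
  case False
  have s: "0 \<le> sum w I" using assms(2) by (intro sum_nonneg) (auto simp: less_imp_le)
  have "fam_weight w F \<le> exp (sum w I)"
    using assms by (intro fam_weight_le_exp) (auto simp: less_imp_le)
  then have "fam_weight w F \<le> 1" using False s by (cases "sum w I = 0") auto
  also have "1 \<le> exp (growth k * sum w I)" using s growth_nonneg[OF assms(5)] by simp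
  finally show ?thesis .
qed

lemma fam_weight_scale:
  assumes "\<And>X. X \<in> F \<Longrightarrow> card X = j"
  shows "fam_weight (\<lambda>i. t * w i) F = t ^ j * fam_weight w F"
  unfolding fam_weight_def sum_distrib_left using assms
  by (intro sum.cong refl) (simp add: prod.distrib)

text \<open>Splitting into layers costs a factor; scaling the weights by \<open>t > 1\<close> turns the
  sum over the layers into a geometric series.\<close>

lemma union_free_weight_le:
  fixes I :: "nat set"
  assumes "2 \<le> k" "finite I" "\<And>i. i \<in> I \<Longrightarrow> 0 < w i" "F \<subseteq> Pow I" "union_free k F" "1 < t"
  shows "fam_weight w F \<le> t / (t - 1) * exp (growth k * t * sum w I)"
proof -
  let ?E = "exp (growth k * t * sum w I)"
  have finF: "finite F" using assms(2,4) finite_subset by blast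
  have layer: "fam_weight w {X\<in>F. card X = j} \<le> (1 / t) ^ j * ?E" for j
  proof -
    have "antichain {X\<in>F. card X = j}"
      using assms(2,4) by (intro antichain_uniform[of _ j]) (auto intro: finite_subset)
    then have "free_antichain k {X\<in>F. card X = j}"
      using union_free_subset[OF assms(5)] by (auto simp: free_antichain_def)
    then have "fam_weight (\<lambda>i. t * w i) {X\<in>F. card X = j} \<le> exp (growth k * (\<Sum>i\<in>I. t * w i))"
      using assms by (intro fam_weight_le_growth) auto
    moreover have "fam_weight (\<lambda>i. t * w i) {X\<in>F. card X = j} = t ^ j * fam_weight w {X\<in>F. card X = j}"
      by (rule fam_weight_scale) simp
    ultimately have "t ^ j * fam_weight w {X\<in>F. card X = j} \<le> ?E"
      by (simp add: sum_distrib_left[symmetric] mult.assoc)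
    then show ?thesis using assms(6) by (simp add: field_simps)
  qed
  have cards: "card ` F \<subseteq> {..card I}" using assms(2,4) by (auto intro: card_mono)
  have "fam_weight w F = (\<Sum>j\<in>{..card I}. fam_weight w {X\<in>F. card X = j})"
    unfolding fam_weight_def by (rule sum.group[OF finF _ cards, symmetric]) simp
  also have "\<dots> \<le> (\<Sum>j\<in>{..card I}. (1 / t) ^ j * ?E)" by (intro sum_mono layer)
  also have "\<dots> = (\<Sum>j<Suc (card I). (1 / t) ^ j) * ?E"
    by (simp add: sum_distrib_right lessThan_Suc_atMost)
  also have "\<dots> \<le> t / (t - 1) * ?E"
  proof (rule mult_right_mono)
    have "(\<Sum>j<Suc (card I). (1 / t) ^ j) = (1 - (1 / t) ^ Suc (card I)) / (1 - 1 / t)"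
      using assms(6) by (subst sum_gp_strict) auto
    also have "\<dots> \<le> 1 / (1 - 1 / t)" using assms(6) by (intro divide_right_mono) auto
    also have "\<dots> = t / (t - 1)" using assms(6) by (simp add: field_simps)
    finally show "(\<Sum>j<Suc (card I). (1 / t) ^ j) \<le> t / (t - 1)" .
  qed simp
  finally show ?thesis .
qed

lemma prime_sum_linear_limit:
  "(\<lambda>N. (c + b * prime_sum (real N)) / ln (ln (real N))) \<longlonglongrightarrow> b"
proof -
  have "(\<lambda>N. prime_sum (real N) / ln (ln (real N))) \<longlonglongrightarrow> 1"
    by (rule filterlim_compose[OF prime_sum_asymp filterlim_real_sequentially])
  moreover have "(\<lambda>N. 1 / ln (ln (real N))) \<longlonglongrightarrow> 0" by real_asymp
  ultimately have "(\<lambda>N. c * (1 / ln (ln (real N))) + b * (prime_sum (real N) / ln (ln (real N))))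
      \<longlonglongrightarrow> c * 0 + b * 1"
    by (intro tendsto_intros)
  then show ?thesis by (simp add: add_divide_distrib)
qed

lemma ln_lcm_free_max_le:
  assumes "2 \<le> k" "0 < C" "1 \<le> N"
    and "\<And>F. union_free k F \<Longrightarrow> F \<subseteq> Pow (primes_le (real N)) \<Longrightarrow>
      fam_weight (\<lambda>p. 1 / real p) F \<le> C * exp (b * prime_sum (real N))"
  shows "ln (lcm_free_max k N) \<le> ln (2 * C) + b * prime_sum (real N)"
proof -
  have "ln (lcm_free_max k N) \<le> ln (2 * (C * exp (b * prime_sum (real N))))"
    using lcm_free_max_le[OF assms(1,4)] lcm_free_max_ge_1[OF assms(1,3)] by (intro ln_mono) auto
  also have "\<dots> = ln (2 * C) + b * prime_sum (real N)"
    using assms(2) by (simp add: ln_mult)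
  finally show ?thesis .
qed

text \<open>A nearly optimal score gives the lower bound. For the upper bound the layer estimate is
  used with \<open>t\<close> close to 1: its constant \<open>t / (t - 1)\<close> vanishes on
  division by \<open>ln (ln N)\<close>, and the remaining slope is
  \<open>growth k * t\<close>.\<close>

theorem lcm_free_max_asymp:
  assumes k: "3 \<le> k"
  shows "(\<lambda>N. ln (lcm_free_max k N) / ln (ln (real N))) \<longlonglongrightarrow> growth k"
proof (rule order_tendstoI)
  have k2: "2 \<le> k" using k by simp
  have LL: "\<forall>\<^sub>F N in sequentially. 0 < ln (ln (real N))" by real_asymp
  {
    fix a assume "a < growth k"
    then obtain x where "x \<in> scores k" "a < x"
      unfolding growth_def using less_cSupD[of "scores k" a] zero_in_scores[OF k2] by blast
    then obtain I :: "nat set" and w F where I: "finite I" "\<forall>i\<in>I. 0 < w i" "F \<subseteq> Pow I" "free_antichain k F"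
        "1 \<le> fam_weight w F" "0 < sum w I" and x: "a < ln (fam_weight w F) / sum w I"
      unfolding scores_def by blast
    have "\<forall>\<^sub>F N in sequentially. a * ln (ln (real N)) < ln (lcm_free_max k N)"
      by (rule lcm_free_max_lower[of I F w k])
        (use I k x in \<open>auto simp: pos_less_divide_eq less_imp_le\<close>)
    then show "\<forall>\<^sub>F N in sequentially. a < ln (lcm_free_max k N) / ln (ln (real N))"
      using LL by eventually_elim (simp add: pos_less_divide_eq)
  next
    fix a assume a: "growth k < a"
    obtain t where t: "1 < t" "growth k * t < a"
    \<comment> \<open>The quotient \<open>a / growth k\<close> requires a nonzero denominator; if
      the supremum is 0, any \<open>t > 1\<close> will do.\<close>
    proof (cases "growth k = 0")
      case True
      then show ?thesis using that[of 2] a by simp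
    next
      case False
      then have g: "0 < growth k" using growth_nonneg[OF k2] by simp
      then have "1 < a / growth k" using a by simp
      then obtain t where "1 < t" "t < a / growth k" using dense by blast
      then show ?thesis using that[of t] g by (simp add: field_simps)
    qed
    let ?C = "t / (t - 1)"
    have "\<forall>\<^sub>F N in sequentially.
        (ln (2 * ?C) + growth k * t * prime_sum (real N)) / ln (ln (real N)) < a"
      using order_tendstoD(2)[OF prime_sum_linear_limit t(2)] .
    then show "\<forall>\<^sub>F N in sequentially. ln (lcm_free_max k N) / ln (ln (real N)) < a"
      using LL eventually_ge_at_top[of 1]
    proof eventually_elim
      case (elim N)
      have "ln (lcm_free_max k N) \<le> ln (2 * ?C) + growth k * t * prime_sum (real N)"
      proof (rule ln_lcm_free_max_le[OF k2])
        fix F assume F: "union_free k F" "F \<subseteq> Pow (primes_le (real N))"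
        show "fam_weight (\<lambda>p. 1 / real p) F \<le> ?C * exp (growth k * t * prime_sum (real N))"
          unfolding prime_sum_def using F t(1)
          by (intro union_free_weight_le[OF k2]) (auto simp: primes_le_def prime_gt_0_nat)
      qed (use t elim in auto)
      then have "ln (lcm_free_max k N) / ln (ln (real N))
          \<le> (ln (2 * ?C) + growth k * t * prime_sum (real N)) / ln (ln (real N))"
        using elim(2) by (intro divide_right_mono) auto
      then show ?case using elim(1) by linarith
    qed
  }
qed

corollary lcm_gamma_eq_growth: "3 \<le> k \<Longrightarrow> lcm_gamma k = growth k"
  unfolding lcm_gamma_def by (rule limI[OF lcm_free_max_asymp])

text \<open>Families over an arbitrary type need not be transported to \<open>nat\<close>:
  \<open>lcm_free_max_lower\<close> already holds for every ground type, so a larger weight would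
  contradict the limit just computed.\<close>

lemma fam_weight_le_gamma:
  fixes w :: "'a \<Rightarrow> real"
  assumes "finite I" "\<And>i. i \<in> I \<Longrightarrow> 0 \<le> w i" "F \<subseteq> Pow I" "free_antichain k F" "3 \<le> k"
  shows "fam_weight w F \<le> exp (lcm_gamma k * sum w I)"
proof (cases "1 \<le> fam_weight w F \<and> 0 < sum w I")
  case True
  show ?thesis
  proof (rule ccontr)
    assume "\<not> ?thesis"
    then have "exp (lcm_gamma k * sum w I) < exp (ln (fam_weight w F))" using True by simp
    then have "lcm_gamma k * sum w I < ln (fam_weight w F)" by (simp only: exp_less_cancel_iff)
    then have "lcm_gamma k < ln (fam_weight w F) / sum w I"
      using True by (simp add: pos_less_divide_eq)
    then obtain x where x: "lcm_gamma k < x" "x < ln (fam_weight w F) / sum w I"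
      using dense by blast
    have LL: "\<forall>\<^sub>F N in sequentially. 0 < ln (ln (real N))" by real_asymp
    have "\<forall>\<^sub>F N in sequentially. x * ln (ln (real N)) < ln (lcm_free_max k N)"
      by (rule lcm_free_max_lower[of I F w k])
        (use assms True x(2) in \<open>auto simp: pos_less_divide_eq\<close>)
    then have "\<forall>\<^sub>F N in sequentially. x \<le> ln (lcm_free_max k N) / ln (ln (real N))"
      using LL by eventually_elim (simp add: pos_le_divide_eq)
    then have "x \<le> growth k"
      by (rule tendsto_lowerbound[OF lcm_free_max_asymp[OF assms(5)]]) simp
    then show False using x(1) lcm_gamma_eq_growth[OF assms(5)] by simp
  qed
next
  case False
  have s: "0 \<le> sum w I" using assms(2) by (intro sum_nonneg)
  have "fam_weight w F \<le> exp (sum w I)" using assms by (intro fam_weight_le_exp)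
  then have "fam_weight w F \<le> 1" using False s by (cases "sum w I = 0") auto
  also have "1 \<le> exp (lcm_gamma k * sum w I)"
    using s growth_nonneg[of k] lcm_gamma_eq_growth[OF assms(5)] assms(5) by simp
  finally show ?thesis .
qed

section \<open>Bounds for the exponent from the sunflower constant and from uniform families\<close>

lemma ln_mu_le_gamma:
  assumes "3 \<le> k"
  shows "ln (sunflower_mu k) \<le> lcm_gamma k"
proof (rule LIMSEQ_le_const2[OF sunflower_mu_facts(1)[OF assms]], intro exI allI impI)
  fix n :: nat assume n: "1 \<le> n"
  obtain F where F: "F \<subseteq> Pow {1..n}" "free_antichain k F" "card F = free_antichain_max k n"
    using free_antichain_max_attained[of k n] assms by auto
  have "real (free_antichain_max k n) \<le> exp (lcm_gamma k * (\<Sum>i\<in>{1..n}. 1))"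
    unfolding F(3)[symmetric] card_eq_fam_weight by (rule fam_weight_le_gamma) (use F assms in auto)
  then have "ln (real (free_antichain_max k n)) \<le> ln (exp (lcm_gamma k * real n))"
    using free_antichain_max_pos[of k n] assms by (intro ln_mono) auto
  then show "ln (real (free_antichain_max k n)) / real n \<le> lcm_gamma k"
    using n by (simp add: pos_divide_le_eq)
qed

text \<open>By Bernoulli's inequality. It turns the factor \<open>n + 1\<close> of the counting
  bound into a geometric one, so that averaging over random subsets factorises over the
  points.\<close>

lemma geometric_absorbs_linear:
  fixes t :: real
  assumes "1 < t" "t \<le> 2"
  shows "real n + 1 \<le> t ^ n / (t - 1)"
proof -
  have "(real n + 1) * (t - 1) \<le> 1 + real n * (t - 1)" using assms by (simp add: algebra_simps)
  also have "\<dots> \<le> (1 + (t - 1)) ^ n" by (rule Bernoulli_inequality) (use assms in simp)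
  finally show ?thesis using assms by (simp add: pos_le_divide_eq)
qed

text \<open>A subset \<open>Z\<close> of \<open>I\<close> containing each \<open>i\<close> independently with probability \<open>w i\<close>
  contains \<open>X\<close> with probability \<open>\<Prod>i\<in>X. w i\<close>; the weight of \<open>F\<close> is the expected number
  of members inside \<open>Z\<close>, which is at most the extremal number for \<open>card Z\<close> points.\<close>

lemma union_free_weight_le_mu:
  assumes "3 \<le> k" "finite I" "\<And>i. i \<in> I \<Longrightarrow> 0 \<le> w i \<and> w i \<le> 1" "F \<subseteq> Pow I" "union_free k F"
    and t: "1 < t" "t \<le> 2"
  shows "fam_weight w F \<le> 1 / (t - 1) * exp ((t * sunflower_mu k - 1) * sum w I)"
proof -
  define P where "P Z = (\<Prod>i\<in>Z. w i) * (\<Prod>i\<in>I - Z. 1 - w i)" for Z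
  have P0: "0 \<le> P Z" if "Z \<subseteq> I" for Z
    unfolding P_def using assms(3) that by (intro mult_nonneg_nonneg prod_nonneg) auto
  have finF: "finite F" using assms(2,4) finite_subset by blast
  \<comment> \<open>The points outside \<open>X\<close> are free, and their factors add up to
    \<open>w i + (1 - w i) = 1\<close>.\<close>
  have up: "(\<Sum>Z\<in>{Z\<in>Pow I. X \<subseteq> Z}. P Z) = (\<Prod>i\<in>X. w i)" if X: "X \<subseteq> I" for X
  proof -
    have fX: "finite X" using X assms(2) finite_subset by blast
    have "(\<Sum>Z\<in>{Z\<in>Pow I. X \<subseteq> Z}. P Z)
        = (\<Sum>Y\<in>Pow (I - X). (\<Prod>i\<in>X. w i) * ((\<Prod>i\<in>Y. w i) * (\<Prod>i\<in>(I - X) - Y. 1 - w i)))"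
    proof (rule sum.reindex_bij_witness[of _ "\<lambda>Y. X \<union> Y" "\<lambda>Z. Z - X"])
      fix Z assume Z: "Z \<in> {Z\<in>Pow I. X \<subseteq> Z}"
      then have "finite Z" using assms(2) finite_subset by auto
      then have "(\<Prod>i\<in>Z. w i) = (\<Prod>i\<in>X. w i) * (\<Prod>i\<in>Z - X. w i)"
        using Z prod.subset_diff[of X Z w] by (simp add: mult.commute)
      moreover have "(I - X) - (Z - X) = I - Z" using Z by auto
      ultimately show "(\<Prod>i\<in>X. w i) * ((\<Prod>i\<in>Z - X. w i) * (\<Prod>i\<in>(I - X) - (Z - X). 1 - w i)) = P Z"
        by (simp add: P_def mult.assoc)
    qed (use X in auto)
    also have "\<dots> = (\<Prod>i\<in>X. w i) * (\<Prod>i\<in>I - X. w i + (1 - w i))"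
      using assms(2) by (subst prod_add) (auto simp: sum_distrib_left)
    finally show ?thesis by simp
  qed
  have "fam_weight w F = (\<Sum>X\<in>F. \<Sum>Z\<in>{Z\<in>Pow I. X \<subseteq> Z}. P Z)"
    unfolding fam_weight_def using up assms(4) by (intro sum.cong refl) auto
  also have "\<dots> = (\<Sum>Z\<in>Pow I. \<Sum>X\<in>{X\<in>F. X \<subseteq> Z}. P Z)"
    using assms(2) finF by (intro sum.swap_restrict) auto
  also have "\<dots> = (\<Sum>Z\<in>Pow I. real (card {X\<in>F. X \<subseteq> Z}) * P Z)" by simp
  also have "\<dots> \<le> (\<Sum>Z\<in>Pow I. (1 / (t - 1) * (t * sunflower_mu k) ^ card Z) * P Z)"
  proof (intro sum_mono mult_right_mono)
    fix Z assume Z: "Z \<in> Pow I"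
    then have fZ: "finite Z" using assms(2) finite_subset by auto
    have "card {X\<in>F. X \<subseteq> Z} \<le> sunflower_free_max k (card Z)"
      using union_free_subset[OF assms(5), of "{X\<in>F. X \<subseteq> Z}"] fZ assms(1)
      by (intro union_free_card_le) auto
    then have "real (card {X\<in>F. X \<subseteq> Z}) \<le> real (sunflower_free_max k (card Z))" by simp
    also have "\<dots> \<le> (real (card Z) + 1) * sunflower_mu k ^ card Z"
      by (rule sunflower_free_max_le_mu[OF assms(1)])
    also have "\<dots> \<le> (t ^ card Z / (t - 1)) * sunflower_mu k ^ card Z"
      using sunflower_mu_facts(3)[OF assms(1)] geometric_absorbs_linear[OF t]
      by (intro mult_right_mono) auto
    finally show "real (card {X\<in>F. X \<subseteq> Z}) \<le> 1 / (t - 1) * (t * sunflower_mu k) ^ card Z"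
      by (simp add: power_mult_distrib)
    show "0 \<le> P Z" using P0 Z by simp
  qed
  also have "\<dots> = 1 / (t - 1) * (\<Sum>Z\<in>Pow I. (\<Prod>i\<in>Z. t * sunflower_mu k * w i) * (\<Prod>i\<in>I - Z. 1 - w i))"
    unfolding sum_distrib_left P_def by (intro sum.cong refl) (simp add: prod.distrib)
  \<comment> \<open>By independence, a point contributes \<open>t * sunflower_mu k * w i\<close>
    inside \<open>Z\<close> and \<open>1 - w i\<close> outside.\<close>
  also have "\<dots> = 1 / (t - 1) * (\<Prod>i\<in>I. t * sunflower_mu k * w i + (1 - w i))"
    using assms(2) by (subst prod_add) auto
  also have "\<dots> \<le> 1 / (t - 1) * (\<Prod>i\<in>I. exp ((t * sunflower_mu k - 1) * w i))"
  proof (intro mult_left_mono prod_mono conjI)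
    fix i assume i: "i \<in> I"
    have "0 \<le> t * sunflower_mu k * w i"
      using t sunflower_mu_facts(3)[OF assms(1)] assms(3)[OF i] by simp
    then show "0 \<le> t * sunflower_mu k * w i + (1 - w i)" using assms(3)[OF i] by simp
    show "t * sunflower_mu k * w i + (1 - w i) \<le> exp ((t * sunflower_mu k - 1) * w i)"
      using exp_ge_add_one_self[of "(t * sunflower_mu k - 1) * w i"] by (simp add: algebra_simps)
  qed (use t in auto)
  also have "\<dots> = 1 / (t - 1) * exp ((t * sunflower_mu k - 1) * sum w I)"
    using assms(2) by (simp add: exp_sum[symmetric] sum_distrib_left)
  finally show ?thesis .
qed

text \<open>The factor \<open>1 / (t - 1)\<close> contributes only a constant to the logarithm. So
  \<open>t\<close> is fixed while \<open>N\<close> grows and tends to 1 only afterwards.\<close>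

lemma gamma_le_mu:
  assumes k: "3 \<le> k"
  shows "lcm_gamma k \<le> sunflower_mu k - 1"
proof -
  have k2: "2 \<le> k" using k by simp
  have bound: "lcm_gamma k \<le> t * sunflower_mu k - 1" if t: "1 < t" "t \<le> 2" for t
    unfolding lcm_gamma_eq_growth[OF k]
  proof (rule tendsto_le[OF _ prime_sum_linear_limit lcm_free_max_asymp[OF k]])
    let ?C = "1 / (t - 1)"
    have LL: "\<forall>\<^sub>F N in sequentially. 0 < ln (ln (real N))" by real_asymp
    then show "\<forall>\<^sub>F N in sequentially. ln (lcm_free_max k N) / ln (ln (real N))
        \<le> (ln (2 * ?C) + (t * sunflower_mu k - 1) * prime_sum (real N)) / ln (ln (real N))"
      using eventually_ge_at_top[of 1]
    proof eventually_elim
      case (elim N)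
      have "ln (lcm_free_max k N) \<le> ln (2 * ?C) + (t * sunflower_mu k - 1) * prime_sum (real N)"
      proof (rule ln_lcm_free_max_le[OF k2])
        fix F assume F: "union_free k F" "F \<subseteq> Pow (primes_le (real N))"
        have "1 / real p \<le> 1" if "p \<in> primes_le (real N)" for p
          using that prime_ge_1_nat[of p] by (simp add: primes_le_def)
        then show "fam_weight (\<lambda>p. 1 / real p) F \<le> ?C * exp ((t * sunflower_mu k - 1) * prime_sum (real N))"
          unfolding prime_sum_def using F t by (intro union_free_weight_le_mu[OF k]) auto
      qed (use t elim in auto)
      then show ?case using elim(1) by (intro divide_right_mono) auto
    qed
  qed simp
  show ?thesis
  proof (rule field_le_epsilon)
    fix e :: real assume e: "0 < e"
    \<comment> \<open>As \<open>sunflower_mu k \<le> 2\<close>, an excess of \<open>e / 2\<close> in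
      \<open>t\<close> costs at most \<open>e\<close>.\<close>
    define t where "t = 1 + min 1 (e / 2)"
    have "t * sunflower_mu k \<le> sunflower_mu k + e"
    proof -
      have "min 1 (e / 2) * sunflower_mu k \<le> (e / 2) * 2"
        using sunflower_mu_facts(3,4)[OF k] e by (intro mult_mono) auto
      then show ?thesis by (simp add: t_def algebra_simps)
    qed
    moreover have "1 < t" "t \<le> 2" using e by (auto simp: t_def)
    ultimately show "lcm_gamma k \<le> sunflower_mu k - 1 + e" using bound[of t] by simp
  qed
qed

text \<open>A member of a union-sunflower contains, for every other member, a point missed by that
  one, and these points are distinct.\<close>

lemma union_free_small_sets:
  assumes "\<And>X. X \<in> F \<Longrightarrow> finite X \<and> card X = r"
  shows "union_free (r + 2) F"
  unfolding union_free_def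
proof safe
  fix T U assume T: "T \<subseteq> F" "card T = r + 2" and pw: "pairwise (\<lambda>X Y. X \<union> Y = U) T"
  have other: "\<exists>Y\<in>T. Y \<noteq> X" for X
  proof -
    have "\<not> T \<subseteq> {X}" using card_mono[of "{X}" T] T(2) by auto
    then show ?thesis by blast
  qed
  have un: "X \<union> Y = U" if "X \<in> T" "Y \<in> T" "X \<noteq> Y" for X Y using pw that by (auto simp: pairwise_def)
  have "\<exists>d. d \<in> U - X" if X: "X \<in> T" for X
  proof (rule ccontr)
    assume "\<not> ?thesis"
    moreover obtain Y where Y: "Y \<in> T" "Y \<noteq> X" using other by blast
    ultimately have "Y \<subseteq> X" using un[OF X Y(1)] by blast
    then show False using card_subset_eq[of X Y] assms T(1) X Y by blast
  qed
  then obtain d where d: "\<And>X. X \<in> T \<Longrightarrow> d X \<in> U - X" by metis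
  have inj: "inj_on d T"
  proof (rule inj_onI)
    fix X Y assume "X \<in> T" "Y \<in> T" "d X = d Y"
    then show "X = Y" using un[of X Y] d[of X] d[of Y] by auto
  qed
  obtain X where X: "X \<in> T" using other by blast
  have "d ` (T - {X}) \<subseteq> X" using un[OF X] d by blast
  then have "card (d ` (T - {X})) \<le> card X" using assms T(1) X by (intro card_mono) auto
  also have "card (d ` (T - {X})) = card (T - {X})"
    using inj by (intro card_image) (auto simp: inj_on_def)
  also have "\<dots> = r + 1" using X T(2) by (simp add: card_Diff_singleton)
  finally show False using assms T(1) X by auto
qed

text \<open>Give each of \<open>n\<close> points the weight \<open>t / n\<close> and take all
  \<open>r\<close>-subsets: the mass is \<open>t\<close>, and the family weight tends to
  \<open>t^r / r!\<close> as \<open>n\<close> grows. At the chosen \<open>t\<close> this limit is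
  \<open>exp r\<close>, so the exponent is at least \<open>r / t\<close>.\<close>

lemma gamma_ge_uniform:
  assumes r: "1 \<le> r"
  shows "real r / (exp 1 * root r (fact r)) \<le> lcm_gamma (r + 2)"
proof -
  \<comment> \<open>the maximiser of \<open>ln (t ^ r / r!) / t\<close>\<close>
  define t where "t = exp 1 * root r (fact r)"
  have t: "0 < t" using r by (simp add: t_def)
  have tr: "t ^ r = exp 1 ^ r * fact r" using r by (simp add: t_def power_mult_distrib)
  have weight: "(\<Prod>i\<in>{0..<r}. 1 - real i / real n) * t ^ r / fact r \<le> exp (lcm_gamma (r + 2) * t)"
    if n: "1 \<le> n" for n
  proof -
    let ?F = "{X. X \<subseteq> {1..n} \<and> card X = r}"
    have F: "finite X \<and> card X = r" if "X \<in> ?F" for X using that finite_subset by auto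
    have "fam_weight (\<lambda>_. t / real n) ?F \<le> exp (lcm_gamma (r + 2) * (\<Sum>i\<in>{1..n}. t / real n))"
    proof (rule fam_weight_le_gamma)
      show "free_antichain (r + 2) ?F"
        using union_free_small_sets[OF F] antichain_uniform[OF F]
          unfolding free_antichain_def by blast
    qed (use t r in auto)
    moreover have "fam_weight (\<lambda>_. t / real n) ?F = real (n choose r) * (t / real n) ^ r"
      unfolding fam_weight_def by (simp add: n_subsets)
    moreover have "real (n choose r) * (t / real n) ^ r = (\<Prod>i\<in>{0..<r}. 1 - real i / real n) * t ^ r / fact r"
    proof -
      have "real (n choose r) = (\<Prod>i\<in>{0..<r}. real n - real i) / fact r"
        by (simp add: binomial_gbinomial gbinomial_prod_rev)
      also have "(\<Prod>i\<in>{0..<r}. real n - real i) = (\<Prod>i\<in>{0..<r}. real n * (1 - real i / real n))"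
        using n by (intro prod.cong refl) (simp add: field_simps)
      also have "\<dots> = real n ^ r * (\<Prod>i\<in>{0..<r}. 1 - real i / real n)" by (simp add: prod.distrib)
      finally show ?thesis using n by (simp add: power_divide field_simps)
    qed
    ultimately show ?thesis using n by simp
  qed
  have "(\<lambda>n. (\<Prod>i\<in>{0..<r}. 1 - real i / real n) * t ^ r / fact r) \<longlonglongrightarrow> (\<Prod>i\<in>{0..<r}. 1 - 0) * t ^ r / fact r"
    by (intro tendsto_intros tendsto_divide_0[OF tendsto_const] filterlim_real_sequentially
        filterlim_at_top_imp_at_infinity) auto
  then have "(\<Prod>i\<in>{0..<r}. 1 - 0) * t ^ r / fact r \<le> exp (lcm_gamma (r + 2) * t)"
    by (rule LIMSEQ_le_const2) (use weight in auto)
  then have "exp (real r) \<le> exp (lcm_gamma (r + 2) * t)"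
    by (simp add: tr exp_of_nat_mult[symmetric])
  then show ?thesis using t by (simp add: t_def[symmetric] pos_divide_le_eq)
qed

lemma lcm_gamma_mono: "mono_on {3..} lcm_gamma"
  by (rule mono_onI) (simp add: lcm_gamma_eq_growth growth_mono)

section \<open>The slice rank bound for three-petal sunflowers\<close>

text \<open>Gaussian elimination: one equation with a nonzero coefficient at \<open>p\<close>
  removes the unknown \<open>p\<close> from all the others.\<close>

lemma homogeneous_solution:
  fixes a :: "'e \<Rightarrow> 'v \<Rightarrow> real"
  assumes "finite E" "finite V" "card E < card V"
  shows "\<exists>x. (\<exists>v\<in>V. x v \<noteq> 0) \<and> (\<forall>e\<in>E. (\<Sum>v\<in>V. a e v * x v) = 0)"
  using assms
proof (induction E arbitrary: V a rule: finite_induct)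
  case empty
  then obtain v where "v \<in> V" by fastforce
  then show ?case by (intro exI[of _ "\<lambda>_. 1"]) auto
next
  case (insert e E)
  show ?case
  proof (cases "\<forall>v\<in>V. a e v = 0")
    case True
    then show ?thesis using insert.IH[of V a] insert.hyps insert.prems by auto
  next
    case False
    then obtain p where p: "p \<in> V" "a e p \<noteq> 0" by blast
    define V' where "V' = V - {p}"
    have V': "finite V'" "p \<notin> V'" "V = insert p V'" "card V = Suc (card V')"
      using p(1) insert.prems(1) card_Suc_Diff1[OF insert.prems(1) p(1)] by (auto simp: V'_def)
    obtain x where x: "\<exists>v\<in>V'. x v \<noteq> 0"
        "\<forall>d\<in>E. (\<Sum>v\<in>V'. (a d v - a d p * a e v / a e p) * x v) = 0"
      using insert.IH[of V' "\<lambda>d v. a d v - a d p * a e v / a e p"] V' insert.hyps insert.prems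
        by auto
    define z where "z = x(p := - (\<Sum>v\<in>V'. a e v * x v) / a e p)"
    have split: "(\<Sum>v\<in>V. a d v * z v) = a d p * z p + (\<Sum>v\<in>V'. a d v * x v)" for d
    proof -
      have "(\<Sum>v\<in>V'. a d v * z v) = (\<Sum>v\<in>V'. a d v * x v)"
        using V'(2) by (intro sum.cong) (auto simp: z_def)
      then show ?thesis unfolding V'(3) using V'(1,2) by simp
    qed
    have "(\<Sum>v\<in>V. a d v * z v) = 0" if d: "d \<in> insert e E" for d
    proof (cases "d = e")
      case True
      then show ?thesis unfolding split using p(2) by (simp add: z_def)
    next
      case False
      then have "(\<Sum>v\<in>V'. (a d v - a d p * a e v / a e p) * x v) = 0" using d x(2) by auto
      moreover have "(\<Sum>v\<in>V'. (a d v - a d p * a e v / a e p) * x v)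
          = (\<Sum>v\<in>V'. a d v * x v - a d p / a e p * (a e v * x v))"
        by (intro sum.cong refl) (simp add: algebra_simps)
      ultimately have "(\<Sum>v\<in>V'. a d v * x v) = a d p / a e p * (\<Sum>v\<in>V'. a e v * x v)"
        by (simp add: sum_subtractf sum_distrib_left)
      then show ?thesis unfolding split by (simp add: z_def)
    qed
    moreover have "\<exists>v\<in>V. z v \<noteq> 0" using x(1) V' by (auto simp: z_def)
    ultimately show ?thesis by blast
  qed
qed

text \<open>Take a solution of maximal support. If the support were too small, there would be a
  nonzero solution vanishing on it, since these further conditions still leave fewer equations than
  unknowns; adding it would enlarge the support.\<close>

lemma large_support_solution:
  fixes f :: "'i \<Rightarrow> 'v \<Rightarrow> real"
  assumes "finite A" "finite V"
  shows "\<exists>h. (\<forall>i\<in>A. (\<Sum>v\<in>V. f i v * h v) = 0) \<and> card V \<le> card {v\<in>V. h v \<noteq> 0} + card A"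
proof -
  define sol where "sol h \<longleftrightarrow> (\<forall>i\<in>A. (\<Sum>v\<in>V. f i v * h v) = 0)" for h
  have "\<exists>h. sol h \<and> (\<forall>h'. sol h' \<longrightarrow> card {v\<in>V. h' v \<noteq> 0} \<le> card {v\<in>V. h v \<noteq> 0})"
  proof (rule ex_has_greatest_nat)
    show "sol (\<lambda>_. 0)" by (simp add: sol_def)
    show "\<forall>h. sol h \<longrightarrow> card {v\<in>V. h v \<noteq> 0} < Suc (card V)"
      using assms(2) by (auto simp: less_Suc_eq_le intro: card_mono)
  qed
  then obtain h where h: "sol h" "\<And>h'. sol h' \<Longrightarrow> card {v\<in>V. h' v \<noteq> 0} \<le> card {v\<in>V. h v \<noteq> 0}"
    by blast
  let ?S = "{v\<in>V. h v \<noteq> 0}"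
  have "card V \<le> card ?S + card A"
  proof (rule ccontr)
    assume "\<not> ?thesis"
    then have "card (Inl ` A \<union> Inr ` ?S) < card V"
      using assms by (subst card_Un_disjoint) (auto simp: card_image)
    then have "\<exists>x. (\<exists>v\<in>V. x v \<noteq> 0) \<and> (\<forall>e\<in>Inl ` A \<union> Inr ` ?S.
        (\<Sum>v\<in>V. (case e of Inl i \<Rightarrow> f i v | Inr u \<Rightarrow> of_bool (u = v)) * x v) = 0)"
      by (intro homogeneous_solution) (use assms in auto)
    then obtain x where x: "\<exists>v\<in>V. x v \<noteq> 0"
      "\<And>e. e \<in> Inl ` A \<union> Inr ` ?S \<Longrightarrow> (\<Sum>v\<in>V. (case e of Inl i \<Rightarrow> f i v | Inr u \<Rightarrow> of_bool (u = v)) * x v) = 0"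
      by blast
    have x0: "x u = 0" if "u \<in> ?S" for u
    proof -
      have "(\<Sum>v\<in>V. of_bool (u = v) * x v) = 0" using x(2)[of "Inr u"] that by simp
      moreover have "(\<Sum>v\<in>V. of_bool (u = v) * x v) = (\<Sum>v\<in>V. if u = v then x v else 0)"
        by (intro sum.cong) auto
      ultimately show ?thesis using that assms(2) by (simp add: sum.delta)
    qed
    have "(\<Sum>v\<in>V. f i v * x v) = 0" if "i \<in> A" for i using x(2)[of "Inl i"] that by simp
    then have "sol (\<lambda>v. h v + x v)"
      using h(1) by (simp add: sol_def distrib_left sum.distrib)
    then have "card {v\<in>V. h v + x v \<noteq> 0} \<le> card ?S" by (rule h(2))
    moreover have "?S \<subset> {v\<in>V. h v + x v \<noteq> 0}"
    proof -
      obtain v where v: "v \<in> V" "x v \<noteq> 0" using x(1) by blast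
      then have "h v = 0" using x0[of v] by auto
      then show ?thesis using v x0 by auto
    qed
    then have "card ?S < card {v\<in>V. h v + x v \<noteq> 0}" using assms(2) by (intro psubset_card_mono) auto
    ultimately show False by simp
  qed
  then show ?thesis using h(1) unfolding sol_def by blast
qed

text \<open>Tao's slice rank bound for a diagonal tensor: contracting the third variable with a
  vector of large support that annihilates the third slices leaves a diagonal matrix of large
  rank.\<close>

lemma diagonal_slice_rank:
  fixes f :: "'i \<Rightarrow> 'v \<Rightarrow> real"
  assumes fin: "finite V" "finite A" "finite \<Phi>"
    and slices: "\<And>\<phi>. \<phi> \<in> \<Phi> \<Longrightarrow> p \<phi> \<in> A \<or> q \<phi> \<in> A \<or> r \<phi> \<in> A"
    and T: "\<And>x y z. T x y z = (\<Sum>\<phi>\<in>\<Phi>. s \<phi> * f (p \<phi>) x * f (q \<phi>) y * f (r \<phi>) z)"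
    and diag: "\<And>x y z. x \<in> V \<Longrightarrow> y \<in> V \<Longrightarrow> z \<in> V \<Longrightarrow> \<not> (x = y \<and> y = z) \<Longrightarrow> T x y z = 0"
    and nz: "\<And>x. x \<in> V \<Longrightarrow> T x x x \<noteq> 0"
  shows "card V \<le> 3 * card A"
proof (rule ccontr)
  assume big: "\<not> ?thesis"
  obtain h where h: "\<forall>i\<in>A. (\<Sum>v\<in>V. f i v * h v) = 0" "card V \<le> card {v\<in>V. h v \<noteq> 0} + card A"
    using large_support_solution[OF fin(2,1), of f] by blast
  define S where "S = {v\<in>V. h v \<noteq> 0}"
  have S: "finite S" "S \<subseteq> V" using fin(1) by (auto simp: S_def)
  \<comment> \<open>Summands with third index in \<open>A\<close> are killed by \<open>h\<close>,
    those with first index in \<open>A\<close> by the vector \<open>u\<close> chosen below. All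
    survivors have their second index in \<open>A\<close> and can be grouped by it.\<close>
  define \<Psi> where "\<Psi> = {\<phi>\<in>\<Phi>. p \<phi> \<notin> A \<and> r \<phi> \<notin> A}"
  define c where "c \<phi> = (\<Sum>z\<in>V. f (r \<phi>) z * h z)" for \<phi>
  define b where "b i x = (\<Sum>\<phi>\<in>{\<phi>\<in>\<Psi>. q \<phi> = i}. s \<phi> * c \<phi> * f (p \<phi>) x)" for i x
  \<comment> \<open>The support satisfies \<open>card S > 2 * card A\<close>: there is room for
    \<open>card A\<close> equations against the first slices and \<open>card A\<close> against the
    grouped second ones.\<close>
  have "card (Inl ` A \<union> Inr ` A) < card S"
    using big h(2) fin by (subst card_Un_disjoint) (auto simp: card_image S_def)
  then have "\<exists>u. (\<exists>v\<in>S. u v \<noteq> 0) \<and> (\<forall>e\<in>Inl ` A \<union> Inr ` A.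
      (\<Sum>x\<in>S. (case e of Inl i \<Rightarrow> f i x | Inr i \<Rightarrow> b i x) * u x) = 0)"
    by (intro homogeneous_solution) (use fin S in auto)
  then obtain u where u: "\<exists>v\<in>S. u v \<noteq> 0"
    "\<And>e. e \<in> Inl ` A \<union> Inr ` A \<Longrightarrow> (\<Sum>x\<in>S. (case e of Inl i \<Rightarrow> f i x | Inr i \<Rightarrow> b i x) * u x) = 0"
    by blast
  have u1: "(\<Sum>x\<in>S. f i x * u x) = 0" if "i \<in> A" for i using u(2)[of "Inl i"] that by simp
  have u2: "(\<Sum>x\<in>S. b i x * u x) = 0" if "i \<in> A" for i using u(2)[of "Inr i"] that by simp
  have zero: "(\<Sum>x\<in>S. \<Sum>z\<in>V. u x * h z * T x y z) = 0" for y
  proof -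
    define g where "g \<phi> = s \<phi> * (\<Sum>x\<in>S. f (p \<phi>) x * u x) * f (q \<phi>) y * c \<phi>" for \<phi>
    have "(\<Sum>x\<in>S. \<Sum>z\<in>V. u x * h z * T x y z)
        = (\<Sum>x\<in>S. \<Sum>z\<in>V. \<Sum>\<phi>\<in>\<Phi>. u x * h z * (s \<phi> * f (p \<phi>) x * f (q \<phi>) y * f (r \<phi>) z))"
      by (simp add: T sum_distrib_left)
    also have "\<dots> = (\<Sum>x\<in>S. \<Sum>\<phi>\<in>\<Phi>. \<Sum>z\<in>V. u x * h z * (s \<phi> * f (p \<phi>) x * f (q \<phi>) y * f (r \<phi>) z))"
      by (intro sum.cong refl sum.swap)
    also have "\<dots> = (\<Sum>\<phi>\<in>\<Phi>. \<Sum>x\<in>S. \<Sum>z\<in>V. u x * h z * (s \<phi> * f (p \<phi>) x * f (q \<phi>) y * f (r \<phi>) z))"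
      by (rule sum.swap)
    also have "\<dots> = (\<Sum>\<phi>\<in>\<Phi>. g \<phi>)"
      by (intro sum.cong refl) (simp add: g_def c_def sum_distrib_left sum_distrib_right mult_ac)
    also have "\<dots> = (\<Sum>\<phi>\<in>\<Psi>. g \<phi>)"
    proof (rule sum.mono_neutral_right[OF fin(3)])
      show "\<forall>\<phi>\<in>\<Phi> - \<Psi>. g \<phi> = 0"
        using u1 h(1) by (auto simp: \<Psi>_def g_def c_def)
    qed (auto simp: \<Psi>_def)
    also have "\<dots> = (\<Sum>i\<in>A. \<Sum>\<phi>\<in>{\<phi>\<in>\<Psi>. q \<phi> = i}. g \<phi>)"
      by (rule sum.group[symmetric]) (use fin slices in \<open>auto simp: \<Psi>_def\<close>)
    also have "\<dots> = (\<Sum>i\<in>A. f i y * (\<Sum>x\<in>S. b i x * u x))"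
    proof (intro sum.cong refl)
      fix i assume "i \<in> A"
      have "(\<Sum>x\<in>S. b i x * u x) = (\<Sum>x\<in>S. \<Sum>\<phi>\<in>{\<phi>\<in>\<Psi>. q \<phi> = i}. s \<phi> * c \<phi> * f (p \<phi>) x * u x)"
        by (simp add: b_def sum_distrib_right)
      also have "\<dots> = (\<Sum>\<phi>\<in>{\<phi>\<in>\<Psi>. q \<phi> = i}. \<Sum>x\<in>S. s \<phi> * c \<phi> * f (p \<phi>) x * u x)"
        by (rule sum.swap)
      finally show "(\<Sum>\<phi>\<in>{\<phi>\<in>\<Psi>. q \<phi> = i}. g \<phi>) = f i y * (\<Sum>x\<in>S. b i x * u x)"
        by (simp add: g_def sum_distrib_left sum_distrib_right mult_ac)
    qed
    also have "\<dots> = 0" using u2 by simp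
    finally show ?thesis .
  qed
  obtain y where y: "y \<in> S" "u y \<noteq> 0" using u(1) by blast
  have "(\<Sum>x\<in>S. \<Sum>z\<in>V. u x * h z * T x y z) = (\<Sum>x\<in>S. if x = y then u y * h y * T y y y else 0)"
  proof (intro sum.cong refl)
    fix x assume x: "x \<in> S"
    have "(\<Sum>z\<in>V. u x * h z * T x y z) = (\<Sum>z\<in>V. if z = y then (if x = y then u y * h y * T y y y else 0) else 0)"
      using diag x y S(2) by (intro sum.cong refl) auto
    then show "(\<Sum>z\<in>V. u x * h z * T x y z) = (if x = y then u y * h y * T y y y else 0)"
      using y(1) S(2) fin(1) by auto
  qed
  also have "\<dots> = u y * h y * T y y y" using y(1) S(1) by simp
  finally show False using zero[of y] y nz[of y] by (auto simp: S_def)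
qed

text \<open>Three distinct sets are excluded by union-freeness. If two coincide, the common union
  equals them and contains the third, so the antichain property applies.\<close>

lemma free_antichain_3_triple:
  assumes "free_antichain 3 F" "X \<in> F" "Y \<in> F" "Z \<in> F" "X \<union> Y = Y \<union> Z" "Y \<union> Z = X \<union> Z"
  shows "X = Y \<and> Y = Z"
proof -
  have ac: "A = B" if "A \<in> F" "B \<in> F" "A \<subseteq> B" for A B
    using antichainD assms(1) that unfolding free_antichain_def by blast
  have "X = Y \<or> Y = Z \<or> X = Z"
  proof (rule ccontr)
    assume ne: "\<not> ?thesis"
    show False
    proof (rule union_freeD[of 3 F "{X, Y, Z}" "X \<union> Y"])
      show "union_free 3 F" using assms(1) by (simp add: free_antichain_def)
      show "card {X, Y, Z} = 3" using ne by auto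
      show "pairwise (\<lambda>A B. A \<union> B = X \<union> Y) {X, Y, Z}"
        using assms(5,6) unfolding pairwise_def by blast
    qed (use assms in auto)
  qed
  then show ?thesis
    using assms(2-6) ac[of X Y] ac[of Y X] ac[of Z Y] ac[of Z X] ac[of Y Z] ac[of X Z] by blast
qed

lemma prod_of_bool_mem:
  "finite P \<Longrightarrow> (\<Prod>i\<in>P. of_bool (i \<in> x)) = (of_bool (P \<subseteq> x) :: real)"
  by (induction P rule: finite_induct) auto

text \<open>The value of \<open>\<phi>\<close> at \<open>i\<close> says which of the four summands
  is taken from the factor at \<open>i\<close>; 3 stands for the constant \<open>-1\<close>.\<close>

lemma sunflower_tensor_expand:
  assumes "finite I"
  shows "(\<Prod>i\<in>I. of_bool (i \<in> x) + of_bool (i \<in> y) + of_bool (i \<in> z) - (1 :: real))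
    = (\<Sum>\<phi>\<in>PiE I (\<lambda>_. {0, 1, 2, 3 :: nat}). (-1) ^ card {i\<in>I. \<phi> i = 3}
        * of_bool ({i\<in>I. \<phi> i = 0} \<subseteq> x) * of_bool ({i\<in>I. \<phi> i = 1} \<subseteq> y) * of_bool ({i\<in>I. \<phi> i = 2} \<subseteq> z))"
proof -
  define t :: "'a \<Rightarrow> nat \<Rightarrow> real" where
    "t i j = (if j = 0 then of_bool (i \<in> x) else if j = 1 then of_bool (i \<in> y)
       else if j = 2 then of_bool (i \<in> z) else - 1)" for i j
  have "(\<Prod>i\<in>I. of_bool (i \<in> x) + of_bool (i \<in> y) + of_bool (i \<in> z) - (1 :: real))
      = (\<Prod>i\<in>I. \<Sum>j\<in>{0, 1, 2, 3}. t i j)"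
    by (intro prod.cong refl) (simp add: t_def)
  also have "\<dots> = (\<Sum>\<phi>\<in>PiE I (\<lambda>_. {0, 1, 2, 3}). \<Prod>i\<in>I. t i (\<phi> i))"
    by (rule prod_sum_PiE) (use assms in auto)
  also have "\<dots> = (\<Sum>\<phi>\<in>PiE I (\<lambda>_. {0, 1, 2, 3 :: nat}). (-1) ^ card {i\<in>I. \<phi> i = 3}
        * of_bool ({i\<in>I. \<phi> i = 0} \<subseteq> x) * of_bool ({i\<in>I. \<phi> i = 1} \<subseteq> y) * of_bool ({i\<in>I. \<phi> i = 2} \<subseteq> z))"
  proof (rule sum.cong[OF refl])
    fix \<phi> assume \<phi>: "\<phi> \<in> PiE I (\<lambda>_. {0, 1, 2, 3 :: nat})"
    have "(\<Prod>i\<in>I. t i (\<phi> i)) = (\<Prod>j\<in>{0, 1, 2, 3}. \<Prod>i\<in>{i\<in>I. \<phi> i = j}. t i (\<phi> i))"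
    proof (rule prod.group[symmetric])
      show "\<phi> ` I \<subseteq> {0, 1, 2, 3}" using PiE_mem[OF \<phi>] by (rule image_subsetI)
    qed (use assms in auto)
    also have "\<dots> = (\<Prod>j\<in>{0, 1, 2, 3}. \<Prod>i\<in>{i\<in>I. \<phi> i = j}. t i j)"
      by (intro prod.cong refl) auto
    also have "\<dots> = (-1) ^ card {i\<in>I. \<phi> i = 3}
        * of_bool ({i\<in>I. \<phi> i = 0} \<subseteq> x) * of_bool ({i\<in>I. \<phi> i = 1} \<subseteq> y) * of_bool ({i\<in>I. \<phi> i = 2} \<subseteq> z)"
      using assms by (simp add: t_def prod_of_bool_mem)
    finally show "(\<Prod>i\<in>I. t i (\<phi> i)) = (-1) ^ card {i\<in>I. \<phi> i = 3}
        * of_bool ({i\<in>I. \<phi> i = 0} \<subseteq> x) * of_bool ({i\<in>I. \<phi> i = 1} \<subseteq> y) * of_bool ({i\<in>I. \<phi> i = 2} \<subseteq> z)" .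
  qed
  finally show ?thesis .
qed

text \<open>The factor at \<open>i\<close> vanishes exactly when \<open>i\<close> lies in one and
  only one of \<open>x\<close>, \<open>y\<close>, \<open>z\<close>. If no factor vanishes, the
  pairwise unions agree, so the tensor is diagonal on \<open>F\<close>; on the diagonal the factors
  are 2 or -1. In each summand of the expansion one of the three disjoint index sets has at most a
  third of the points.\<close>

lemma free_antichain_3_card_le:
  assumes F: "F \<subseteq> Pow I" "finite I" "free_antichain 3 F"
  shows "card F \<le> 3 * card {S. S \<subseteq> I \<and> 3 * card S \<le> card I}"
proof -
  let ?A = "{S. S \<subseteq> I \<and> 3 * card S \<le> card I}"
  let ?\<Phi> = "PiE I (\<lambda>_. {0, 1, 2, 3 :: nat})"
  let ?c = "\<lambda>j \<phi>. {i\<in>I. \<phi> i = (j :: nat)}"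
  define T where "T x y z = (\<Prod>i\<in>I. of_bool (i \<in> x) + of_bool (i \<in> y) + of_bool (i \<in> z) - (1 :: real))" for x y z
  show ?thesis
  proof (rule diagonal_slice_rank[of F ?A ?\<Phi> "?c 0" "?c 1" "?c 2" T "\<lambda>\<phi>. (-1) ^ card (?c 3 \<phi>)" "\<lambda>P x. of_bool (P \<subseteq> x)"])
    show "finite F" using F finite_subset by blast
    show "finite ?A" using F(2) by simp
    show "finite ?\<Phi>" using F(2) by (intro finite_PiE) auto
    show "?c 0 \<phi> \<in> ?A \<or> ?c 1 \<phi> \<in> ?A \<or> ?c 2 \<phi> \<in> ?A" for \<phi>
    proof -
      have "card (?c 0 \<phi> \<union> (?c 1 \<phi> \<union> ?c 2 \<phi>)) \<le> card I" using F(2) by (intro card_mono) auto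
      moreover have "card (?c 0 \<phi> \<union> (?c 1 \<phi> \<union> ?c 2 \<phi>)) = card (?c 0 \<phi>) + card (?c 1 \<phi> \<union> ?c 2 \<phi>)"
        using F(2) by (intro card_Un_disjoint) auto
      moreover have "card (?c 1 \<phi> \<union> ?c 2 \<phi>) = card (?c 1 \<phi>) + card (?c 2 \<phi>)"
        using F(2) by (intro card_Un_disjoint) auto
      ultimately have "3 * card (?c 0 \<phi>) \<le> card I \<or> 3 * card (?c 1 \<phi>) \<le> card I \<or> 3 * card (?c 2 \<phi>) \<le> card I"
        by linarith
      then show ?thesis by blast
    qed
    show "T x y z = (\<Sum>\<phi>\<in>?\<Phi>. (-1) ^ card (?c 3 \<phi>) * of_bool (?c 0 \<phi> \<subseteq> x) * of_bool (?c 1 \<phi> \<subseteq> y) * of_bool (?c 2 \<phi> \<subseteq> z))" for x y z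
      unfolding T_def by (rule sunflower_tensor_expand[OF F(2)])
    show "T x x x \<noteq> 0" for x
      unfolding T_def using F(2) by (auto simp: of_bool_def)
    fix x y z assume xyz: "x \<in> F" "y \<in> F" "z \<in> F" "\<not> (x = y \<and> y = z)"
    have "\<exists>i\<in>I. of_bool (i \<in> x) + of_bool (i \<in> y) + of_bool (i \<in> z) - (1 :: real) = 0"
    proof (rule ccontr)
      assume "\<not> ?thesis"
      then have *: "of_bool (i \<in> x) + of_bool (i \<in> y) + of_bool (i \<in> z) \<noteq> (1 :: real)" if "i \<in> I" for i
        using that by force
      have "i \<in> x \<union> y \<longleftrightarrow> i \<in> y \<union> z" "i \<in> y \<union> z \<longleftrightarrow> i \<in> x \<union> z" if "i \<in> I" for i
        using *[OF that] by (auto simp: of_bool_def split: if_splits)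
      moreover have "x \<subseteq> I" "y \<subseteq> I" "z \<subseteq> I" using xyz F(1) by auto
      ultimately have "x \<union> y = y \<union> z" "y \<union> z = x \<union> z" by blast+
      then show False using free_antichain_3_triple[OF F(3) xyz(1-3)] xyz(4) by blast
    qed
    then show "T x y z = 0" unfolding T_def using F(2) by (simp add: prod_zero_iff)
  qed
qed

text \<open>A Chernoff bound: every counted \<open>S\<close> has
  \<open>2 powr (n / 3 - card S) \<ge> 1\<close>. The parameter \<open>1 / 2\<close> is the odds at
  density one third, and each point contributes the factor
  \<open>2 powr (1 / 3) * (3 / 2)\<close>.\<close>

lemma card_small_subsets_le:
  assumes "finite I"
  shows "real (card {S. S \<subseteq> I \<and> 3 * card S \<le> card I}) \<le> (3 / 2 powr (2 / 3)) ^ card I"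
proof -
  let ?n = "card I" and ?A = "{S. S \<subseteq> I \<and> 3 * card S \<le> card I}"
  have "real (card ?A) = (\<Sum>S\<in>?A. 1)" by simp
  also have "\<dots> \<le> (\<Sum>S\<in>?A. 2 powr (real ?n / 3) * (1 / 2) ^ card S)"
  proof (rule sum_mono)
    fix S assume "S \<in> ?A"
    then have "real (card S) \<le> real ?n / 3" by simp
    then have "2 powr (real (card S)) \<le> 2 powr (real ?n / 3)" by (intro powr_mono) auto
    then show "1 \<le> 2 powr (real ?n / 3) * (1 / 2) ^ card S"
      by (simp add: powr_realpow field_simps)
  qed
  also have "\<dots> \<le> (\<Sum>S\<in>Pow I. 2 powr (real ?n / 3) * (1 / 2) ^ card S)"
    using assms by (intro sum_mono2) auto
  also have "\<dots> = 2 powr (real ?n / 3) * fam_weight (\<lambda>_. 1 / 2) (Pow I)"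
    by (simp add: fam_weight_def sum_distrib_left)
  also have "\<dots> = 2 powr (real ?n / 3) * (3 / 2) ^ ?n"
    unfolding fam_weight_Pow[OF assms] by simp
  also have "2 powr (real ?n / 3) = (2 powr (1 / 3)) ^ ?n"
    by (simp add: powr_power)
  also have "(2 powr (1 / 3)) ^ ?n * (3 / 2) ^ ?n = (3 / 2 powr (2 / 3) :: real) ^ ?n"
  proof -
    have "2 powr (1 / 3) * 2 powr (2 / 3) = (2 :: real)" by (simp add: powr_add[symmetric])
    then have "2 powr (1 / 3) * (3 / 2) = (3 / 2 powr (2 / 3) :: real)" by (simp add: field_simps)
    then show ?thesis by (simp only: power_mult_distrib[symmetric])
  qed
  finally show ?thesis .
qed

lemma sunflower_mu_3_le: "sunflower_mu 3 \<le> 3 / 2 powr (2 / 3)"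
proof -
  let ?c = "3 / 2 powr (2 / 3) :: real"
  have c: "0 < ?c" by simp
  have bound: "ln (real (free_antichain_max 3 n)) / real n \<le> ln 3 / real n + ln ?c" if n: "1 \<le> n" for n
  proof -
    obtain F where F: "F \<subseteq> Pow {1..n}" "free_antichain 3 F" "card F = free_antichain_max 3 n"
      using free_antichain_max_attained[of 3 n] by auto
    have "real (card F) \<le> real (3 * card {S. S \<subseteq> {1..n} \<and> 3 * card S \<le> card {1..n}})"
      using free_antichain_3_card_le[OF F(1) _ F(2)] by (simp only: of_nat_le_iff) simp
    also have "\<dots> \<le> 3 * ?c ^ n"
      using card_small_subsets_le[of "{1..n}"] by simp
    finally have "ln (real (free_antichain_max 3 n)) \<le> ln (3 * ?c ^ n)"
      using F(3) free_antichain_max_pos[of 3 n] by (intro ln_mono) auto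
    also have "\<dots> = ln 3 + ln (?c ^ n)" using c by (intro ln_mult_pos zero_less_power) auto
    also have "\<dots> = ln 3 + real n * ln ?c" by (subst ln_realpow) (rule refl)
    finally have "ln (real (free_antichain_max 3 n)) / real n \<le> (ln 3 + real n * ln ?c) / real n"
      by (rule divide_right_mono) simp
    also have "\<dots> = ln 3 / real n + ln ?c" using n by (simp only: add_divide_distrib) simp
    finally show ?thesis .
  qed
  have lim: "(\<lambda>n. ln 3 / real n + ln ?c) \<longlonglongrightarrow> 0 + ln ?c"
    by (intro tendsto_add tendsto_const) real_asymp
  have "ln (sunflower_mu 3) \<le> 0 + ln ?c"
    by (rule LIMSEQ_le[OF sunflower_mu_facts(1)[OF order.refl] lim]) (use bound in auto)
  then show ?thesis
    using sunflower_mu_facts(3)[of 3] c by (subst (asm) add_0, subst (asm) ln_le_cancel_iff) auto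
qed

section \<open>A recursive construction without three-petal sunflowers\<close>

definition same_unions :: "'a set \<Rightarrow> 'a set \<Rightarrow> 'a set \<Rightarrow> bool" where
  "same_unions X Y Z \<longleftrightarrow> X \<union> Y = Y \<union> Z \<and> Y \<union> Z = X \<union> Z"

text \<open>Repetitions are allowed on purpose: for \<open>X \<subseteq> Y\<close> the triple
  \<open>Y\<close>, \<open>Y\<close>, \<open>X\<close> has equal unions, so the antichain property
  is built in.\<close>

definition triple_free :: "'a set set \<Rightarrow> bool" where
  "triple_free F \<longleftrightarrow> (\<forall>X\<in>F. \<forall>Y\<in>F. \<forall>Z\<in>F. same_unions X Y Z \<longrightarrow> X = Y \<and> Y = Z)"

text \<open>In a compatible pair, the only non-constant triples with equal pairwise unions have
  two members in \<open>G\<close> and one in \<open>H\<close>, just as for \<open>G = {{x}}\<close>, \<open>H = {{}}\<close>.\<close>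

definition compatible :: "'a set set \<Rightarrow> 'a set set \<Rightarrow> bool" where
  "compatible G H \<longleftrightarrow> triple_free G \<and> triple_free H
     \<and> (\<forall>X\<in>H. \<forall>Y\<in>H. \<forall>Z\<in>G. \<not> same_unions X Y Z)"

lemma same_unions_perm:
  "same_unions X Y Z \<Longrightarrow> same_unions Y Z X" "same_unions X Y Z \<Longrightarrow> same_unions X Z Y"
  unfolding same_unions_def by blast+

lemma triple_free_imp_free_antichain:
  assumes "triple_free F"
  shows "free_antichain 3 F"
  unfolding free_antichain_def
proof
  show "union_free 3 F"
    unfolding union_free_def
  proof safe
    fix T U assume T: "T \<subseteq> F" "card T = 3" "pairwise (\<lambda>X Y. X \<union> Y = U) T"
    then obtain X Y Z where XYZ: "T = {X, Y, Z}" "X \<noteq> Y" "X \<noteq> Z" "Y \<noteq> Z"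
      by (auto simp: card_3_iff)
    then have su: "same_unions X Y Z" using T(3) by (auto simp: same_unions_def pairwise_def)
    have "X \<in> F" "Y \<in> F" "Z \<in> F" using T(1) XYZ(1) by auto
    then show False using assms su XYZ(2) unfolding triple_free_def by blast
  qed
  show "antichain F"
    unfolding antichain_def
  proof (intro ballI impI)
    fix X Y assume "X \<in> F" "Y \<in> F" "X \<subseteq> Y"
    moreover from this have "same_unions Y Y X" by (auto simp: same_unions_def)
    ultimately show "X = Y" using assms unfolding triple_free_def by blast
  qed
qed

definition slice :: "('j \<times> 'a) set \<Rightarrow> 'j \<Rightarrow> 'a set" where
  "slice X j = {a. (j, a) \<in> X}"

text \<open>Substitution into a code: position \<open>j\<close> of a code word \<open>S\<close> is
  filled with a member of \<open>G j\<close> if \<open>j\<close> is in \<open>S\<close> and with a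
  member of \<open>H j\<close> if not.\<close>

definition compose :: "'j set \<Rightarrow> ('j \<Rightarrow> 'a set) \<Rightarrow> ('j \<Rightarrow> 'a set set) \<Rightarrow> ('j \<Rightarrow> 'a set set)
    \<Rightarrow> 'j set set \<Rightarrow> ('j \<times> 'a) set set" where
  "compose J I G H C = {X. X \<subseteq> Sigma J I \<and>
     (\<exists>S\<in>C. \<forall>j\<in>J. slice X j \<in> (if j \<in> S then G j else H j))}"

lemma same_unions_slice: "same_unions X Y Z \<Longrightarrow> same_unions (slice X j) (slice Y j) (slice Z j)"
  unfolding same_unions_def slice_def by (intro conjI set_eqI iffI) auto

text \<open>Compatibility excludes slices of types \<open>H\<close>, \<open>H\<close>,
  \<open>G\<close> in any order, so no position belongs to exactly one of the three code words; that
  is equality of their pairwise unions.\<close>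

lemma same_unions_codes:
  assumes comp: "\<And>j. j \<in> J \<Longrightarrow> compatible (G j) (H j)"
    and S: "S1 \<subseteq> J" "S2 \<subseteq> J" "S3 \<subseteq> J"
    and X: "\<And>j. j \<in> J \<Longrightarrow> slice X j \<in> (if j \<in> S1 then G j else H j)"
    and Y: "\<And>j. j \<in> J \<Longrightarrow> slice Y j \<in> (if j \<in> S2 then G j else H j)"
    and Z: "\<And>j. j \<in> J \<Longrightarrow> slice Z j \<in> (if j \<in> S3 then G j else H j)"
    and XYZ: "same_unions X Y Z"
  shows "same_unions S1 S2 S3"
proof -
  have no: "\<not> same_unions A B C" "\<not> same_unions A C B" "\<not> same_unions C A B"
    if "j \<in> J" "A \<in> H j" "B \<in> H j" "C \<in> G j" for j A B C
    using comp[OF that(1)] that same_unions_perm unfolding compatible_def by metis+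
  have "\<not> (j \<in> S1 \<and> j \<notin> S2 \<and> j \<notin> S3)" "\<not> (j \<notin> S1 \<and> j \<in> S2 \<and> j \<notin> S3)"
    "\<not> (j \<notin> S1 \<and> j \<notin> S2 \<and> j \<in> S3)" if j: "j \<in> J" for j
    using no[OF j] X[OF j] Y[OF j] Z[OF j] same_unions_slice[OF XYZ, of j]
      by (auto split: if_splits)
  then show ?thesis using S unfolding same_unions_def by blast
qed

lemma slice_ext:
  assumes "X \<subseteq> Sigma J I" "Y \<subseteq> Sigma J I" "\<And>j. j \<in> J \<Longrightarrow> slice X j = slice Y j"
  shows "X = Y"
  using assms unfolding slice_def by (auto; blast)

lemma triple_free_compose:
  assumes comp: "\<And>j. j \<in> J \<Longrightarrow> compatible (G j) (H j)" and C: "triple_free C" "C \<subseteq> Pow J"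
  shows "triple_free (compose J I G H C)"
  unfolding triple_free_def
proof (intro ballI impI)
  fix X Y Z
  assume XYZ: "X \<in> compose J I G H C" "Y \<in> compose J I G H C" "Z \<in> compose J I G H C"
    and su: "same_unions X Y Z"
  obtain S1 where S1: "S1 \<in> C" "\<And>j. j \<in> J \<Longrightarrow> slice X j \<in> (if j \<in> S1 then G j else H j)"
    using XYZ(1) unfolding compose_def by blast
  obtain S2 where S2: "S2 \<in> C" "\<And>j. j \<in> J \<Longrightarrow> slice Y j \<in> (if j \<in> S2 then G j else H j)"
    using XYZ(2) unfolding compose_def by blast
  obtain S3 where S3: "S3 \<in> C" "\<And>j. j \<in> J \<Longrightarrow> slice Z j \<in> (if j \<in> S3 then G j else H j)"
    using XYZ(3) unfolding compose_def by blast
  have "same_unions S1 S2 S3"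
    by (rule same_unions_codes[where J=J and G=G and H=H]) (use comp S1 S2 S3 C(2) su in auto)
  then have eq: "S1 = S2" "S2 = S3" using C(1) S1(1) S2(1) S3(1) unfolding triple_free_def by blast+
  have "slice X j = slice Y j \<and> slice Y j = slice Z j" if j: "j \<in> J" for j
  proof -
    have "triple_free (if j \<in> S3 then G j else H j)"
      using comp[OF j] by (simp add: compatible_def)
    then show ?thesis
      using S1(2)[OF j] S2(2)[OF j] S3(2)[OF j] same_unions_slice[OF su, of j]
      unfolding eq triple_free_def by blast
  qed
  moreover have "X \<subseteq> Sigma J I" "Y \<subseteq> Sigma J I" "Z \<subseteq> Sigma J I"
    using XYZ by (simp_all add: compose_def)
  ultimately show "X = Y \<and> Y = Z" using slice_ext[of _ J I] by metis
qed

text \<open>The same type argument reduces to the outer codes. The composed pair is again compatible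
  and can replace single points in the next round.\<close>

lemma compatible_compose:
  assumes comp: "\<And>j. j \<in> J \<Longrightarrow> compatible (G j) (H j)"
    and C: "compatible C D" "C \<subseteq> Pow J" "D \<subseteq> Pow J"
  shows "compatible (compose J I G H C) (compose J I G H D)"
  unfolding compatible_def
proof (intro conjI ballI notI)
  show "triple_free (compose J I G H C)" "triple_free (compose J I G H D)"
    by (rule triple_free_compose[OF comp]; use C in \<open>simp add: compatible_def\<close>)+
  fix X Y Z
  assume XYZ: "X \<in> compose J I G H D" "Y \<in> compose J I G H D" "Z \<in> compose J I G H C"
    and su: "same_unions X Y Z"
  obtain S1 where S1: "S1 \<in> D" "\<And>j. j \<in> J \<Longrightarrow> slice X j \<in> (if j \<in> S1 then G j else H j)"
    using XYZ(1) unfolding compose_def by blast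
  obtain S2 where S2: "S2 \<in> D" "\<And>j. j \<in> J \<Longrightarrow> slice Y j \<in> (if j \<in> S2 then G j else H j)"
    using XYZ(2) unfolding compose_def by blast
  obtain S3 where S3: "S3 \<in> C" "\<And>j. j \<in> J \<Longrightarrow> slice Z j \<in> (if j \<in> S3 then G j else H j)"
    using XYZ(3) unfolding compose_def by blast
  have "same_unions S1 S2 S3"
    by (rule same_unions_codes[where J=J and G=G and H=H]) (use comp S1 S2 S3 C(2,3) su in auto)
  then show False using C(1) S1(1) S2(1) S3(1) unfolding compatible_def by blast
qed

lemma slice_Sigma: "j \<in> J \<Longrightarrow> slice (Sigma J \<phi>) j = \<phi> j"
  by (auto simp: slice_def)

text \<open>Disjointness of \<open>G j\<close> and \<open>H j\<close> lets a composed set determine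
  its code word, so nothing is counted twice; for a fixed word the slices vary
  independently.\<close>

lemma fam_weight_compose:
  assumes "finite J" "\<And>j. j \<in> J \<Longrightarrow> finite (I j)"
    and GH: "\<And>j. j \<in> J \<Longrightarrow> G j \<subseteq> Pow (I j)" "\<And>j. j \<in> J \<Longrightarrow> H j \<subseteq> Pow (I j)"
      "\<And>j. j \<in> J \<Longrightarrow> G j \<inter> H j = {}"
    and C: "C \<subseteq> Pow J"
  shows "fam_weight (\<lambda>(j, a). w j a) (compose J I G H C)
    = (\<Sum>S\<in>C. \<Prod>j\<in>J. if j \<in> S then fam_weight (w j) (G j) else fam_weight (w j) (H j))"
proof -
  define K where "K S j = (if j \<in> S then G j else H j)" for S j
  define L where "L S = {X. X \<subseteq> Sigma J I \<and> (\<forall>j\<in>J. slice X j \<in> K S j)}" for S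
  have KI: "K S j \<subseteq> Pow (I j)" if "j \<in> J" for S j using GH(1,2)[OF that] by (simp add: K_def)
  have finK: "finite (K S j)" if "j \<in> J" for S j
    using KI[OF that] assms(2)[OF that] finite_subset by blast
  have finC: "finite C" using C assms(1) finite_subset by blast
  have finL: "finite (L S)" for S
    by (rule finite_subset[of _ "Pow (Sigma J I)"]) (use assms in \<open>auto simp: L_def\<close>)
  have dis: "L S \<inter> L S' = {}" if S: "S \<in> C" "S' \<in> C" "S \<noteq> S'" for S S'
  proof (rule ccontr)
    assume "L S \<inter> L S' \<noteq> {}"
    then obtain X where X: "X \<in> L S" "X \<in> L S'" by blast
    obtain j where "j \<in> J" "(j \<in> S) \<noteq> (j \<in> S')" using S C by blast
    then show False using X GH(3)[of j] by (auto simp: L_def K_def split: if_splits)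
  qed
  have "fam_weight (\<lambda>(j, a). w j a) (compose J I G H C) = (\<Sum>S\<in>C. \<Sum>X\<in>L S. \<Prod>(j, a)\<in>X. w j a)"
  proof -
    have "compose J I G H C = (\<Union>S\<in>C. L S)" by (auto simp: compose_def L_def K_def)
    then show ?thesis
      unfolding fam_weight_def using finC finL dis by (simp add: sum.UNION_disjoint)
  qed
  also have "\<dots> = (\<Sum>S\<in>C. \<Prod>j\<in>J. fam_weight (w j) (K S j))"
  proof (intro sum.cong refl)
    fix S assume "S \<in> C"
    have "(\<Prod>j\<in>J. fam_weight (w j) (K S j)) = (\<Sum>\<phi>\<in>PiE J (K S). \<Prod>j\<in>J. \<Prod>a\<in>\<phi> j. w j a)"
      unfolding fam_weight_def by (rule prod_sum_PiE) (use assms(1) finK in auto)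
    also have "\<dots> = (\<Sum>X\<in>L S. \<Prod>(j, a)\<in>X. w j a)"
    proof (rule sum.reindex_bij_witness[of _ "\<lambda>X. \<lambda>j\<in>J. slice X j" "Sigma J"])
      fix \<phi> assume \<phi>: "\<phi> \<in> PiE J (K S)"
      have mem: "\<phi> j \<in> K S j" if "j \<in> J" for j using PiE_mem[OF \<phi> that] .
      show "(\<lambda>j\<in>J. slice (Sigma J \<phi>) j) = \<phi>"
        using \<phi> by (intro ext) (auto simp: slice_Sigma PiE_def extensional_def)
      show "Sigma J \<phi> \<in> L S"
      proof -
        have "\<phi> j \<subseteq> I j" if "j \<in> J" for j using mem[OF that] KI[OF that, of S] by blast
        then show ?thesis using mem by (auto simp: L_def slice_Sigma)
      qed
      have "finite (\<phi> j)" if "j \<in> J" for j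
        using mem[OF that] KI[OF that, of S] assms(2)[OF that] finite_subset by blast
      then show "(\<Prod>(j, a)\<in>Sigma J \<phi>. w j a) = (\<Prod>j\<in>J. \<Prod>a\<in>\<phi> j. w j a)"
        using assms(1) by (subst prod.Sigma) auto
    next
      fix X assume X: "X \<in> L S"
      show "(\<lambda>j\<in>J. slice X j) \<in> PiE J (K S)" using X by (auto simp: L_def)
      show "Sigma J (\<lambda>j\<in>J. slice X j) = X" using X by (auto simp: L_def slice_def)
    qed
    finally show "(\<Sum>X\<in>L S. \<Prod>(j, a)\<in>X. w j a) = (\<Prod>j\<in>J. fam_weight (w j) (K S j))" ..
  qed
  also have "\<dots> = (\<Sum>S\<in>C. \<Prod>j\<in>J. if j \<in> S then fam_weight (w j) (G j) else fam_weight (w j) (H j))"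
    by (intro sum.cong prod.cong refl) (simp add: K_def)
  finally show ?thesis .
qed

section \<open>Explicit codes on seven points\<close>

definition positions :: "bool list \<Rightarrow> nat set" where
  "positions u = {j. j < length u \<and> u ! j}"

text \<open>An evaluable form of \<open>same_unions\<close> on characteristic lists of equal length;
  the last equation ends the recursion.\<close>

fun same_unions_code :: "bool list \<Rightarrow> bool list \<Rightarrow> bool list \<Rightarrow> bool" where
  "same_unions_code (a # x) (b # y) (c # z) \<longleftrightarrow>
     (a \<or> b) = (b \<or> c) \<and> (b \<or> c) = (a \<or> c) \<and> same_unions_code x y z"
| "same_unions_code _ _ _ \<longleftrightarrow> True"

lemma same_unions_code:
  assumes "length x = length y" "length y = length z" "same_unions (positions x) (positions y) (positions z)"
  shows "same_unions_code x y z"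
  using assms
proof (induction x y z rule: list_induct3)
  case (Cons a x b y c z)
  have step: "(0 \<in> positions (d # v)) = d" "(Suc j \<in> positions (d # v)) = (j \<in> positions v)" for d v j
    by (auto simp: positions_def)
  have iff: "(j \<in> positions (a # x) \<or> j \<in> positions (b # y)) = (j \<in> positions (b # y) \<or> j \<in> positions (c # z))"
    "(j \<in> positions (b # y) \<or> j \<in> positions (c # z)) = (j \<in> positions (a # x) \<or> j \<in> positions (c # z))" for j
    using Cons.prems unfolding same_unions_def by (metis UnCI UnE)+
  have "same_unions (positions x) (positions y) (positions z)"
    unfolding same_unions_def
    by (intro conjI set_eqI) (use iff[of "Suc _"] in \<open>simp_all only: step Un_iff\<close>)
  then show ?case using Cons.IH iff[of 0] by (simp only: step same_unions_code.simps simp_thms)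
qed simp

lemma inj_positions: "length u = length v \<Longrightarrow> positions u = positions v \<Longrightarrow> u = v"
  by (rule nth_equalityI) (auto simp: positions_def set_eq_iff)

text \<open>The design \<open>D\<close> consists of the ten blocks of a 2-(6,3,2) design on the points
  \<open>0..5\<close>: any four points span exactly two of them. The code \<open>G\<close> consists of the other ten
  triples, each with the point \<open>6\<close> added, and \<open>{0..5}\<close>; the code \<open>H\<close> consists of \<open>D\<close> and
  the pairs \<open>{i, 6}\<close>.\<close>

definition code_G :: "bool list list" where
  "code_G = (let t = True; f = False in
   [[t,t,t,f,f,f,t], [t,t,f,f,t,f,t], [t,f,t,t,f,f,t], [t,f,f,t,f,t,t],
    [t,f,f,f,t,t,t], [f,t,t,f,f,t,t], [f,t,f,t,t,f,t], [f,t,f,t,f,t,t],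
    [f,f,t,t,t,f,t], [f,f,t,f,t,t,t], [t,t,t,t,t,t,f]])"

definition code_H :: "bool list list" where
  "code_H = (let t = True; f = False in
   [[t,f,f,f,f,f,t], [f,t,f,f,f,f,t], [f,f,t,f,f,f,t], [f,f,f,t,f,f,t],
    [f,f,f,f,t,f,t], [f,f,f,f,f,t,t], [t,t,f,t,f,f,f], [f,t,t,t,f,f,f],
    [t,f,t,f,t,f,f], [f,t,t,f,t,f,f], [t,f,f,t,t,f,f], [t,t,f,f,f,t,f],
    [t,f,t,f,f,t,f], [f,f,t,t,f,t,f], [f,t,f,f,t,t,f], [f,f,f,t,t,t,f]])"

lemma code_checks:
  "\<forall>x\<in>set code_G. \<forall>y\<in>set code_G. \<forall>z\<in>set code_G. same_unions_code x y z \<longrightarrow> x = y \<and> y = z"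
  "\<forall>x\<in>set code_H. \<forall>y\<in>set code_H. \<forall>z\<in>set code_H. same_unions_code x y z \<longrightarrow> x = y \<and> y = z"
  "\<forall>x\<in>set code_H. \<forall>y\<in>set code_H. \<forall>z\<in>set code_G. \<not> same_unions_code x y z"
  "\<forall>x\<in>set code_G. length x = 7" "\<forall>x\<in>set code_H. length x = 7"
  "distinct code_G" "distinct code_H"
  by code_simp+

lemma compatible_codes: "compatible (positions ` set code_G) (positions ` set code_H)"
proof -
  have eq: "same_unions_code x y z"
    if "x \<in> set code_G \<union> set code_H" "y \<in> set code_G \<union> set code_H" "z \<in> set code_G \<union> set code_H"
      "same_unions (positions x) (positions y) (positions z)" for x y z
    by (rule same_unions_code) (use that code_checks(4,5) in auto)
  have free: "triple_free (positions ` A)"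
    if A: "A \<subseteq> set code_G \<union> set code_H"
      and chk: "\<forall>x\<in>A. \<forall>y\<in>A. \<forall>z\<in>A. same_unions_code x y z \<longrightarrow> x = y \<and> y = z" for A
    unfolding triple_free_def
  proof (intro ballI impI)
    fix X Y Z assume XYZ: "X \<in> positions ` A" "Y \<in> positions ` A" "Z \<in> positions ` A" "same_unions X Y Z"
    then obtain x y z where xyz: "x \<in> A" "y \<in> A" "z \<in> A" "X = positions x" "Y = positions y" "Z = positions z"
      by blast
    then have "same_unions_code x y z" using eq[of x y z] A XYZ(4) by blast
    then show "X = Y \<and> Y = Z" using chk xyz by blast
  qed
  show ?thesis
    unfolding compatible_def
  proof (intro conjI ballI notI)
    show "triple_free (positions ` set code_G)" by (rule free[OF _ code_checks(1)]) simp
    show "triple_free (positions ` set code_H)" by (rule free[OF _ code_checks(2)]) simp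
    fix X Y Z assume XYZ: "X \<in> positions ` set code_H" "Y \<in> positions ` set code_H"
      "Z \<in> positions ` set code_G" "same_unions X Y Z"
    then obtain x y z where xyz: "x \<in> set code_H" "y \<in> set code_H" "z \<in> set code_G"
      "X = positions x" "Y = positions y" "Z = positions z"
      by blast
    then have "same_unions_code x y z" using eq[of x y z] XYZ(4) by blast
    then show False using code_checks(3) xyz by blast
  qed
qed

lemma sum_code:
  fixes P :: "nat set \<Rightarrow> real"
  assumes "distinct c" "\<forall>x\<in>set c. length x = 7"
  shows "(\<Sum>S\<in>positions ` set c. P S) = (\<Sum>x\<leftarrow>c. P (positions x))"
proof -
  have "inj_on positions (set c)" using assms(2) inj_positions by (intro inj_onI) auto
  then show ?thesis using assms(1) by (simp add: sum.reindex sum.distinct_set_conv_list)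
qed

lemma prod_code:
  assumes "length x = 7"
  shows "(\<Prod>j\<in>{..<7}. if j \<in> positions x then a j else b j)
    = ((\<Prod>j<6. if x ! j then a j else b j) * (if x ! 6 then a 6 else b 6) :: real)"
proof -
  have "{..<7} = insert 6 {..<6 :: nat}" by auto
  then show ?thesis using assms by (simp add: positions_def mult.commute)
qed

lemma prod_bool_list:
  "(\<Prod>j<length x. if x ! j then g else h) = (g ^ length (filter id x) * h ^ length (filter Not x) :: real)"
proof (induction x)
  case (Cons c x)
  have "(\<Prod>j<length (c # x). if (c # x) ! j then g else h)
      = (if c then g else h) * (\<Prod>j<length x. if x ! j then g else h)"
    by (simp only: length_Cons prod.lessThan_Suc_shift nth_Cons_0 nth_Cons_Suc o_def)
  then show ?case unfolding Cons.IH by (simp add: id_def)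
qed simp

text \<open>Each of the first six positions contributes \<open>g\<close> or \<open>h\<close>, while
  position 6 is a plain point contributing \<open>s\<close> or 1. Thus a triple with the point 6
  gives \<open>s * g^3 * h^3\<close>, the full six-set \<open>g^6\<close>, a pair with the point 6
  gives \<open>s * g * h^5\<close>, and a block \<open>g^3 * h^3\<close>.\<close>

lemma code_weights:
  fixes g h s :: real
  defines "a \<equiv> \<lambda>j :: nat. if j < 6 then g else s" and "b \<equiv> \<lambda>j :: nat. if j < 6 then h else 1"
  shows "(\<Sum>S\<in>positions ` set code_G. \<Prod>j\<in>{..<7}. if j \<in> S then a j else b j) = 10 * s * g ^ 3 * h ^ 3 + g ^ 6"
    and "(\<Sum>S\<in>positions ` set code_H. \<Prod>j\<in>{..<7}. if j \<in> S then a j else b j) = 6 * s * g * h ^ 5 + 10 * g ^ 3 * h ^ 3"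
proof -
  have *: "(\<Prod>j\<in>{..<7}. if j \<in> positions x then a j else b j)
      = g ^ length (filter id (take 6 x)) * h ^ length (filter Not (take 6 x)) * (if x ! 6 then s else 1)"
    if "length x = 7" for x
  proof -
    have "(\<Prod>j<6. if x ! j then a j else b j) = (\<Prod>j<length (take 6 x). if take 6 x ! j then g else h)"
      using that by (intro prod.cong) (auto simp: a_def b_def)
    then show ?thesis
      unfolding prod_code[OF that] prod_bool_list by (simp add: a_def b_def)
  qed
  have len: "map (\<lambda>x. \<Prod>j\<in>{..<7}. if j \<in> positions x then a j else b j) c
      = map (\<lambda>x. g ^ length (filter id (take 6 x)) * h ^ length (filter Not (take 6 x)) * (if x ! 6 then s else 1)) c"
    if "\<forall>x\<in>set c. length x = 7" for c
    using that * by (intro map_cong) auto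
  show "(\<Sum>S\<in>positions ` set code_G. \<Prod>j\<in>{..<7}. if j \<in> S then a j else b j) = 10 * s * g ^ 3 * h ^ 3 + g ^ 6"
    unfolding sum_code[OF code_checks(6,4)] len[OF code_checks(4)]
      by (simp add: code_G_def Let_def eval_nat_numeral mult_ac)
  show "(\<Sum>S\<in>positions ` set code_H. \<Prod>j\<in>{..<7}. if j \<in> S then a j else b j) = 6 * s * g * h ^ 5 + 10 * g ^ 3 * h ^ 3"
    unfolding sum_code[OF code_checks(7,5)] len[OF code_checks(5)]
      by (simp add: code_H_def Let_def eval_nat_numeral mult_ac)
qed

section \<open>Iteration of the codes\<close>

definition two_type :: "'a itself \<Rightarrow> real \<Rightarrow> real \<Rightarrow> real \<Rightarrow> bool" where
  "two_type _ m g h \<longleftrightarrow> (\<exists>(I :: 'a set) w G H. finite I \<and> (\<forall>i\<in>I. 0 \<le> w i) \<and> G \<subseteq> Pow I \<and> H \<subseteq> Pow I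
     \<and> compatible G H \<and> sum w I = m \<and> g \<le> fam_weight w G \<and> h \<le> fam_weight w H)"

lemma compatible_singletons: "compatible {{x}} {{}}"
  by (simp add: compatible_def triple_free_def same_unions_def)

lemma compatible_disjoint: "compatible G H \<Longrightarrow> G \<inter> H = {}"
  unfolding compatible_def same_unions_def by blast

lemma two_type_unit: "0 \<le> t \<Longrightarrow> two_type TYPE(unit) t t 1"
  unfolding two_type_def
  by (intro exI[of _ "{()}"] exI[of _ "\<lambda>_. t"] exI[of _ "{{()}}"] exI[of _ "{{}}"])
    (simp add: compatible_singletons fam_weight_def)

lemma two_type_mono:
  assumes "two_type T m g h" "g' \<le> g" "h' \<le> h"
  shows "two_type T m g' h'"
proof -
  obtain I :: "'a set" and w G H where "finite I" "\<forall>i\<in>I. 0 \<le> w i" "G \<subseteq> Pow I" "H \<subseteq> Pow I"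
    "compatible G H" "sum w I = m" "g \<le> fam_weight w G" "h \<le> fam_weight w H"
    using assms(1) unfolding two_type_def by blast
  moreover from this have "g' \<le> fam_weight w G" "h' \<le> fam_weight w H" using assms(2,3) by auto
  ultimately show ?thesis unfolding two_type_def by blast
qed

text \<open>Six positions receive copies of the current pair and the seventh a fresh point of weight
  \<open>s\<close>; this explains the mass \<open>6 * m + s\<close> and the polynomials of
  \<open>code_weights\<close>.\<close>

lemma two_type_step:
  assumes "two_type TYPE('a) m g h" "0 \<le> g" "0 \<le> h" "0 \<le> s"
  shows "two_type TYPE(nat \<times> 'a) (6 * m + s) (10 * s * g ^ 3 * h ^ 3 + g ^ 6) (6 * s * g * h ^ 5 + 10 * g ^ 3 * h ^ 3)"
proof -
  obtain I :: "'a set" and w G H where I: "finite I" "\<forall>i\<in>I. 0 \<le> w i" "G \<subseteq> Pow I" "H \<subseteq> Pow I"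
    "compatible G H" "sum w I = m" "g \<le> fam_weight w G" "h \<le> fam_weight w H"
    using assms(1) unfolding two_type_def by blast
  \<comment> \<open>\<open>undefined\<close> merely names a point of the type \<open>'a\<close>;
    with position 6 as first component it is distinct from the points of the six copies.\<close>
  define I' where "I' j = (if j < 6 then I else {undefined})" for j :: nat
  define G' where "G' j = (if j < 6 then G else {{undefined}})" for j :: nat
  define H' where "H' j = (if j < 6 then H else {{}})" for j :: nat
  define w' where "w' j = (if j < 6 then w else (\<lambda>_. s))" for j :: nat
  have comp: "compatible (G' j) (H' j)" for j
    by (simp add: G'_def H'_def I(5) compatible_singletons)
  have GI: "G' j \<subseteq> Pow (I' j)" "H' j \<subseteq> Pow (I' j)" "finite (I' j)" for j
    using I(1,3,4) by (auto simp: G'_def H'_def I'_def)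
  have codes: "positions ` set code_G \<subseteq> Pow {..<7}" "positions ` set code_H \<subseteq> Pow {..<7}"
    using code_checks(4,5) by (auto simp: positions_def)
  let ?a = "\<lambda>j :: nat. if j < 6 then fam_weight w G else s"
  let ?b = "\<lambda>j :: nat. if j < 6 then fam_weight w H else 1"
  have wG: "fam_weight (w' j) (G' j) = ?a j" and wH: "fam_weight (w' j) (H' j) = ?b j" for j
    by (auto simp: w'_def G'_def H'_def fam_weight_def)
  have W: "fam_weight (\<lambda>(j, x). w' j x) (compose {..<7} I' G' H' C)
      = (\<Sum>S\<in>C. \<Prod>j\<in>{..<7}. if j \<in> S then ?a j else ?b j)" if "C \<subseteq> Pow {..<7}" for C
    using fam_weight_compose[of "{..<7}" I' G' H' C w'] GI that compatible_disjoint[OF comp]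
    unfolding wG wH by simp
  show ?thesis
    unfolding two_type_def
  proof (intro exI conjI)
    show "finite (Sigma {..<7} I')" using GI(3) by simp
    show "\<forall>i\<in>Sigma {..<7} I'. 0 \<le> (case i of (j, x) \<Rightarrow> w' j x)"
      using I(2) assms(4) by (auto simp: I'_def w'_def)
    show "compose {..<7} I' G' H' (positions ` set code_G) \<subseteq> Pow (Sigma {..<7} I')"
      "compose {..<7} I' G' H' (positions ` set code_H) \<subseteq> Pow (Sigma {..<7} I')"
      by (auto simp: compose_def)
    show "compatible (compose {..<7} I' G' H' (positions ` set code_G)) (compose {..<7} I' G' H' (positions ` set code_H))"
      by (rule compatible_compose[OF comp compatible_codes codes])
    have "(\<Sum>i\<in>Sigma {..<7} I'. case i of (j, x) \<Rightarrow> w' j x) = (\<Sum>j<7. \<Sum>x\<in>I' j. w' j x)"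
      using GI(3) by (simp add: sum.Sigma)
    also have "\<dots> = 6 * m + s"
      by (simp add: eval_nat_numeral lessThan_Suc I'_def w'_def I(6))
    finally show "(\<Sum>i\<in>Sigma {..<7} I'. case i of (j, x) \<Rightarrow> w' j x) = 6 * m + s" .
    show "10 * s * g ^ 3 * h ^ 3 + g ^ 6 \<le> fam_weight (\<lambda>(j, x). w' j x) (compose {..<7} I' G' H' (positions ` set code_G))"
      unfolding W[OF codes(1)] code_weights(1) using assms(2-4) I(7,8)
      by (intro add_mono mult_mono power_mono) auto
    show "6 * s * g * h ^ 5 + 10 * g ^ 3 * h ^ 3 \<le> fam_weight (\<lambda>(j, x). w' j x) (compose {..<7} I' G' H' (positions ` set code_H))"
      unfolding W[OF codes(2)] code_weights(2) using assms(2-4) I(7,8)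
      by (intro add_mono mult_mono power_mono) auto
  qed
qed

lemma two_type_gamma:
  assumes "two_type T m g h"
  shows "h \<le> exp (lcm_gamma 3 * m)"
proof -
  obtain I :: "'a set" and w G H where I: "finite I" "\<forall>i\<in>I. 0 \<le> w i" "H \<subseteq> Pow I"
    "compatible G H" "sum w I = m" "h \<le> fam_weight w H"
    using assms unfolding two_type_def by blast
  have "free_antichain 3 H"
    using I(4) by (intro triple_free_imp_free_antichain) (simp add: compatible_def)
  then have "fam_weight w H \<le> exp (lcm_gamma 3 * sum w I)"
    using I by (intro fam_weight_le_gamma) auto
  then show ?thesis using I(5,6) by simp
qed

text \<open>The starting mass \<open>7/8\<close> and the extra masses \<open>3/2\<close> are close to a numerical optimum for
  three steps of the recursion; the weights are rounded down after each step.\<close>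

lemma gamma_3_lower: "ln (1551 / 1000) < lcm_gamma 3"
proof (rule ccontr)
  assume neg: "\<not> ?thesis"
  have 1: "two_type TYPE(nat \<times> unit) (27 / 4) (104 / 10) (145 / 10)"
  proof -
    have "two_type TYPE(nat \<times> unit) (6 * (7 / 8) + 3 / 2)
        (10 * (3 / 2) * (7 / 8) ^ 3 * 1 ^ 3 + (7 / 8) ^ 6) (6 * (3 / 2) * (7 / 8) * 1 ^ 5 + 10 * (7 / 8) ^ 3 * 1 ^ 3)"
      by (intro two_type_step two_type_unit) auto
    then have "two_type TYPE(nat \<times> unit) (6 * (7 / 8) + 3 / 2) (104 / 10) (145 / 10)"
      by (rule two_type_mono) (simp_all add: eval_nat_numeral)
    then show ?thesis by simp
  qed
  have 2: "two_type TYPE(nat \<times> nat \<times> unit) 42 52000000 94000000"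
  proof -
    have "two_type TYPE(nat \<times> nat \<times> unit) (6 * (27 / 4) + 3 / 2) 52000000 94000000"
      by (rule two_type_mono[OF two_type_step[OF 1]]) (simp_all add: eval_nat_numeral)
    then show ?thesis by simp
  qed
  have 3: "two_type TYPE(nat \<times> nat \<times> nat \<times> unit) (507 / 2) 0 (3 * 10 ^ 48)"
  proof -
    have "two_type TYPE(nat \<times> nat \<times> nat \<times> unit) (6 * 42 + 3 / 2) 0 (3 * 10 ^ 48)"
      by (rule two_type_mono[OF two_type_step[OF 2]]) simp_all
    then show ?thesis by simp
  qed
  \<comment> \<open>Squaring clears the half in the mass \<open>507 / 2\<close>; the exponent 507
    then splits as \<open>39 * 13\<close>.\<close>
  have "(3 * 10 ^ 48) ^ 2 \<le> exp (lcm_gamma 3 * (507 / 2)) ^ 2"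
    using two_type_gamma[OF 3] by (intro power_mono) auto
  also have "\<dots> = exp (507 * lcm_gamma 3)" by (simp add: exp_of_nat_mult[symmetric])
  also have "\<dots> \<le> exp (real 507 * ln (1551 / 1000))" using neg by simp
  also have "\<dots> = ((1551 / 1000) ^ 39) ^ 13"
    by (simp only: exp_of_nat_mult) (simp add: power_mult[symmetric])
  \<comment> \<open>The 39th power of 1.551 is about 2.716e7, and the 13th power of the rounded
    value is about 4.5e96, below \<open>9 * 10 ^ 96\<close>.\<close>
  also have "\<dots> \<le> 27200000 ^ 13" by (intro power_mono) (simp_all add: power_divide)
  finally show False by simp
qed

section \<open>Stirling's formula and numerical bounds\<close>

definition stirling_error :: "nat \<Rightarrow> real" where
  "stirling_error n = ln (fact n) - (real n + 1 / 2) * ln (real n) + real n"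

text \<open>For \<open>x = (n + 1) / n\<close> and \<open>y = 1 / (2 * n + 1)\<close> one has
  \<open>ln x = 2 artanh y\<close>, and the difference is \<open>ln x / (2 * y) - 1\<close>. The
  series bounds it by \<open>y^2 / (3 * (1 - y^2)) = 1 / (12 * n * (n + 1))\<close>, which
  telescopes.\<close>

lemma stirling_error_step:
  assumes "1 \<le> n"
  shows "0 \<le> stirling_error n - stirling_error (Suc n)"
    and "stirling_error n - stirling_error (Suc n) \<le> 1 / (12 * real n) - 1 / (12 * real (Suc n))"
proof -
  define x where "x = real (Suc n) / real n"
  define y where "y = 1 / (2 * real n + 1)"
  have x1: "1 < x" using assms by (simp add: x_def field_simps)
  have xy: "(x - 1) / (x + 1) = y" using assms by (simp add: x_def y_def field_simps)
  have y: "0 < y" "real n + 1 / 2 = 1 / (2 * y)" by (auto simp: y_def field_simps)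
  have b: "2 * y \<le> ln x" "ln x \<le> 2 * y + 2 * (y ^ 3 / (1 - y\<^sup>2) / 3)"
    using ln_approx_bounds[OF x1, of 1] by (simp_all add: xy)
  have diff: "stirling_error n - stirling_error (Suc n) = (real n + 1 / 2) * ln x - 1"
  proof -
    have "ln x = ln (real (Suc n)) - ln (real n)"
      unfolding x_def using assms by (intro ln_divide_pos) auto
    moreover have "ln (fact (Suc n) :: real) = ln (real (Suc n)) + ln (fact n)"
      unfolding fact_Suc by (subst ln_mult_pos) auto
    ultimately have "ln (real (Suc n)) = ln x + ln (real n)"
      "ln (fact (Suc n) :: real) = (ln x + ln (real n)) + ln (fact n)" by simp_all
    then show ?thesis
      unfolding stirling_error_def by (simp add: algebra_simps del: fact_Suc of_nat_Suc) (simp add: algebra_simps)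
  qed
  have "1 / (2 * y) * (2 * y) \<le> 1 / (2 * y) * ln x" using b(1) y(1) by (intro mult_left_mono) auto
  then show "0 \<le> stirling_error n - stirling_error (Suc n)" using y diff by simp
  have y2: "y\<^sup>2 < 1" using assms by (simp add: y_def power_divide) 
  have "1 / (2 * y) * ln x \<le> 1 / (2 * y) * (2 * y + 2 * (y ^ 3 / (1 - y\<^sup>2) / 3))"
    using b(2) y(1) by (intro mult_left_mono) auto
  also have "\<dots> = 1 + y\<^sup>2 / (3 * (1 - y\<^sup>2))"
    using y(1) y2 by (simp add: field_simps power2_eq_square power3_eq_cube)
  also have "y\<^sup>2 / (3 * (1 - y\<^sup>2)) = 1 / (12 * real n * real (Suc n))"
  proof -
    have "1 - y\<^sup>2 = 4 * real n * real (Suc n) * y\<^sup>2"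
    proof -
      have "y * (2 * real n + 1) = 1" by (simp add: y_def)
      then have "(y * (2 * real n + 1))\<^sup>2 = 1" by simp
      then show ?thesis by (simp add: power2_eq_square algebra_simps)
    qed
    then show ?thesis using y(1) by simp
  qed
  finally show "stirling_error n - stirling_error (Suc n) \<le> 1 / (12 * real n) - 1 / (12 * real (Suc n))"
    unfolding diff y(2) using assms by (simp add: field_simps)
qed

text \<open>The error decreases, whereas the error minus \<open>1 / (12 * n)\<close> increases, and
  both have the same limit.\<close>

lemma stirling_error_limit:
  obtains c where "stirling_error \<longlonglongrightarrow> c"
    "\<And>n. 1 \<le> n \<Longrightarrow> c \<le> stirling_error n \<and> stirling_error n \<le> c + 1 / (12 * real n)"
proof -
  define d where "d n = stirling_error (Suc n)" for n
  define e where "e n = d n - 1 / (12 * real (Suc n))" for n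
  have dec: "decseq d"
    unfolding decseq_Suc_iff
  proof
    fix n show "d (Suc n) \<le> d n" using stirling_error_step(1)[of "Suc n"] by (simp add: d_def)
  qed
  have inc: "incseq e"
    unfolding incseq_Suc_iff
  proof
    fix n show "e n \<le> e (Suc n)"
      using stirling_error_step(2)[of "Suc n"] unfolding e_def d_def by linarith
  qed
  have "d 0 - 1 / 12 \<le> d n" for n
  proof -
    have "e 0 \<le> e n" using inc by (simp add: incseqD)
    also have "e n \<le> d n" by (simp add: e_def)
    finally show ?thesis by (simp add: e_def)
  qed
  then obtain c where c: "d \<longlonglongrightarrow> c" "\<And>n. c \<le> d n"
    using decseq_convergent[OF dec] by blast
  have "(\<lambda>n. 1 / (12 * real (Suc n))) \<longlonglongrightarrow> 0" by real_asymp
  then have "e \<longlonglongrightarrow> c - 0" unfolding e_def by (intro tendsto_diff c(1))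
  then have ele: "e n \<le> c" for n using incseq_le[OF inc] by simp
  show ?thesis
  proof (rule that)
    show "stirling_error \<longlonglongrightarrow> c"
      using c(1) unfolding d_def by (rule LIMSEQ_imp_Suc)
    fix n :: nat assume "1 \<le> n"
    then obtain m where "n = Suc m" by (cases n) auto
    then show "c \<le> stirling_error n \<and> stirling_error n \<le> c + 1 / (12 * real n)"
      using c(2)[of m] ele[of m] by (simp add: d_def e_def)
  qed
qed

lemma wallis_product_fact:
  "(\<Prod>k=1..n. (4 * (real k)\<^sup>2) / (4 * (real k)\<^sup>2 - 1))
    = (2 ^ n * fact n) ^ 4 / ((fact (2 * n))\<^sup>2 * (2 * real n + 1))"
proof (induction n)
  case (Suc n)
  have f: "fact (2 * Suc n) = (2 * real n + 2) * (2 * real n + 1) * fact (2 * n)"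
    by (simp add: algebra_simps)
  have nz: "4 * (real (Suc n))\<^sup>2 - 1 = (2 * real n + 1) * (2 * real n + 3)"
    by (simp add: power2_eq_square algebra_simps)
  have "(\<Prod>k=1..Suc n. (4 * (real k)\<^sup>2) / (4 * (real k)\<^sup>2 - 1))
      = (2 ^ n * fact n) ^ 4 / ((fact (2 * n))\<^sup>2 * (2 * real n + 1)) * ((4 * (real (Suc n))\<^sup>2) / ((2 * real n + 1) * (2 * real n + 3)))"
    by (subst prod.cl_ivl_Suc) (simp only: Suc.IH nz, simp)
  also have "\<dots> = (2 ^ Suc n * fact (Suc n)) ^ 4 / ((fact (2 * Suc n))\<^sup>2 * (2 * real (Suc n) + 1))"
  proof -
    have gen: "A ^ 4 / (B\<^sup>2 * x) * ((4 * z\<^sup>2) / (x * y)) = (2 * z * A) ^ 4 / ((2 * z * x * B)\<^sup>2 * y)"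
      if "z \<noteq> 0" "x \<noteq> 0" "y \<noteq> 0" "B \<noteq> 0" for A B x y z :: real
      using that by (simp add: field_simps power2_eq_square power4_eq_xxxx)
    have e1: "(2 ^ Suc n * fact (Suc n) :: real) = 2 * (real n + 1) * (2 ^ n * fact n)"
      by (simp add: algebra_simps)
    have e2: "(fact (2 * Suc n) :: real) = 2 * (real n + 1) * (2 * real n + 1) * fact (2 * n)"
      unfolding f by (simp add: algebra_simps)
    have e3: "2 * real (Suc n) + 1 = 2 * real n + 3" "real (Suc n) = real n + 1" by simp_all
    show ?thesis
      unfolding e1 e2 e3(1) unfolding e3(2) by (rule gen) (simp_all add: add_nonneg_eq_0_iff)
  qed
  finally show ?case .
qed simp

text \<open>Wallis' product compares the errors at \<open>n\<close> and \<open>2 * n\<close>; the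
  leading terms cancel and leave \<open>4 * c - 2 * c + ln (1 / 4) = ln (pi / 2)\<close>.\<close>

lemma stirling_error_const:
  assumes "stirling_error \<longlonglongrightarrow> c"
  shows "c = ln (2 * pi) / 2"
proof -
  let ?P = "\<lambda>n. \<Prod>k=1..n. (4 * (real k)\<^sup>2) / (4 * (real k)\<^sup>2 - 1)"
  have "(\<lambda>n. ln (?P n)) \<longlonglongrightarrow> ln (pi / 2)"
    by (intro tendsto_ln wallis) simp
  moreover have "\<forall>\<^sub>F n in sequentially. ln (?P n)
      = 4 * stirling_error n - 2 * stirling_error (2 * n) + ln (real n / (2 * (2 * real n + 1)))"
    using eventually_ge_at_top[of 1]
  proof eventually_elim
    case (elim n)
    have "ln (?P n) = 4 * (real n * ln 2 + ln (fact n)) - (2 * ln (fact (2 * n)) + ln (2 * real n + 1))"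
      unfolding wallis_product_fact
      by (simp add: ln_div ln_mult ln_realpow)
    moreover have "ln (real (2 * n)) = ln 2 + ln (real n)" using elim by (simp add: ln_mult)
    moreover have "ln (real n / (2 * (2 * real n + 1))) = ln (real n) - (ln 2 + ln (2 * real n + 1))"
      using elim by (subst ln_mult_pos[symmetric]) (auto intro!: ln_divide_pos)
    ultimately show ?case by (simp add: stirling_error_def algebra_simps)
  qed
  ultimately have 1: "(\<lambda>n. 4 * stirling_error n - 2 * stirling_error (2 * n) + ln (real n / (2 * (2 * real n + 1)))) \<longlonglongrightarrow> ln (pi / 2)"
    by (rule Lim_transform_eventually)
  have "(\<lambda>n. stirling_error (2 * n)) \<longlonglongrightarrow> c"
    using LIMSEQ_subseq_LIMSEQ[OF assms, of "\<lambda>n. 2 * n"] by (simp add: strict_mono_def o_def)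
  moreover have "(\<lambda>n. ln (real n / (2 * (2 * real n + 1)))) \<longlonglongrightarrow> ln (1 / 4)" by real_asymp
  ultimately have "(\<lambda>n. 4 * stirling_error n - 2 * stirling_error (2 * n) + ln (real n / (2 * (2 * real n + 1))))
      \<longlonglongrightarrow> 4 * c - 2 * c + ln (1 / 4)"
    using assms by (intro tendsto_add tendsto_diff tendsto_mult tendsto_const)
  from LIMSEQ_unique[OF 1 this] have "2 * c = ln (pi / 2) - ln (1 / 4)" by simp
  also have "\<dots> = ln (pi / 2 / (1 / 4))" by (rule ln_divide_pos[symmetric]) auto
  also have "\<dots> = ln (2 * pi)" by (simp add: mult.commute)
  finally show ?thesis by simp
qed

text \<open>Taking logarithms reduces the bound to Stirling's formula divided by \<open>r\<close>;
  the half logarithm and the constant combine to \<open>ln (2 * pi * r) / (2 * r)\<close>.\<close>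

lemma uniform_bound_eq_exp:
  assumes "1 \<le> r"
  obtains u where "real r / (exp 1 * root r (fact r)) = exp (- u)"
    "ln (2 * pi * real r) / (2 * real r) \<le> u"
    "u \<le> ln (2 * pi * real r) / (2 * real r) + 1 / (12 * (real r)\<^sup>2)"
proof -
  define u where "u = ln (fact r) / real r - ln (real r) + 1"
  obtain c where c: "stirling_error \<longlonglongrightarrow> c"
    "c \<le> stirling_error r" "stirling_error r \<le> c + 1 / (12 * real r)"
    using stirling_error_limit assms by metis
  have ln2: "ln (2 * pi * real r) = 2 * c + ln (real r)"
    unfolding stirling_error_const[OF c(1)] using assms by (simp add: ln_mult)
  have u: "u = ln (2 * pi * real r) / (2 * real r) + (stirling_error r - c) / real r"
    unfolding ln2 using assms by (simp add: u_def stirling_error_def field_simps)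
  show ?thesis
  proof (rule that)
    have "root r (fact r) = exp (ln (fact r) / real r)"
      using assms by (simp add: root_powr_inverse powr_def field_simps)
    then have "real r / (exp 1 * root r (fact r)) = exp (ln (real r)) / (exp 1 * exp (ln (fact r) / real r))"
      using assms by simp
    also have "\<dots> = exp (- u)"
      by (simp add: u_def exp_diff[symmetric] exp_add[symmetric] algebra_simps)
    finally show "real r / (exp 1 * root r (fact r)) = exp (- u)" .
    show "ln (2 * pi * real r) / (2 * real r) \<le> u" unfolding u using c(2) assms by simp
    have "(stirling_error r - c) / real r \<le> (1 / (12 * real r)) / real r"
      using c(3) by (intro divide_right_mono) auto
    then show "u \<le> ln (2 * pi * real r) / (2 * real r) + 1 / (12 * (real r)\<^sup>2)"
      unfolding u by (simp add: power2_eq_square)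
  qed
qed

lemma exp_minus_bounds:
  assumes "0 \<le> (u::real)"
  shows "1 - u \<le> exp (- u)" "exp (- u) \<le> 1 - u + u\<^sup>2"
proof -
  show "1 - u \<le> exp (- u)" using exp_ge_add_one_self[of "- u"] by simp
  \<comment> \<open>The product equals \<open>1 + u^3\<close>.\<close>
  have "1 \<le> (1 - u + u\<^sup>2) * (1 + u)"
    using assms by (simp add: algebra_simps power2_eq_square)
  also have "\<dots> \<le> (1 - u + u\<^sup>2) * exp u"
  proof (rule mult_left_mono)
    have "0 \<le> (1 - u / 2)\<^sup>2 + 3 / 4 * u\<^sup>2" by simp
    then show "0 \<le> 1 - u + u\<^sup>2" by (simp add: power2_eq_square algebra_simps)
  qed (rule exp_ge_add_one_self)
  finally show "exp (- u) \<le> 1 - u + u\<^sup>2" by (simp add: exp_minus field_simps)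
qed

lemma uniform_bound_error:
  assumes "1 \<le> r"
  shows "\<bar>real r / (exp 1 * root r (fact r)) - (1 - ln (2 * pi * real r) / (2 * real r))\<bar>
    \<le> 1 / (12 * (real r)\<^sup>2) + (ln (2 * pi * real r) / (2 * real r) + 1 / (12 * (real r)\<^sup>2))\<^sup>2"
proof -
  let ?l = "ln (2 * pi * real r) / (2 * real r)"
  obtain u where u: "real r / (exp 1 * root r (fact r)) = exp (- u)" "?l \<le> u" "u \<le> ?l + 1 / (12 * (real r)\<^sup>2)"
    using uniform_bound_eq_exp[OF assms] .
  have "1 \<le> 2 * pi * real r"
    using assms pi_gt3 mult_mono[of 1 "2 * pi" 1 "real r"] by simp
  then have "0 \<le> ?l" by simp
  then have u0: "0 \<le> u" using u(2) by simp
  have "u\<^sup>2 \<le> (?l + 1 / (12 * (real r)\<^sup>2))\<^sup>2" using u(3) u0 by (intro power_mono)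
  then show ?thesis
    unfolding u(1) using exp_minus_bounds[OF u0] u(2,3) by (simp add: abs_le_iff) 
qed

lemma uniform_bound_bigo:
  "(\<lambda>r. real r / (exp 1 * root r (fact r)) - (1 - ln (2 * pi * real r) / (2 * real r)))
     \<in> O(\<lambda>r. (ln (real r))\<^sup>2 / (real r)\<^sup>2)"
proof -
  let ?h = "\<lambda>r. 1 / (12 * (real r)\<^sup>2) + (ln (2 * pi * real r) / (2 * real r) + 1 / (12 * (real r)\<^sup>2))\<^sup>2"
  have "(\<lambda>r. real r / (exp 1 * root r (fact r)) - (1 - ln (2 * pi * real r) / (2 * real r))) \<in> O(?h)"
  proof (rule bigoI[of _ 1])
    show "\<forall>\<^sub>F r in sequentially. norm (real r / (exp 1 * root r (fact r)) - (1 - ln (2 * pi * real r) / (2 * real r)))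
        \<le> 1 * norm (?h r)"
      using eventually_ge_at_top[of 1]
    proof eventually_elim
      case (elim r)
      then show ?case using uniform_bound_error[OF elim] by simp
    qed
  qed
  also have "?h \<in> O(\<lambda>r. (ln (real r))\<^sup>2 / (real r)\<^sup>2)" by real_asymp
  finally show ?thesis .
qed

lemma uniform_bound_limit: "(\<lambda>r. real r / (exp 1 * root r (fact r))) \<longlonglongrightarrow> 1"
proof -
  have small: "(\<lambda>r. (ln (real r))\<^sup>2 / (real r)\<^sup>2) \<in> o(\<lambda>_. 1 :: real)" by real_asymp
  have 1: "(\<lambda>r. real r / (exp 1 * root r (fact r)) - (1 - ln (2 * pi * real r) / (2 * real r))) \<longlonglongrightarrow> 0"
    using smalloD_tendsto[OF landau_o.big_small_trans[OF uniform_bound_bigo small]] by simp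
  have 2: "(\<lambda>r. 1 - ln (2 * pi * real r) / (2 * real r)) \<longlonglongrightarrow> 1" by real_asymp
  from tendsto_add[OF 1 2] show ?thesis by simp
qed

lemma ln_1551_bounds:
  "438899884 / 1000000000 \<le> ln (1551 / 1000 :: real)" "ln (1551 / 1000 :: real) < 438899885 / 1000000000"
  using ln_approx_bounds[of "1551 / 1000" 7] by (simp_all add: eval_nat_numeral)

text \<open>Cubing removes the fractional power: the cube is \<open>27 / 4\<close>, to be compared
  with cubes of rationals.\<close>

lemma cube_bounds:
  "889881574 / 1000000000 \<le> 3 / 2 powr (2 / 3) - (1 :: real)"
  "3 / 2 powr (2 / 3) - (1 :: real) < 889881575 / 1000000000"
proof -
  have cube: "(3 / 2 powr (2 / 3)) ^ 3 = (27 / 4 :: real)"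
    by (simp add: power_divide powr_power)
  show "889881574 / 1000000000 \<le> 3 / 2 powr (2 / 3) - (1 :: real)"
  proof -
    have "(1889881574 / 1000000000 :: real) ^ 3 \<le> (3 / 2 powr (2 / 3)) ^ 3"
      unfolding cube by (simp add: power3_eq_cube)
    then show ?thesis
      using power_le_imp_le_base[of "1889881574 / 1000000000 :: real" 2 "3 / 2 powr (2 / 3)"] by simp
  qed
  show "3 / 2 powr (2 / 3) - (1 :: real) < 889881575 / 1000000000"
  proof -
    have "(3 / 2 powr (2 / 3)) ^ 3 < (1889881575 / 1000000000 :: real) ^ 3"
      unfolding cube by (simp add: power3_eq_cube)
    then show ?thesis
      using power_less_imp_less_base[of "3 / 2 powr (2 / 3)" 3 "1889881575 / 1000000000 :: real"] by simp
  qed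
qed

theorem corollary1p2:
  shows
    "(\<forall>k\<ge>3.
        max (real (k - 2) / (exp 1 * root (k - 2) (fact (k - 2)))) (ln (sunflower_mu k))
          \<le> lcm_gamma k
        \<and> lcm_gamma k \<le> sunflower_mu k - 1
        \<and> sunflower_mu k - 1 \<le> 1)
     \<and> (gamma3_lower < lcm_gamma 3 \<and> lcm_gamma 3 \<le> gamma3_upper
        \<and> 0.438899884 \<le> gamma3_lower \<and> gamma3_lower < 0.438899885
        \<and> 0.889881574 \<le> gamma3_upper \<and> gamma3_upper < 0.889881575)
     \<and> mono_on {3..} lcm_gamma
     \<and> lcm_gamma \<longlonglongrightarrow> 1
     \<and> (\<forall>k\<ge>3. \<forall>r. r = k - 2 \<longrightarrow> lcm_gamma k \<ge> real r / (exp 1 * root r (fact r)))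
     \<and> (\<lambda>r. real r / (exp 1 * root r (fact r)) - (1 - ln (2 * pi * real r) / (2 * real r)))
          \<in> O(\<lambda>r. (ln (real r))\<^sup>2 / (real r)\<^sup>2)"
proof -
  have uniform: "real (k - 2) / (exp 1 * root (k - 2) (fact (k - 2))) \<le> lcm_gamma k" if "3 \<le> k" for k
  proof -
    have "1 \<le> k - 2" "k - 2 + 2 = k" using that by auto
    then show ?thesis using gamma_ge_uniform[of "k - 2"] by metis
  qed
  have upper: "lcm_gamma k \<le> 1" if "3 \<le> k" for k
    using gamma_le_mu[OF that] sunflower_mu_facts(4)[OF that] by linarith
  show ?thesis
  proof (intro conjI allI impI)
    fix k :: nat assume k: "3 \<le> k"
    show "max (real (k - 2) / (exp 1 * root (k - 2) (fact (k - 2)))) (ln (sunflower_mu k)) \<le> lcm_gamma k"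
      using uniform[OF k] ln_mu_le_gamma[OF k] by simp
    show "lcm_gamma k \<le> sunflower_mu k - 1" by (rule gamma_le_mu[OF k])
    show "sunflower_mu k - 1 \<le> 1" using sunflower_mu_facts(4)[OF k] by simp
    show "real r / (exp 1 * root r (fact r)) \<le> lcm_gamma k" if "r = k - 2" for r
      using uniform[OF k] that by simp
  next
    show "gamma3_lower < lcm_gamma 3" unfolding gamma3_lower_def by (rule gamma_3_lower)
    show "lcm_gamma 3 \<le> gamma3_upper"
      using gamma_le_mu[of 3] sunflower_mu_3_le by (simp add: gamma3_upper_def)
    show "0.438899884 \<le> gamma3_lower" "gamma3_lower < 0.438899885"
      using ln_1551_bounds by (simp_all add: gamma3_lower_def)
    show "0.889881574 \<le> gamma3_upper" "gamma3_upper < 0.889881575"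
      using cube_bounds by (simp_all add: gamma3_upper_def)
    show "mono_on {3..} lcm_gamma" by (rule lcm_gamma_mono)
    show "lcm_gamma \<longlonglongrightarrow> 1"
    \<comment> \<open>The shift by 3 corresponds to \<open>r = n + 1 \<ge> 1\<close> in the uniform
      bound.\<close>
    proof (rule LIMSEQ_offset[of _ 3])
      have low: "(\<lambda>n. real (n + 1) / (exp 1 * root (n + 1) (fact (n + 1)))) \<longlonglongrightarrow> 1"
        by (rule LIMSEQ_ignore_initial_segment[OF uniform_bound_limit, of 1])
      show "(\<lambda>n. lcm_gamma (n + 3)) \<longlonglongrightarrow> 1"
      proof (rule tendsto_sandwich[OF _ _ low tendsto_const])
        show "\<forall>\<^sub>F n in sequentially. real (n + 1) / (exp 1 * root (n + 1) (fact (n + 1))) \<le> lcm_gamma (n + 3)"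
        proof (intro always_eventually allI)
          fix n :: nat
          have "n + 1 + 2 = n + 3" by simp
          then show "real (n + 1) / (exp 1 * root (n + 1) (fact (n + 1))) \<le> lcm_gamma (n + 3)"
            using gamma_ge_uniform[of "n + 1"] by (metis le_add2)
        qed
        show "\<forall>\<^sub>F n in sequentially. lcm_gamma (n + 3) \<le> 1"
          using upper by simp
      qed
    qed
  qed (rule uniform_bound_bigo)
qed

end
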